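(* Let $M$ be a nonempty Riemannian manifold (of class $C^2$), $p\in[1,\infty)$ and $n\ge2$. Let $\mathbb{S}^n$ be the unit sphere with its round metric and let $\iota\colon\mathbb{S}^n\to\mathbb{R}^{\nu}$ be an isometric embedding with $\iota(\mathbb{S}^n)$ closed. Then the identity map $$i\colon(\dot W^{1,p}(M,\mathbb{S}^n),\delta_{1,p}^S)\to(\dot W^{1,p}(M,\mathbb{S}^n),\delta_{1,p}^\iota)$$ is not uniformly continuous, where $$\delta_{1,p}^S(u,v)=\Bigl(\int_M\bigl(d^S_{T^*M\otimes T\mathbb{S}^n}(Du,Dv)\bigr)^p\Bigr)^{1/p},\qquad\delta_{1,p}^\iota(u,v)=\Bigl(\int_M\bigl(|\iota\circ u-\iota\circ v|^2+|D(\iota\circ u)-D(\iota\circ v)|^2\bigr)^{p/2}\Bigr)^{1/p}.$$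
   Context: A map $u\colon M\to N$ between manifolds is colocally weakly differentiable if $u$ is measurable and $f\circ u$ is weakly differentiable for every $f\in C^1_c(N,\mathbb{R})$. Its colocal weak derivative is the (existing and almost everywhere unique) measurable bundle morphism $Du\colon TM\to TN$ covering $u$ such that for every $f\in C^1_c(N,\mathbb{R})$, $D(f\circ u)=Df\circ Du$ almost everywhere in $M$. For Riemannian $(M,g_M),(N,g_N)$, $\dot W^{1,p}(M,N)$ is the set of colocally weakly differentiable $u$ with $|Du|_{g_M^*\otimes g_N}\in L^p(M)$, where $|\cdot|_{g_M^*\otimes g_N}$ is the Hilbert–Schmidt norm; integrals are with respect to the Riemannian measure, and distances may take the value $\infty$. In $\delta^\iota_{1,p}$ the norm on linear maps $T_xM\to\mathbb{R}^{\nu}$ is the Hilbert–Schmidt norm. $T^*M\otimes TN$ is the vector bundle over $M\times N$ with fiber $\mathcal{L}(T_xM,T_yN)$ over $(x,y)$, with bundle metric $g_M^*\otimes g_N$ and the metric connection $K$ which is the tensor-product connection induced by the Levi-Civita connections of $M$ and $N$. For a vector bundle $\pi\colon E\to B$ over a Riemannian manifold $(B,g_B)$ with bundle metric $g_E$ and metric connection map $K_E\colon TE\to E$, the Sasaki metric on $E$ is the Riemannian metric whose quadratic form is $G_E^S(\nu)=g_B(D\pi(\nu))+g_E(K_E(\nu))$, $\nu\in TE$, and $d_E^S$ is its geodesic distance. Here $B=M\times\mathbb{S}^n$ with the product metric and $E=T^*M\otimes T\mathbb{S}^n$; $d^S(Du,Dv)$ is the function $x\mapsto d^S(Du(x),D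v(x))$.
   Formalization: The manifold M is taken to have dimension at least 1; for a zero-dimensional M (for instance a single point) the second distance is bounded by the first, so the identity map is uniformly continuous and the claim fails. *)

theory Defs
  imports "HOL-Analysis.Analysis"
begin

subsection \<open>Functions of class C1 and C2 on open sets\<close>

definition C1_on :: "'a::euclidean_space set \<Rightarrow> ('a \<Rightarrow> 'b::real_normed_vector) \<Rightarrow> bool" where
  "C1_on S f \<longleftrightarrow>
     (\<exists>f' :: 'a \<Rightarrow> 'a \<Rightarrow>\<^sub>L 'b.
        (\<forall>z\<in>S. (f has_derivative blinfun_apply (f' z)) (at z)) \<and> continuous_on S f')"

definition C2_on :: "'a::euclidean_space set \<Rightarrow> ('a \<Rightarrow> 'b::real_normed_vector) \<Rightarrow> bool" where
  "C2_on S f \<longleftrightarrow>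
     (\<exists>f' :: 'a \<Rightarrow> 'a \<Rightarrow>\<^sub>L 'b.
        (\<forall>z\<in>S. (f has_derivative blinfun_apply (f' z)) (at z)) \<and> C1_on S f')"

subsection \<open>Riemannian manifolds\<close>

text \<open>
  A chart is a pair of its domain and its coordinate map.  As part of the data of a manifold
  with atlas, every point x comes with one distinguished chart around it, \<open>chart_at M x\<close>, and
  the tangent space at x is the model space, a vector being given by its components in that
  chart; \<open>tangent_change\<close> converts components from one chart to another.  Since all notions
  below are invariant under changes of charts, the distinguished charts are only a way of
  writing down tangent vectors.
  \<open>metric M x\<close> is the inner product on the tangent space at x.
\<close>

type_synonym ('p, 'm) chart = "'p set \<times> ('p \<Rightarrow> (real ^ 'm))"

definition chart_inv :: "('p, 'm) chart \<Rightarrow> (real ^ 'm) \<Rightarrow> 'p" where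
  "chart_inv c = inv_into (fst c) (snd c)"

definition chart_img :: "('p, 'm) chart \<Rightarrow> (real ^ 'm) set" where
  "chart_img c = snd c ` fst c"

definition tangent_change ::
  "('p, 'm::finite) chart \<Rightarrow> ('p, 'm) chart \<Rightarrow> 'p \<Rightarrow> (real ^ 'm) \<Rightarrow>\<^sub>L (real ^ 'm)" where
  "tangent_change c c' x = Blinfun (frechet_derivative (snd c' \<circ> chart_inv c) (at (snd c x)))"

record ('p, 'm) rmfd =
  carrier_top :: "'p topology"
  atlas :: "('p, 'm) chart set"
  chart_at :: "'p \<Rightarrow> ('p, 'm) chart"
  metric :: "'p \<Rightarrow> (real ^ 'm) \<Rightarrow> (real ^ 'm) \<Rightarrow> real"

abbreviation points :: "('p, 'm::finite) rmfd \<Rightarrow> 'p set" where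
  "points M \<equiv> topspace (carrier_top M)"

definition is_chart :: "'p topology \<Rightarrow> ('p, 'm::finite) chart \<Rightarrow> bool" where
  "is_chart X c \<longleftrightarrow>
     openin X (fst c) \<and> open (chart_img c) \<and>
     homeomorphic_map (subtopology X (fst c)) (top_of_set (chart_img c)) (snd c)"

text \<open>The matrix of the metric at the point with coordinates z in the chart c, as a bilinear form.\<close>

definition metric_in ::
  "('p, 'm::finite) rmfd \<Rightarrow> ('p, 'm) chart \<Rightarrow> (real ^ 'm) \<Rightarrow> (real ^ 'm) \<Rightarrow> (real ^ 'm) \<Rightarrow> real" where
  "metric_in M c z v w =
     (let x = chart_inv c z; T = tangent_change c (chart_at M x) x
      in metric M x (blinfun_apply T v) (blinfun_apply T w))"

text \<open>A manifold of class C2 carries a C2 atlas, and its metric has C1 components.\<close>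

definition riemannian_manifold :: "('p, 'm::finite) rmfd \<Rightarrow> bool" where
  "riemannian_manifold M \<longleftrightarrow>
     Hausdorff_space (carrier_top M) \<and> second_countable (carrier_top M) \<and>
     (\<forall>c\<in>atlas M. is_chart (carrier_top M) c) \<and>
     (\<forall>x\<in>points M. chart_at M x \<in> atlas M \<and> x \<in> fst (chart_at M x)) \<and>
     (\<forall>c\<in>atlas M. \<forall>c'\<in>atlas M. C2_on (snd c ` (fst c \<inter> fst c')) (snd c' \<circ> chart_inv c)) \<and>
     (\<forall>x\<in>points M. bilinear (metric M x) \<and>
        (\<forall>v w. metric M x v w = metric M x w v) \<and>
        (\<forall>v. v \<noteq> 0 \<longrightarrow> metric M x v v > 0)) \<and>
     (\<forall>c\<in>atlas M. \<forall>v w. C1_on (chart_img c) (\<lambda>z. metric_in M c z v w))"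

subsection \<open>Riemannian measure\<close>

definition lebesgue_sets :: "('p, 'm::finite) rmfd \<Rightarrow> 'p set set" where
  "lebesgue_sets M =
     {B. B \<subseteq> points M \<and> (\<forall>c\<in>atlas M. snd c ` (B \<inter> fst c) \<in> sets lebesgue)}"

definition chart_volume ::
  "('p, 'm::finite) rmfd \<Rightarrow> ('p, 'm) chart \<Rightarrow> 'p set \<Rightarrow> ennreal" where
  "chart_volume M c B =
     (\<integral>\<^sup>+ z \<in> snd c ` B.
        ennreal (sqrt (det (\<chi> i j. metric_in M c z (axis i 1) (axis j 1)))) \<partial>lebesgue)"

definition countable_atlas :: "('p, 'm::finite) rmfd \<Rightarrow> nat \<Rightarrow> ('p, 'm) chart" where
  "countable_atlas M =
     (SOME C. range C \<subseteq> atlas M \<and> (\<Union>i. fst (C i)) = points M)"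

text \<open>
  The local volumes are glued along the disjoint pieces
  \<open>fst (C i) - (\<Union>j<i. fst (C j))\<close> of a countable cover C by chart domains, which exists by
  second countability.  By the change of variables formula the result does not depend on C.
\<close>

definition riemannian_measure :: "('p, 'm::finite) rmfd \<Rightarrow> 'p measure" where
  "riemannian_measure M =
     (let C = countable_atlas M in
      measure_of (points M) (lebesgue_sets M)
        (\<lambda>B. \<Sum>i. chart_volume M (C i) (B \<inter> (fst (C i) - (\<Union>j<i. fst (C j))))))"

subsection \<open>Hilbert--Schmidt norm\<close>

definition orthonormal_basis ::
  "((real ^ 'm) \<Rightarrow> (real ^ 'm) \<Rightarrow> real) \<Rightarrow> (real ^ 'm::finite) set \<Rightarrow> bool" where
  "orthonormal_basis g B \<longleftrightarrow>
     finite B \<and> card B = CARD('m) \<and>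
     (\<forall>e\<in>B. \<forall>e'\<in>B. g e e' = (if e = e' then 1 else 0))"

text \<open>The value does not depend on the orthonormal basis.\<close>

definition hs_norm ::
  "((real ^ 'm) \<Rightarrow> (real ^ 'm) \<Rightarrow> real) \<Rightarrow> ('b \<Rightarrow> 'b \<Rightarrow> real) \<Rightarrow> ((real ^ 'm::finite) \<Rightarrow> 'b) \<Rightarrow> real" where
  "hs_norm g h L = sqrt (\<Sum>e\<in>(SOME B. orthonormal_basis g B). h (L e) (L e))"

subsection \<open>Weak derivatives of vector-valued functions on a manifold\<close>

definition locally_integrable_on ::
  "('a::euclidean_space \<Rightarrow> 'b::euclidean_space) \<Rightarrow> 'a set \<Rightarrow> bool" where
  "locally_integrable_on f S \<longleftrightarrow> (\<forall>K. compact K \<and> K \<subseteq> S \<longrightarrow> f absolutely_integrable_on K)"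

definition test_functions :: "'a::euclidean_space set \<Rightarrow> ('a \<Rightarrow> real) set" where
  "test_functions S =
     {\<phi>. C1_on UNIV \<phi> \<and> (\<exists>K. compact K \<and> K \<subseteq> S \<and> (\<forall>z. z \<notin> K \<longrightarrow> \<phi> z = 0))}"

text \<open>
  \<open>F x\<close> is a linear map on the tangent space at x; it is expressed in the chart c before it is
  tested against \<open>\<phi>\<close>.
\<close>

definition has_weak_derivative ::
  "('p, 'm::finite) rmfd \<Rightarrow> ('p \<Rightarrow> 'b::euclidean_space) \<Rightarrow> ('p \<Rightarrow> (real ^ 'm) \<Rightarrow>\<^sub>L 'b) \<Rightarrow> bool" where
  "has_weak_derivative M f F \<longleftrightarrow>
     (\<forall>c\<in>atlas M.
        let f\<^sub>c = (\<lambda>z. f (chart_inv c z));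
            F\<^sub>c = (\<lambda>z. let x = chart_inv c z in F x o\<^sub>L tangent_change c (chart_at M x) x)
        in locally_integrable_on f\<^sub>c (chart_img c) \<and>
           (\<forall>v. locally_integrable_on (\<lambda>z. blinfun_apply (F\<^sub>c z) v) (chart_img c)) \<and>
           (\<forall>\<phi>\<in>test_functions (chart_img c). \<forall>v.
              (LINT z:chart_img c|lebesgue. frechet_derivative \<phi> (at z) v *\<^sub>R f\<^sub>c z) =
              - (LINT z:chart_img c|lebesgue. \<phi> z *\<^sub>R blinfun_apply (F\<^sub>c z) v)))"

definition weakly_differentiable ::
  "('p, 'm::finite) rmfd \<Rightarrow> ('p \<Rightarrow> 'b::euclidean_space) \<Rightarrow> bool" where
  "weakly_differentiable M f \<longleftrightarrow> (\<exists>F. has_weak_derivative M f F)"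

text \<open>A representative of the almost everywhere unique weak derivative.\<close>

definition weak_derivative ::
  "('p, 'm::finite) rmfd \<Rightarrow> ('p \<Rightarrow> 'b::euclidean_space) \<Rightarrow> 'p \<Rightarrow> (real ^ 'm) \<Rightarrow>\<^sub>L 'b" where
  "weak_derivative M f = (SOME F. has_weak_derivative M f F)"

subsection \<open>Classical derivatives on a manifold\<close>

definition C1_map :: "('p, 'm::finite) rmfd \<Rightarrow> ('p \<Rightarrow> 'b::real_normed_vector) \<Rightarrow> bool" where
  "C1_map N f \<longleftrightarrow> (\<forall>c\<in>atlas N. C1_on (chart_img c) (f \<circ> chart_inv c))"

definition differential ::
  "('p, 'm::finite) rmfd \<Rightarrow> ('p \<Rightarrow> 'b::real_normed_vector) \<Rightarrow> 'p \<Rightarrow> (real ^ 'm) \<Rightarrow>\<^sub>L 'b" where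
  "differential N f y =
     Blinfun (frechet_derivative (f \<circ> chart_inv (chart_at N y)) (at (snd (chart_at N y) y)))"

definition C1_compact_support :: "('p, 'm::finite) rmfd \<Rightarrow> ('p \<Rightarrow> real) set" where
  "C1_compact_support N =
     {f. C1_map N f \<and> (\<exists>K. compactin (carrier_top N) K \<and> (\<forall>y\<in>points N - K. f y = 0))}"

subsection \<open>Colocal weak derivatives and homogeneous Sobolev spaces\<close>

definition measurable_map ::
  "('p, 'm::finite) rmfd \<Rightarrow> ('q, 'n::finite) rmfd \<Rightarrow> ('p \<Rightarrow> 'q) \<Rightarrow> bool" where
  "measurable_map M N u \<longleftrightarrow>
     u \<in> points M \<rightarrow> points N \<and>
     (\<forall>V. openin (carrier_top N) V \<longrightarrow> {x \<in> points M. u x \<in> V} \<in> lebesgue_sets M)"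

text \<open>
  An element of the fiber over (x,y) of the bundle of linear maps from tangent spaces of M to
  tangent spaces of N is a bounded linear map L between the model spaces; \<open>hom_in\<close> is its
  expression in the charts c and d.
\<close>

definition hom_in ::
  "('p, 'm::finite) rmfd \<Rightarrow> ('q, 'n::finite) rmfd \<Rightarrow> ('p, 'm) chart \<Rightarrow> ('q, 'n) chart \<Rightarrow>
   'p \<Rightarrow> 'q \<Rightarrow> ((real ^ 'm) \<Rightarrow>\<^sub>L (real ^ 'n)) \<Rightarrow> ((real ^ 'm) \<Rightarrow>\<^sub>L (real ^ 'n))" where
  "hom_in M N c d x y L =
     tangent_change (chart_at N y) d y o\<^sub>L L o\<^sub>L tangent_change c (chart_at M x) x"

text \<open>U is a measurable bundle morphism covering u.\<close>

definition measurable_morphism ::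
  "('p, 'm::finite) rmfd \<Rightarrow> ('q, 'n::finite) rmfd \<Rightarrow> ('p \<Rightarrow> 'q) \<Rightarrow>
   ('p \<Rightarrow> (real ^ 'm) \<Rightarrow>\<^sub>L (real ^ 'n)) \<Rightarrow> bool" where
  "measurable_morphism M N u U \<longleftrightarrow>
     measurable_map M N u \<and>
     (\<forall>c\<in>atlas M. \<forall>d\<in>atlas N. \<forall>V. open V \<longrightarrow>
        {x \<in> fst c. u x \<in> fst d \<and> hom_in M N c d x (u x) (U x) \<in> V} \<in> lebesgue_sets M)"

definition colocally_weakly_differentiable ::
  "('p, 'm::finite) rmfd \<Rightarrow> ('q, 'n::finite) rmfd \<Rightarrow> ('p \<Rightarrow> 'q) \<Rightarrow> bool" where
  "colocally_weakly_differentiable M N u \<longleftrightarrow>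
     measurable_map M N u \<and> (\<forall>f\<in>C1_compact_support N. weakly_differentiable M (f \<circ> u))"

definition has_colocal_weak_derivative ::
  "('p, 'm::finite) rmfd \<Rightarrow> ('q, 'n::finite) rmfd \<Rightarrow> ('p \<Rightarrow> 'q) \<Rightarrow>
   ('p \<Rightarrow> (real ^ 'm) \<Rightarrow>\<^sub>L (real ^ 'n)) \<Rightarrow> bool" where
  "has_colocal_weak_derivative M N u U \<longleftrightarrow>
     measurable_morphism M N u U \<and>
     (\<forall>f\<in>C1_compact_support N.
        has_weak_derivative M (f \<circ> u) (\<lambda>x. differential N f (u x) o\<^sub>L U x))"

definition colocal_weak_derivative ::
  "('p, 'm::finite) rmfd \<Rightarrow> ('q, 'n::finite) rmfd \<Rightarrow> ('p \<Rightarrow> 'q) \<Rightarrow>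
   'p \<Rightarrow> (real ^ 'm) \<Rightarrow>\<^sub>L (real ^ 'n)" where
  "colocal_weak_derivative M N u = (SOME U. has_colocal_weak_derivative M N u U)"

definition homogeneous_sobolev ::
  "('p, 'm::finite) rmfd \<Rightarrow> ('q, 'n::finite) rmfd \<Rightarrow> real \<Rightarrow> ('p \<Rightarrow> 'q) set" where
  "homogeneous_sobolev M N p =
     {u. colocally_weakly_differentiable M N u \<and>
         (\<integral>\<^sup>+ x. ennreal (hs_norm (metric M x) (metric N (u x))
              (blinfun_apply (colocal_weak_derivative M N u x)) powr p)
            \<partial>riemannian_measure M) < \<infinity>}"

subsection \<open>Sasaki metric and its geodesic distance\<close>

text \<open>Christoffel map of the Levi-Civita connection in a chart, by the Koszul formula.\<close>

definition christoffel ::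
  "('p, 'm::finite) rmfd \<Rightarrow> ('p, 'm) chart \<Rightarrow> (real ^ 'm) \<Rightarrow> (real ^ 'm) \<Rightarrow> (real ^ 'm) \<Rightarrow> (real ^ 'm)" where
  "christoffel M c z v w =
     (THE r. \<forall>q. metric_in M c z r q =
        (frechet_derivative (\<lambda>z. metric_in M c z w q) (at z) v +
         frechet_derivative (\<lambda>z. metric_in M c z v q) (at z) w -
         frechet_derivative (\<lambda>z. metric_in M c z v w) (at z) q) / 2)"

text \<open>
  Connection map K of the tensor product connection in the charts c and d, at the point
  (a, b, L) of the bundle and the vector \<open>(\<alpha>, \<beta>, \<Lambda>)\<close> tangent to the bundle.  The formula
  is the Leibniz rule \<open>(\<nabla> L) w = \<nabla> (L w) - L (\<nabla> w)\<close>.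
\<close>

definition connection_map ::
  "('p, 'm::finite) rmfd \<Rightarrow> ('q, 'n::finite) rmfd \<Rightarrow> ('p, 'm) chart \<Rightarrow> ('q, 'n) chart \<Rightarrow>
   (real ^ 'm) \<times> (real ^ 'n) \<times> ((real ^ 'm) \<Rightarrow>\<^sub>L (real ^ 'n)) \<Rightarrow>
   (real ^ 'm) \<times> (real ^ 'n) \<times> ((real ^ 'm) \<Rightarrow>\<^sub>L (real ^ 'n)) \<Rightarrow> (real ^ 'm) \<Rightarrow> (real ^ 'n)" where
  "connection_map M N c d = (\<lambda>(a, b, L) (\<alpha>, \<beta>, \<Lambda>) w.
     blinfun_apply \<Lambda> w + christoffel N d b \<beta> (blinfun_apply L w)
       - blinfun_apply L (christoffel M c a \<alpha> w))"

definition sasaki_form ::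
  "('p, 'm::finite) rmfd \<Rightarrow> ('q, 'n::finite) rmfd \<Rightarrow> ('p, 'm) chart \<Rightarrow> ('q, 'n) chart \<Rightarrow>
   (real ^ 'm) \<times> (real ^ 'n) \<times> ((real ^ 'm) \<Rightarrow>\<^sub>L (real ^ 'n)) \<Rightarrow>
   (real ^ 'm) \<times> (real ^ 'n) \<times> ((real ^ 'm) \<Rightarrow>\<^sub>L (real ^ 'n)) \<Rightarrow> real" where
  "sasaki_form M N c d = (\<lambda>(a, b, L) (\<alpha>, \<beta>, \<Lambda>).
     metric_in M c a \<alpha> \<alpha> + metric_in N d b \<beta> \<beta> +
     (hs_norm (metric_in M c a) (metric_in N d b)
        (connection_map M N c d (a, b, L) (\<alpha>, \<beta>, \<Lambda>)))\<^sup>2)"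

definition hom_coord ::
  "('p, 'm::finite) rmfd \<Rightarrow> ('q, 'n::finite) rmfd \<Rightarrow> ('p, 'm) chart \<Rightarrow> ('q, 'n) chart \<Rightarrow>
   'p \<times> 'q \<times> ((real ^ 'm) \<Rightarrow>\<^sub>L (real ^ 'n)) \<Rightarrow> (real ^ 'm) \<times> (real ^ 'n) \<times> ((real ^ 'm) \<Rightarrow>\<^sub>L (real ^ 'n))" where
  "hom_coord M N c d = (\<lambda>(x, y, L). (snd c x, snd d y, hom_in M N c d x y L))"

definition piecewise_C1_curve ::
  "('p, 'm::finite) rmfd \<Rightarrow> ('q, 'n::finite) rmfd \<Rightarrow>
   (real \<Rightarrow> 'p \<times> 'q \<times> ((real ^ 'm) \<Rightarrow>\<^sub>L (real ^ 'n))) \<Rightarrow> bool" where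
  "piecewise_C1_curve M N \<gamma> \<longleftrightarrow>
     (\<forall>t\<in>{0..1}. fst (\<gamma> t) \<in> points M \<and> fst (snd (\<gamma> t)) \<in> points N \<and>
        (let c = chart_at M (fst (\<gamma> t)); d = chart_at N (fst (snd (\<gamma> t))) in
         \<exists>\<epsilon>>0. (\<forall>s\<in>{0..1} \<inter> {t-\<epsilon>..t+\<epsilon>}. fst (\<gamma> s) \<in> fst c \<and> fst (snd (\<gamma> s)) \<in> fst d) \<and>
                (\<lambda>s. hom_coord M N c d (\<gamma> s)) piecewise_C1_differentiable_on
                  ({0..1} \<inter> {t-\<epsilon>..t+\<epsilon>})))"

definition sasaki_speed ::
  "('p, 'm::finite) rmfd \<Rightarrow> ('q, 'n::finite) rmfd \<Rightarrow>
   (real \<Rightarrow> 'p \<times> 'q \<times> ((real ^ 'm) \<Rightarrow>\<^sub>L (real ^ 'n))) \<Rightarrow> real \<Rightarrow> real" where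
  "sasaki_speed M N \<gamma> t =
     (let c = chart_at M (fst (\<gamma> t)); d = chart_at N (fst (snd (\<gamma> t))) in
      sqrt (sasaki_form M N c d (hom_coord M N c d (\<gamma> t))
              (vector_derivative (\<lambda>s. hom_coord M N c d (\<gamma> s)) (at t))))"

definition sasaki_length ::
  "('p, 'm::finite) rmfd \<Rightarrow> ('q, 'n::finite) rmfd \<Rightarrow>
   (real \<Rightarrow> 'p \<times> 'q \<times> ((real ^ 'm) \<Rightarrow>\<^sub>L (real ^ 'n))) \<Rightarrow> ennreal" where
  "sasaki_length M N \<gamma> = (\<integral>\<^sup>+ t\<in>{0..1}. ennreal (sasaki_speed M N \<gamma> t) \<partial>lborel)"

definition sasaki_dist ::
  "('p, 'm::finite) rmfd \<Rightarrow> ('q, 'n::finite) rmfd \<Rightarrow>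
   'p \<times> 'q \<times> ((real ^ 'm) \<Rightarrow>\<^sub>L (real ^ 'n)) \<Rightarrow> 'p \<times> 'q \<times> ((real ^ 'm) \<Rightarrow>\<^sub>L (real ^ 'n)) \<Rightarrow> ennreal" where
  "sasaki_dist M N e e' =
     (INF \<gamma>\<in>{\<gamma>. piecewise_C1_curve M N \<gamma> \<and> \<gamma> 0 = e \<and> \<gamma> 1 = e'}. sasaki_length M N \<gamma>)"

subsection \<open>The two distances\<close>

text \<open>Used for positive exponents only.\<close>

definition ennreal_powr :: "ennreal \<Rightarrow> real \<Rightarrow> ennreal" where
  "ennreal_powr a r = (if a = \<infinity> then \<infinity> else ennreal (enn2real a powr r))"

definition delta_S ::
  "('p, 'm::finite) rmfd \<Rightarrow> ('q, 'n::finite) rmfd \<Rightarrow> real \<Rightarrow> ('p \<Rightarrow> 'q) \<Rightarrow> ('p \<Rightarrow> 'q) \<Rightarrow> ennreal" where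
  "delta_S M N p u v =
     ennreal_powr
       (\<integral>\<^sup>+ x. ennreal_powr
           (sasaki_dist M N (x, u x, colocal_weak_derivative M N u x)
                            (x, v x, colocal_weak_derivative M N v x)) p
         \<partial>riemannian_measure M)
       (1 / p)"

definition delta_iota ::
  "('p, 'm::finite) rmfd \<Rightarrow> ('q \<Rightarrow> 'b::euclidean_space) \<Rightarrow> real \<Rightarrow>
   ('p \<Rightarrow> 'q) \<Rightarrow> ('p \<Rightarrow> 'q) \<Rightarrow> ennreal" where
  "delta_iota M \<iota> p u v =
     ennreal_powr
       (\<integral>\<^sup>+ x. ennreal
           (((norm (\<iota> (u x) - \<iota> (v x)))\<^sup>2 +
             (hs_norm (metric M x) (\<bullet>)
                (blinfun_apply (weak_derivative M (\<iota> \<circ> u) x - weak_derivative M (\<iota> \<circ> v) x)))\<^sup>2)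
            powr (p / 2))
         \<partial>riemannian_measure M)
       (1 / p)"

text \<open>Uniform continuity for distances that may take the value \<open>\<infinity>\<close>.\<close>

definition uniformly_continuous_edist ::
  "'a set \<Rightarrow> ('a \<Rightarrow> 'a \<Rightarrow> ennreal) \<Rightarrow> ('b \<Rightarrow> 'b \<Rightarrow> ennreal) \<Rightarrow> ('a \<Rightarrow> 'b) \<Rightarrow> bool" where
  "uniformly_continuous_edist W d d' F \<longleftrightarrow>
     (\<forall>\<epsilon>::real. \<epsilon> > 0 \<longrightarrow> (\<exists>\<delta>::real. \<delta> > 0 \<and>
        (\<forall>u\<in>W. \<forall>v\<in>W. d u v < ennreal \<delta> \<longrightarrow> d' (F u) (F v) < ennreal \<epsilon>)))"

subsection \<open>The round sphere and isometric embeddings\<close>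

text \<open>
  The unit sphere of \<open>(real ^ 'n) \<times> real\<close>, a Euclidean space of dimension \<open>CARD('n) + 1\<close>, with
  the stereographic projections from \<open>(0, 1)\<close> and \<open>(0, -1)\<close> as charts.  The metric is the one
  induced by the inner product of the ambient space.
\<close>

definition stereo :: "real \<Rightarrow> ((real ^ 'n::finite) \<times> real, 'n) chart" where
  "stereo s = (sphere 0 1 - {(0, s)}, \<lambda>(w, h). w /\<^sub>R (1 - s * h))"

definition sphere_chart_at :: "(real ^ 'n::finite) \<times> real \<Rightarrow> ((real ^ 'n) \<times> real, 'n) chart" where
  "sphere_chart_at y = (if snd y \<le> 0 then stereo 1 else stereo (-1))"

definition round_sphere :: "((real ^ 'n::finite) \<times> real, 'n) rmfd" where
  "round_sphere =
     \<lparr> carrier_top = top_of_set (sphere 0 1),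
       atlas = {stereo 1, stereo (-1)},
       chart_at = sphere_chart_at,
       metric = (\<lambda>y v w.
         let d = sphere_chart_at y;
             D = frechet_derivative (chart_inv d) (at (snd d y))
         in D v \<bullet> D w) \<rparr>"

definition isometric_embedding ::
  "('q, 'n::finite) rmfd \<Rightarrow> ('q \<Rightarrow> 'b::euclidean_space) \<Rightarrow> bool" where
  "isometric_embedding N \<iota> \<longleftrightarrow>
     C1_map N \<iota> \<and> embedding_map (carrier_top N) euclidean \<iota> \<and>
     (\<forall>y\<in>points N. \<forall>v w.
        blinfun_apply (differential N \<iota> y) v \<bullet> blinfun_apply (differential N \<iota> y) w = metric N y v w)"

end

theory Submission
  imports Defs
begin

text \<open>
  Let \<open>geo\<close> be the equator of the sphere, parametrised by arc length.  Since the velocity of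
  a geodesic is parallel, the map \<open>geo \<circ> (\<phi> + s h \<zeta>)\<close>, with derivative
  \<open>geo' \<otimes> (d\<phi> + s h d\<zeta>)\<close>, is at every point x a curve in s of constant Sasaki speed
  \<open>h sqrt (\<zeta>\<^sup>2 + |d\<zeta>|\<^sup>2)\<close>.  Hence \<open>geo \<circ> \<phi>\<close> and \<open>geo \<circ> (\<phi> + h \<zeta>)\<close> are at Sasaki distance
  O(h), no matter how large \<open>d\<phi>\<close> is.  Where \<open>\<zeta> = 1\<close>, however, the derivatives of their
  compositions with \<open>\<iota>\<close> differ by \<open>(c'(\<phi> + h) - c'(\<phi>)) \<otimes> d\<phi>\<close> with \<open>c = \<iota> \<circ> geo\<close>.  As c is
  bounded and \<open>c(h) \<noteq> c(0)\<close>, the derivative of c is not h-periodic, so \<open>c'(s + h) - c'(s)\<close> is bounded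
  away from 0 near some \<open>s\<^sub>0\<close>.  Letting \<open>\<phi>\<close> oscillate around \<open>s\<^sub>0\<close> with small amplitude and high
  frequency makes \<open>\<delta>\<^sup>\<iota>\<close> large while \<open>\<delta>\<^sup>S\<close> stays small.
\<close>

section \<open>Functions of class C1 and their derivatives\<close>

text \<open>The derivatives in both distances come from Hilbert's choice, so they are known only
  almost everywhere and only through testing, and the measure is glued along an unspecified
  countable atlas. Hence explicit maps are tied to the chosen derivatives by the fundamental lemma,
  and all oscillation is placed in one chart on which the glued measure is the chart volume. The
  Sasaki distance is only ever bounded from above, so one explicit curve is enough. The great circle
  lies in the equator because stereographic coordinates there have conformal factor 1 and are the
  same for both poles. The order of the choices matters. \<open>h\<close> depends on
  \<open>\<delta>\<close> alone. The jump of the derivative of c over a step h then gives a gap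
  \<open>\<eta>\<close> and a radius \<open>A\<close>, both possibly tiny; an amplitude of at most
  \<open>A\<close> keeps the phase where the gap persists. The frequency is chosen last and
  compensates for both, which is possible because the Sasaki bound does not see it. A cutoff
  confines all derivatives to a compact set of finite measure, so the maps belong to the Sobolev
  space for every M.\<close>

definition fd :: "('a::euclidean_space \<Rightarrow> 'b::real_normed_vector) \<Rightarrow> 'a \<Rightarrow> 'a \<Rightarrow>\<^sub>L 'b" where
  "fd f z = Blinfun (frechet_derivative f (at z))"

lemma fd_eqI:
  assumes "(f has_derivative blinfun_apply L) (at z)"
  shows "fd f z = L"
  using frechet_derivative_at[OF assms] by (simp add: fd_def blinfun_apply_inverse flip: frechet_derivative_at[OF assms])

lemma fd_apply:
  assumes "f differentiable (at z)"
  shows "blinfun_apply (fd f z) = frechet_derivative f (at z)"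
  using assms by (metis bounded_linear_Blinfun_apply fd_def frechet_derivative_works has_derivative_bounded_linear)

lemma C1_on_imp_has_derivative:
  assumes "C1_on S f" "z \<in> S"
  shows "(f has_derivative blinfun_apply (fd f z)) (at z)"
proof -
  obtain f' where "(f has_derivative blinfun_apply (f' z)) (at z)"
    using assms unfolding C1_on_def by blast
  then show ?thesis using fd_eqI by metis
qed

lemma C1_on_imp_continuous_fd:
  assumes "C1_on S f"
  shows "continuous_on S (fd f)"
proof -
  obtain f' where f': "\<forall>z\<in>S. (f has_derivative blinfun_apply (f' z)) (at z)" "continuous_on S f'"
    using assms unfolding C1_on_def by blast
  then have "\<And>z. z \<in> S \<Longrightarrow> f' z = fd f z" using fd_eqI by metis
  with f'(2) show ?thesis by (simp cong: continuous_on_cong)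
qed

lemma C1_onI:
  assumes "\<And>z. z \<in> S \<Longrightarrow> (f has_derivative blinfun_apply (f' z)) (at z)" "continuous_on S f'"
  shows "C1_on S f"
  using assms unfolding C1_on_def by blast

lemma C1_on_subset: "C1_on T f \<Longrightarrow> S \<subseteq> T \<Longrightarrow> C1_on S f"
  unfolding C1_on_def by (meson continuous_on_subset subsetD)

lemma C1_on_imp_continuous_on: "C1_on S f \<Longrightarrow> continuous_on S f"
  by (meson C1_on_imp_has_derivative continuous_at_imp_continuous_on has_derivative_continuous)

lemma C2_on_imp_C1_on: "C2_on S f \<Longrightarrow> C1_on S f"
  unfolding C2_on_def using C1_onI C1_on_imp_continuous_on by metis

lemma C1_on_cong:
  assumes "open S" "C1_on S f" "\<And>z. z \<in> S \<Longrightarrow> f z = g z"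
  shows "C1_on S g"
proof (rule C1_onI)
  show "continuous_on S (fd f)" using assms C1_on_imp_continuous_fd by blast
  fix z assume "z \<in> S"
  with assms show "(g has_derivative blinfun_apply (fd f z)) (at z)"
    by (metis C1_on_imp_has_derivative has_derivative_transform_within_open)
qed

text \<open>\<open>fd\<close> is determined pointwise, so its continuity may be checked on small
  open sets. This is how a function given on an open set is glued with a constant beyond a compact
  support.\<close>

lemma C1_on_local:
  assumes "\<And>z. z \<in> S \<Longrightarrow> \<exists>U. open U \<and> z \<in> U \<and> C1_on U f"
  shows "C1_on S f"
proof (rule C1_onI)
  show "continuous_on S (fd f)"
    using assms C1_on_imp_continuous_fd
    by (metis continuous_at_imp_continuous_on continuous_on_eq_continuous_at)
  show "(f has_derivative blinfun_apply (fd f z)) (at z)" if "z \<in> S" for z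
    using assms[OF that] C1_on_imp_has_derivative by blast
qed

lemma C1_on_compose:
  assumes g: "C1_on T g" and f: "C1_on S f" and sub: "f ` S \<subseteq> T"
  shows "C1_on S (g \<circ> f)"
proof (rule C1_onI)
  show "((g \<circ> f) has_derivative blinfun_apply (fd g (f z) o\<^sub>L fd f z)) (at z)" if "z \<in> S" for z
    using diff_chain_at[OF C1_on_imp_has_derivative[OF f that] C1_on_imp_has_derivative[OF g]] sub that
    by (simp add: blinfun_compose.rep_eq image_subset_iff)
  have "continuous_on S (\<lambda>z. fd g (f z))"
    using continuous_on_compose2[OF C1_on_imp_continuous_fd[OF g] C1_on_imp_continuous_on[OF f] sub] .
  then show "continuous_on S (\<lambda>z. fd g (f z) o\<^sub>L fd f z)"
    using bounded_bilinear.continuous_on[OF bounded_bilinear_blinfun_compose] C1_on_imp_continuous_fd[OF f]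
    by blast
qed

lemma C1_on_const [simp, intro]: "C1_on S (\<lambda>z. c)"
  by (rule C1_onI[where f'="\<lambda>z. 0"]) (auto simp: zero_blinfun.rep_eq)

lemma C1_on_bounded_linear:
  assumes "bounded_linear f"
  shows "C1_on S f"
  by (rule C1_onI[where f'="\<lambda>z. Blinfun f"])
     (auto simp: bounded_linear_Blinfun_apply assms bounded_linear_imp_has_derivative)

lemma C1_on_add:
  assumes "C1_on S f" "C1_on S g"
  shows "C1_on S (\<lambda>z. f z + g z)"
proof (rule C1_onI)
  show "((\<lambda>z. f z + g z) has_derivative blinfun_apply (fd f z + fd g z)) (at z)" if "z \<in> S" for z
    using has_derivative_add[OF C1_on_imp_has_derivative[OF assms(1) that] C1_on_imp_has_derivative[OF assms(2) that]]
    by (simp add: plus_blinfun.rep_eq)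
qed (intro continuous_intros C1_on_imp_continuous_fd assms)

lemma C1_on_bilinear:
  assumes b: "bounded_bilinear b" and f: "C1_on S f" and g: "C1_on S g"
  shows "C1_on S (\<lambda>z. b (f z) (g z))"
proof (rule C1_onI)
  interpret bounded_bilinear b by fact
  show "((\<lambda>z. b (f z) (g z)) has_derivative blinfun_apply ((prod_right (f z) o\<^sub>L fd g z) + (prod_left (g z) o\<^sub>L fd f z))) (at z)" if "z \<in> S" for z
    using FDERIV[OF C1_on_imp_has_derivative[OF f that] C1_on_imp_has_derivative[OF g that]]
    by (simp add: plus_blinfun.rep_eq)
  show "continuous_on S (\<lambda>z. (prod_right (f z) o\<^sub>L fd g z) + (prod_left (g z) o\<^sub>L fd f z))"
    by (intro continuous_intros bounded_bilinear.continuous_on[OF bounded_bilinear_blinfun_compose]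
        C1_on_imp_continuous_fd f g C1_on_imp_continuous_on
        bounded_linear.continuous_on[OF bounded_linear_prod_left] bounded_linear.continuous_on[OF bounded_linear_prod_right])
qed

lemmas C1_on_mult = C1_on_bilinear[OF bounded_bilinear_mult]
lemmas C1_on_scaleR = C1_on_bilinear[OF bounded_bilinear_scaleR]
lemmas C1_on_inner = C1_on_bilinear[OF bounded_bilinear_inner]

lemma C1_on_prod:
  fixes f :: "'i \<Rightarrow> 'a::euclidean_space \<Rightarrow> real"
  assumes "\<And>i. i \<in> I \<Longrightarrow> C1_on S (f i)"
  shows "C1_on S (\<lambda>z. \<Prod>i\<in>I. f i z)"
  using assms by (induction I rule: infinite_finite_induct) (auto intro!: C1_on_mult)

section \<open>C1 functions of one real variable and explicit cutoffs\<close>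

lemma C1_on_real:
  fixes f :: "real \<Rightarrow> 'b::real_normed_vector"
  assumes "\<And>t. t \<in> S \<Longrightarrow> (f has_vector_derivative f' t) (at t)" "continuous_on S f'"
  shows "C1_on S f"
proof (rule C1_onI)
  show "(f has_derivative blinfun_apply (blinfun_scaleR_left (f' t))) (at t)" if "t \<in> S" for t
    using assms(1)[OF that] by (simp add: has_vector_derivative_def blinfun_scaleR_left.rep_eq)
  show "continuous_on S (\<lambda>t. blinfun_scaleR_left (f' t))"
    by (intro bounded_linear.continuous_on[OF bounded_linear_blinfun_scaleR_left] assms(2))
qed

text \<open>The truncated square is C1, which is all the regularity asked of test functions and
  cutoffs; every cutoff below is built from it.\<close>

lemma has_vector_derivative_max_power2:
  "((\<lambda>t. (max 0 t)\<^sup>2) has_vector_derivative 2 * max 0 t) (at (t::real))"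
proof -
  consider "t < 0" | "t = 0" | "t > 0" by linarith
  then show ?thesis
  proof cases
    case 1
    have "((\<lambda>t. 0) has_vector_derivative 2 * max 0 t) (at (t::real))"
      using 1 by (auto intro!: derivative_eq_intros)
    then show ?thesis
      by (rule has_vector_derivative_transform_within_open[of _ _ _ "{..<0}"]) (use 1 in auto)
  next
    case 3
    have "((\<lambda>t. t\<^sup>2) has_vector_derivative 2 * max 0 t) (at (t::real))"
      using 3 by (auto intro!: derivative_eq_intros simp: has_real_derivative_iff_has_vector_derivative[symmetric])
    then show ?thesis
      by (rule has_vector_derivative_transform_within_open[of _ _ _ "{0<..}"]) (use 3 in auto)
  next
    case 2
    have "((\<lambda>y. (max 0 y)\<^sup>2 / y) \<longlongrightarrow> 0) (at (0::real))"
    proof (rule Lim_null_comparison)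
      show "\<forall>\<^sub>F x in at 0. norm ((max 0 x)\<^sup>2 / x) \<le> \<bar>x::real\<bar>"
        by (rule always_eventually) (auto simp: max_def power2_eq_square)
      show "((\<lambda>x. \<bar>x::real\<bar>) \<longlongrightarrow> 0) (at 0)" by (rule tendsto_eq_intros | simp)+
    qed
    then show ?thesis using 2
      by (simp add: has_real_derivative_iff_has_vector_derivative[symmetric] has_field_derivative_iff)
  qed
qed

lemma C1_on_max_power2: "C1_on S (\<lambda>t::real. (max 0 t)\<^sup>2)"
  by (rule C1_on_real[OF has_vector_derivative_max_power2]) (auto intro!: continuous_intros)

lemma C1_on_max_power2':
  assumes "C1_on S f"
  shows "C1_on S (\<lambda>z. (max 0 (f z :: real))\<^sup>2)"
  using C1_on_compose[OF C1_on_max_power2[of UNIV] assms] by (simp add: o_def)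

lemma C1_on_diff:
  assumes "C1_on S f" "C1_on S g"
  shows "C1_on S (\<lambda>z. f z - g z)"
  using C1_on_add[OF assms(1) C1_on_scaleR[OF C1_on_const[where c="-1"] assms(2)]] by simp

lemma C1_on_id: "C1_on S (\<lambda>z. z)"
  using C1_on_bounded_linear[OF bounded_linear_ident] .

text \<open>A C1 step from 0 to 1: the inner truncated square makes the slope vanish at 0, the outer
  one makes it vanish at 1.\<close>

definition bump :: "real \<Rightarrow> real" where
  "bump t = 1 - (max 0 (1 - (max 0 t)\<^sup>2))\<^sup>2"

lemma bump_0: "t \<le> 0 \<Longrightarrow> bump t = 0" and bump_1: "1 \<le> t \<Longrightarrow> bump t = 1"
  by (auto simp: bump_def max_def one_le_power intro: antisym)

lemma C1_on_bump: "C1_on S bump"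
  unfolding bump_def[abs_def] by (intro C1_on_diff C1_on_const C1_on_max_power2' C1_on_id)

lemma zero_outside_fd:
  assumes "closed K" "\<And>z. z \<notin> K \<Longrightarrow> f z = 0" "z \<notin> K"
  shows "fd f z = 0"
proof (rule fd_eqI)
  have "((\<lambda>z. 0) has_derivative blinfun_apply 0) (at z)" by (simp add: zero_blinfun.rep_eq)
  then show "(f has_derivative blinfun_apply 0) (at z)"
    by (rule has_derivative_transform_within_open[of _ _ _ _ "- K"]) (use assms in auto)
qed

section \<open>Compactly supported functions and the integral of a derivative\<close>

lemma integrable_compact_support:
  fixes f :: "'a::euclidean_space \<Rightarrow> 'b::euclidean_space"
  assumes "compact K" "continuous_on K f" "\<And>z. z \<notin> K \<Longrightarrow> f z = 0"
  shows "integrable lborel f" "integrable lebesgue f"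
proof -
  have "(\<lambda>x. indicator K x *\<^sub>R f x) = f" using assms(3) by (force simp: indicator_def)
  then show "integrable lborel f" using borel_integrable_compact[OF assms(1,2)] by simp
  then show "integrable lebesgue f"
    using borel_measurable_integrable integrable_completion by blast
qed

text \<open>The integrals of the difference quotients vanish by translation invariance.\<close>

lemma integral_fd_eq_0:
  fixes f :: "'a::euclidean_space \<Rightarrow> 'b::euclidean_space"
  assumes f: "C1_on UNIV f" and K: "compact K" "\<And>z. z \<notin> K \<Longrightarrow> f z = 0"
  shows "(LINT z|lebesgue. fd f z v) = 0"
proof -
  define D where "D = (\<lambda>z. fd f z v)"
  have contD: "continuous_on S D" for S
    unfolding D_def using C1_on_imp_continuous_fd[OF f] by (auto intro!: continuous_intros intro: continuous_on_subset)
  have contf: "continuous_on S f" for S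
    using C1_on_imp_continuous_on[OF f] continuous_on_subset by blast
  have D0: "D z = 0" if "z \<notin> K" for z
    using zero_outside_fd[OF compact_imp_closed[OF K(1)] K(2) that] unfolding D_def by simp
  obtain B where B: "\<And>z. norm (D z) \<le> B" "B \<ge> 0"
  proof -
    have "bounded (D ` K)" using K(1) contD compact_continuous_image compact_imp_bounded by blast
    then obtain B where "B > 0" "\<And>z. z \<in> K \<Longrightarrow> norm (D z) \<le> B" unfolding bounded_pos by auto
    then show ?thesis using that[of B] D0 by (metis less_imp_le norm_zero)
  qed
  \<comment> \<open>All points from which some shift by \<open>t *\<^sub>R v\<close> with t in [0,1]
    lands in K. Since every step \<open>t n\<close> is at most 1, this compact set supports all
    difference quotients at once, as domination requires.\<close>
  define K' where "K' = (\<lambda>(z,t). z - t *\<^sub>R v) ` (K \<times> {0..1::real})"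
  have "compact K'"
    unfolding K'_def by (intro compact_continuous_image compact_Times K) (auto intro!: continuous_intros simp: case_prod_beta)
  define t where "t = (\<lambda>n. 1 / real (Suc n))"
  have t: "0 < t n" "t n \<le> 1" for n by (auto simp: t_def)
  define s where "s = (\<lambda>n z. (f (z + t n *\<^sub>R v) - f z) /\<^sub>R t n)"
  have s0: "s n z = 0" if "z \<notin> K'" for n z
  proof -
    have "z \<notin> K" using that unfolding K'_def by (force intro: image_eqI[where x="(z,0)"])
    moreover have "z + t n *\<^sub>R v \<notin> K"
    proof
      assume "z + t n *\<^sub>R v \<in> K"
      then have "z \<in> K'" unfolding K'_def using t[of n]
        by (intro image_eqI[where x="(z + t n *\<^sub>R v, t n)"]) auto
      with that show False by simp
    qed
    ultimately show ?thesis using K(2) by (simp add: s_def)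
  qed
  have sb: "norm (s n z) \<le> B" for n z
  proof -
    \<comment> \<open>Mean value inequality along the segment: the bound \<open>B\<close> of the
      derivative also bounds every difference quotient.\<close>
    have "norm (f (z + t n *\<^sub>R v) - f (z + 0 *\<^sub>R v)) \<le> B * norm (t n - 0)"
    proof (rule differentiable_bound[where S="{0..1}" and f="\<lambda>r. f (z + r *\<^sub>R v)" and f'="\<lambda>r h. h *\<^sub>R D (z + r *\<^sub>R v)"])
      fix r :: real assume "r \<in> {0..1}"
      have "((f \<circ> (\<lambda>r. z + r *\<^sub>R v)) has_derivative (blinfun_apply (fd f (z + r *\<^sub>R v)) \<circ> (\<lambda>h. h *\<^sub>R v))) (at r)"
        by (rule diff_chain_at[OF _ C1_on_imp_has_derivative[OF f UNIV_I]]) (auto intro!: derivative_eq_intros)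
      then show "((\<lambda>r. f (z + r *\<^sub>R v)) has_derivative (\<lambda>h. h *\<^sub>R D (z + r *\<^sub>R v))) (at r within {0..1})"
        by (simp add: o_def D_def blinfun.scaleR_right has_derivative_at_withinI)
      show "onorm (\<lambda>h. h *\<^sub>R D (z + r *\<^sub>R v)) \<le> B"
        by (rule onorm_bound) (use B in \<open>auto simp: mult.commute[of B] intro!: mult_left_mono\<close>)
    qed (use t[of n] in auto)
    then show ?thesis using t[of n] by (simp add: s_def divide_inverse_commute[symmetric] pos_divide_le_eq)
  qed
  have lim: "(\<lambda>n. s n z) \<longlonglongrightarrow> D z" for z
  proof -
    have "((f \<circ> (\<lambda>r. z + r *\<^sub>R v)) has_derivative (blinfun_apply (fd f (z + 0 *\<^sub>R v)) \<circ> (\<lambda>h. h *\<^sub>R v))) (at 0)"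
      by (rule diff_chain_at[OF _ C1_on_imp_has_derivative[OF f UNIV_I]]) (auto intro!: derivative_eq_intros)
    then have "((\<lambda>r. f (z + r *\<^sub>R v)) has_vector_derivative D z) (at 0)"
      by (simp add: o_def D_def blinfun.scaleR_right has_vector_derivative_def)
    then have "(\<lambda>r. norm (f (z + r *\<^sub>R v) - f z - r *\<^sub>R D z) / norm r) \<midarrow>0\<rightarrow> 0"
      unfolding has_vector_derivative_def has_derivative_at by simp
    then have "(\<lambda>r. norm ((f (z + r *\<^sub>R v) - f z) /\<^sub>R r - D z)) \<midarrow>0\<rightarrow> 0"
    proof (rule Lim_transform_eventually)
      have "norm (f (z + r *\<^sub>R v) - f z - r *\<^sub>R D z) / norm r = norm ((f (z + r *\<^sub>R v) - f z) /\<^sub>R r - D z)"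
        if "r \<noteq> 0" for r
      proof -
        have "norm ((f (z + r *\<^sub>R v) - f z) /\<^sub>R r - D z) = norm ((f (z + r *\<^sub>R v) - f z - r *\<^sub>R D z) /\<^sub>R r)"
          using that by (simp add: scaleR_diff_right)
        then show ?thesis by (simp add: divide_inverse mult.commute)
      qed
      then show "\<forall>\<^sub>F r in at 0. norm (f (z + r *\<^sub>R v) - f z - r *\<^sub>R D z) / norm r
          = norm ((f (z + r *\<^sub>R v) - f z) /\<^sub>R r - D z)"
        by (auto simp: eventually_at_filter)
    qed
    then have "(\<lambda>r. (f (z + r *\<^sub>R v) - f z) /\<^sub>R r) \<midarrow>0\<rightarrow> D z"
      using Lim_null tendsto_norm_zero_iff by blast
    moreover have "filterlim t (at 0) sequentially"
      unfolding filterlim_at using t LIMSEQ_inverse_real_of_nat by (auto simp: t_def inverse_eq_divide eventually_sequentially)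
    ultimately show ?thesis unfolding s_def using filterlim_compose by blast
  qed
  have int_s: "integrable lborel (s n)" for n
    by (rule integrable_compact_support[OF \<open>compact K'\<close> _ s0])
      (auto simp: s_def intro!: continuous_intros continuous_on_compose2[OF contf[of UNIV]])
  have "integral\<^sup>L lborel (s n) = 0" for n
  proof -
    have fi: "integrable lborel f" by (rule integrable_compact_support(1)[OF K(1) contf]) (rule K(2))
    have fm: "f \<in> borel_measurable borel" using contf[of UNIV] borel_measurable_continuous_onI by blast
    have *: "(LINT z|lborel. f (z + t n *\<^sub>R v)) = integral\<^sup>L lborel f"
    proof -
      have "integral\<^sup>L lborel f = integral\<^sup>L (distr lborel borel ((+) (t n *\<^sub>R v))) f" by (simp add: lborel_distr_plus)
      also have "\<dots> = (LINT z|lborel. f (t n *\<^sub>R v + z))" by (rule integral_distr) (auto simp: fm)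
      finally show ?thesis by (simp add: add.commute)
    qed
    have "integrable lborel (\<lambda>z. f (z + t n *\<^sub>R v))"
    proof -
      have "integrable (distr lborel borel ((+) (t n *\<^sub>R v))) f" by (simp add: lborel_distr_plus fi)
      then have "integrable lborel (\<lambda>z. f (t n *\<^sub>R v + z))" by (subst (asm) integrable_distr_eq) (auto simp: fm)
      then show ?thesis by (simp add: add.commute)
    qed
    then show ?thesis unfolding s_def using * fi by simp
  qed
  moreover have "(\<lambda>n. integral\<^sup>L lborel (s n)) \<longlonglongrightarrow> integral\<^sup>L lborel D"
  proof (rule integral_dominated_convergence[where w="\<lambda>z. indicator K' z *\<^sub>R B"])
    show "integrable lborel (\<lambda>z. indicator K' z *\<^sub>R B)"
      by (rule borel_integrable_compact[OF \<open>compact K'\<close>]) auto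
    show "D \<in> borel_measurable lborel" using contD[of UNIV] borel_measurable_continuous_onI by auto
    show "AE z in lborel. norm (s n z) \<le> indicator K' z *\<^sub>R B" for n
      using sb s0 by (intro always_eventually) (auto simp: indicator_def)
  qed (use int_s lim in auto)
  ultimately have "integral\<^sup>L lborel D = 0" using LIMSEQ_unique[OF _ tendsto_const] by fastforce
  moreover have "integral\<^sup>L lebesgue D = integral\<^sup>L lborel D"
    by (rule integral_completion) (use contD[of UNIV] borel_measurable_continuous_onI in auto)
  ultimately show ?thesis unfolding D_def by simp
qed

section \<open>The fundamental lemma of the calculus of variations\<close>

lemma C1_on_inner_left: "C1_on S (\<lambda>z. z \<bullet> i)" "C1_on S (\<lambda>z. i \<bullet> z)"
  by (auto intro!: C1_on_bounded_linear bounded_linear_inner_left bounded_linear_inner_right)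

text \<open>t / (1 + t) is C1 for t > -1. It serves twice: to push bump functions towards an
  indicator, and for the rational functions in the inverse stereographic projection.\<close>

lemma C1_on_saturate:
  assumes "C1_on S q" "\<And>z. z \<in> S \<Longrightarrow> 0 \<le> (q z :: real)"
  shows "C1_on S (\<lambda>z. q z / (1 + q z))"
proof -
  have "C1_on {-1<..} (\<lambda>t::real. t / (1 + t))"
  proof (rule C1_on_real)
    show "((\<lambda>t. t / (1 + t)) has_vector_derivative (1 / (1 + t)\<^sup>2)) (at t)" if "t \<in> {-1<..}" for t :: real
      using that unfolding has_real_derivative_iff_has_vector_derivative[symmetric]
      by (auto intro!: derivative_eq_intros simp: field_simps power2_eq_square)
    show "continuous_on {-1<..} (\<lambda>t::real. 1 / (1 + t)\<^sup>2)"
      by (auto intro!: continuous_intros)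
  qed
  from C1_on_compose[OF this assms(1)] show ?thesis
    using assms(2) by (force simp: o_def)
qed

text \<open>The product q of truncated squares is positive exactly on the open box, so k q / (1 + k
  q) stays in [0,1), vanishes off the box and tends to 1 inside it as k grows.\<close>

lemma test_function_box:
  fixes a b :: "'a::euclidean_space"
  assumes "cbox a b \<subseteq> S"
  obtains \<phi> :: "nat \<Rightarrow> 'a \<Rightarrow> real" where
    "\<And>k. \<phi> k \<in> test_functions S" "\<And>k z. 0 \<le> \<phi> k z" "\<And>k z. \<phi> k z \<le> indicator (box a b) z"
    "\<And>z. (\<lambda>k. \<phi> k z) \<longlonglongrightarrow> indicator (box a b) z"
proof -
  define q where "q = (\<lambda>z. \<Prod>i\<in>Basis. (max 0 (z \<bullet> i - a \<bullet> i))\<^sup>2 * (max 0 (b \<bullet> i - z \<bullet> i))\<^sup>2)"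
  have C: "C1_on UNIV q"
    unfolding q_def
    by (intro C1_on_prod C1_on_mult C1_on_max_power2' C1_on_diff C1_on_const C1_on_inner_left)
  have q0: "0 \<le> q z" for z unfolding q_def by (simp add: prod_nonneg)
  have qpos: "0 < q z" if "z \<in> box a b" for z
    unfolding q_def using that by (auto simp: box_def intro!: prod_pos)
  have qz: "q z = 0" if "z \<notin> box a b" for z
  proof -
    have "\<not> (\<forall>i\<in>Basis. a \<bullet> i < z \<bullet> i \<and> z \<bullet> i < b \<bullet> i)"
      using that unfolding mem_box .
    then obtain i where "i \<in> Basis" "z \<bullet> i \<le> a \<bullet> i \<or> b \<bullet> i \<le> z \<bullet> i"
      by (meson not_le)
    then show ?thesis unfolding q_def by (intro prod_zero) (auto intro!: bexI[of _ i] simp: max_def)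
  qed
  define \<phi> where "\<phi> = (\<lambda>k::nat. \<lambda>z. real k * q z / (1 + real k * q z))"
  have "C1_on UNIV (\<phi> k)" for k
    unfolding \<phi>_def by (intro C1_on_saturate C1_on_mult C C1_on_const mult_nonneg_nonneg of_nat_0_le_iff q0)
  then have "\<phi> k \<in> test_functions S" for k
    unfolding test_functions_def using assms qz box_subset_cbox[of a b]
    by (auto simp: \<phi>_def intro!: exI[of _ "cbox a b"])
  moreover have "0 \<le> \<phi> k z" for k z using q0 by (simp add: \<phi>_def)
  moreover have "\<phi> k z \<le> indicator (box a b) z" for k z
    using q0[of z] qz[of z] by (auto simp: \<phi>_def indicator_def divide_le_eq add_pos_nonneg intro: add_increasing)
  moreover have "(\<lambda>k. \<phi> k z) \<longlonglongrightarrow> indicator (box a b) z" for z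
  proof (cases "z \<in> box a b")
    case True
    have q: "q z > 0" using qpos[OF True] .
    have "(\<lambda>k. 1 - 1 / (1 + q z * real k)) \<longlonglongrightarrow> 1 - 0"
      using q by (intro tendsto_intros tendsto_divide_0[OF tendsto_const] filterlim_at_top_imp_at_infinity
         filterlim_tendsto_add_at_top[OF tendsto_const] filterlim_tendsto_pos_mult_at_top[OF tendsto_const _ filterlim_real_sequentially])
    moreover have "1 - 1 / (1 + q z * real k) = \<phi> k z" for k
      using q by (simp add: \<phi>_def field_simps add_pos_nonneg add_nonneg_eq_0_iff)
    ultimately show ?thesis using True by simp
  next
    case False
    then show ?thesis using qz[OF False] by (simp add: \<phi>_def)
  qed
  ultimately show ?thesis using that by blast
qed

text \<open>Dominated convergence along test functions that tend to the indicator of the box. The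
  boundary of the box is negligible, so the open and the closed box have the same integral.\<close>

lemma integral_box_eq_0:
  fixes G :: "'a::euclidean_space \<Rightarrow> 'b::euclidean_space"
  assumes G: "locally_integrable_on G S" and sub: "cbox a b \<subseteq> S"
    and 0: "\<And>\<phi>. \<phi> \<in> test_functions S \<Longrightarrow> (LINT z:S|lebesgue. \<phi> z *\<^sub>R G z) = 0"
  shows "integral (cbox a b) G = 0"
proof -
  obtain \<phi> :: "nat \<Rightarrow> 'a \<Rightarrow> real" where \<phi>:
    "\<And>k. \<phi> k \<in> test_functions S" "\<And>k z. 0 \<le> \<phi> k z" "\<And>k z. \<phi> k z \<le> indicator (box a b) z"
    "\<And>z. (\<lambda>k. \<phi> k z) \<longlonglongrightarrow> indicator (box a b) z"
    using test_function_box[OF sub] by blast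
  have ci: "G absolutely_integrable_on cbox a b"
    using G sub unfolding locally_integrable_on_def by auto
  have bi: "G absolutely_integrable_on box a b"
    using set_integrable_subset[OF ci _ box_subset_cbox] by simp
  have z: "\<phi> k z = 0" if "z \<notin> box a b" for k z
    using \<phi>(2,3)[of k z] that by (simp add: antisym)
  have eq: "indicator S z *\<^sub>R \<phi> k z *\<^sub>R G z = \<phi> k z *\<^sub>R (indicator (box a b) z *\<^sub>R G z)" for k z
    using z sub box_subset_cbox[of a b] by (auto simp: indicator_def)
  have m: "(\<lambda>z. indicator (box a b) z *\<^sub>R G z) \<in> borel_measurable lebesgue"
    using bi unfolding set_integrable_def by auto
  have "(\<lambda>k. LINT z|lebesgue. \<phi> k z *\<^sub>R (indicator (box a b) z *\<^sub>R G z)) \<longlonglongrightarrow>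
        (LINT z|lebesgue. indicator (box a b) z *\<^sub>R G z)"
  proof (rule integral_dominated_convergence[where w="\<lambda>z. norm (indicator (box a b) z *\<^sub>R G z)"])
    show "integrable lebesgue (\<lambda>z. norm (indicator (box a b) z *\<^sub>R G z))"
      using bi unfolding set_integrable_def by (rule integrable_norm)
    have "\<phi> k \<in> borel_measurable borel" for k
      using \<phi>(1)[of k] unfolding test_functions_def
      by (auto intro!: borel_measurable_continuous_onI C1_on_imp_continuous_on)
    then have "\<phi> k \<in> borel_measurable lebesgue" for k
      by (simp add: measurable_completion)
    then show "(\<lambda>z. \<phi> k z *\<^sub>R (indicator (box a b) z *\<^sub>R G z)) \<in> borel_measurable lebesgue" for k
      using borel_measurable_scaleR[OF _ m] by blast
    have "(\<lambda>k. \<phi> k z *\<^sub>R (indicator (box a b) z *\<^sub>R G z)) \<longlonglongrightarrow> indicator (box a b) z *\<^sub>R G z" for z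
      using tendsto_scaleR[OF \<phi>(4)[of z] tendsto_const[of "indicator (box a b) z *\<^sub>R G z"]]
      by (auto simp: indicator_def split: if_splits)
    then show "AE z in lebesgue. (\<lambda>k. \<phi> k z *\<^sub>R (indicator (box a b) z *\<^sub>R G z)) \<longlonglongrightarrow> indicator (box a b) z *\<^sub>R G z"
      by (intro always_eventually allI)
    have "norm (\<phi> k z *\<^sub>R (indicator (box a b) z *\<^sub>R G z)) \<le> norm (indicator (box a b) z *\<^sub>R G z)" for k z
    proof -
      have "\<phi> k z \<le> 1" by (rule order_trans[OF \<phi>(3) indicator_le_1])
      then show ?thesis using \<phi>(2)[of k z] mult_left_le_one_le[of "norm (indicator (box a b) z *\<^sub>R G z)" "\<phi> k z"]
        by (simp only: norm_scaleR) simp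
    qed
    then show "AE z in lebesgue. norm (\<phi> k z *\<^sub>R (indicator (box a b) z *\<^sub>R G z)) \<le> norm (indicator (box a b) z *\<^sub>R G z)" for k
      by simp
  qed (fact m)
  moreover have "(LINT z|lebesgue. \<phi> k z *\<^sub>R (indicator (box a b) z *\<^sub>R G z)) = 0" for k
    using 0[OF \<phi>(1)[of k]] unfolding set_lebesgue_integral_def by (simp only: eq)
  ultimately have "(LINT z|lebesgue. indicator (box a b) z *\<^sub>R G z) = 0"
    using LIMSEQ_unique[OF _ tendsto_const] by fastforce
  then have "integral (box a b) G = 0"
    using set_lebesgue_integral_eq_integral(2)[OF bi] by (simp add: set_lebesgue_integral_def)
  then show ?thesis by (simp add: integral_open_interval)
qed

text \<open>All integrals of G over boxes inside S vanish, while by Lebesgue differentiation the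
  averages over shrinking cubes recover G almost everywhere. Countably many boxes exhaust S.\<close>

lemma fundamental_lemma:
  fixes G :: "'a::euclidean_space \<Rightarrow> 'b::euclidean_space"
  assumes S: "open S" and G: "locally_integrable_on G S"
    and 0: "\<And>\<phi>. \<phi> \<in> test_functions S \<Longrightarrow> (LINT z:S|lebesgue. \<phi> z *\<^sub>R G z) = 0"
  shows "negligible {z \<in> S. G z \<noteq> 0}"
proof -
  have box: "negligible {z \<in> box a b. G z \<noteq> 0}" if sub: "cbox a b \<subseteq> S" for a b :: 'a
  proof -
    \<comment> \<open>The differentiation theorem asks for integrability on every box of the space,
      hence the continuation by zero.\<close>
    define F where "F = (\<lambda>z. if z \<in> cbox a b then G z else 0)"
    have "G integrable_on cbox a b"
      using G sub unfolding locally_integrable_on_def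
      by (intro set_lebesgue_integral_eq_integral(1)) auto
    then have "F integrable_on cbox c d" for c d
      unfolding F_def by (intro integrable_on_subcbox[OF _ subset_UNIV]) (simp add: integrable_restrict_UNIV)
    then obtain N where N: "negligible N" "\<And>x e. \<lbrakk>x \<notin> N; 0 < e\<rbrakk> \<Longrightarrow>
               \<exists>d>0. \<forall>h. 0 < h \<and> h < d \<longrightarrow>
                         norm(integral (cbox x (x + h *\<^sub>R One)) F /\<^sub>R h ^ DIM('a) - F x) < e"
      using integrable_ccontinuous_explicit by blast
    have "x \<in> N" if x: "x \<in> box a b" "G x \<noteq> 0" for x
    proof (rule ccontr)
      assume "x \<notin> N"
      have Fx: "F x = G x" using x box_subset_cbox[of a b] by (auto simp: F_def)
      from N(2)[OF \<open>x \<notin> N\<close>, of "norm (G x)"] x obtain d where d: "d > 0"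
        "\<And>h. 0 < h \<and> h < d \<Longrightarrow> norm(integral (cbox x (x + h *\<^sub>R One)) F /\<^sub>R h ^ DIM('a) - F x) < norm (G x)" by auto
      have "open (box a b)" by (rule open_box)
      then obtain e where e: "e > 0" "cball x e \<subseteq> box a b" using x(1) open_contains_cball by blast
      \<comment> \<open>A cube of side h has diameter at most h times the dimension, by comparison
        with the l1 norm; so the cube with corner x stays in the ball of radius e and inside the
        box.\<close>
      define h where "h = min (d/2) (e / real DIM('a))"
      have h: "0 < h" "h < d" using d(1) e(1) by (auto simp: h_def)
      have "cbox x (x + h *\<^sub>R One) \<subseteq> cball x e"
      proof
        fix y assume y: "y \<in> cbox x (x + h *\<^sub>R One)"
        have "norm (y - x) \<le> (\<Sum>i\<in>Basis. \<bar>(y - x) \<bullet> i\<bar>)" by (rule norm_le_l1)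
        also have "\<dots> \<le> (\<Sum>i\<in>(Basis::'a set). h)"
          using y by (intro sum_mono) (auto simp: mem_box inner_diff_left inner_add_left)
        also have "\<dots> \<le> e" using h(1) by (simp add: h_def min_def field_simps)
        finally show "y \<in> cball x e" by (simp add: dist_norm norm_minus_commute)
      qed
      then have sub': "cbox x (x + h *\<^sub>R One) \<subseteq> cbox a b" using e(2) box_subset_cbox by blast
      have "integral (cbox x (x + h *\<^sub>R One)) F = integral (cbox x (x + h *\<^sub>R One)) G"
        using sub' by (intro Henstock_Kurzweil_Integration.integral_cong) (auto simp: F_def)
      also have "\<dots> = 0" by (rule integral_box_eq_0[OF G _ 0]) (use sub sub' in auto)
      finally show False using d(2)[of h] h Fx by simp
    qed
    then show ?thesis using N(1) by (auto intro: negligible_subset)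
  qed
  obtain \<D> where D: "countable \<D>" "\<D> \<subseteq> Pow S" "\<And>X. X \<in> \<D> \<Longrightarrow> \<exists>a b. X = cbox a b \<and> negligible (frontier X)" "\<Union>\<D> = S"
    using open_countable_Union_open_cbox[OF S] negligible_frontier_interval by (metis frontier_cbox)
  have "negligible {z \<in> X. G z \<noteq> 0}" if X: "X \<in> \<D>" for X
  proof -
    obtain a b where ab: "X = cbox a b" using D(3)[OF X] by blast
    have "{z \<in> X. G z \<noteq> 0} \<subseteq> {z \<in> box a b. G z \<noteq> 0} \<union> (cbox a b - box a b)" using ab by auto
    then show ?thesis
      using box[of a b] X D(2) ab negligible_frontier_interval by (meson PowD negligible_Un negligible_subset subsetD)
  qed
  then have "negligible (\<Union>X\<in>\<D>. {z \<in> X. G z \<noteq> 0})"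
    using D(1) by blast
  moreover have "{z \<in> S. G z \<noteq> 0} = (\<Union>X\<in>\<D>. {z \<in> X. G z \<noteq> 0})" using D(4) by blast
  ultimately show ?thesis by simp
qed

section \<open>Local integrability and integration by parts\<close>

lemma locally_integrable_continuous:
  fixes f :: "'a::euclidean_space \<Rightarrow> 'b::euclidean_space"
  assumes "continuous_on S f"
  shows "locally_integrable_on f S"
  unfolding locally_integrable_on_def set_integrable_def
proof (intro allI impI)
  fix K assume "compact K \<and> K \<subseteq> S"
  then have "integrable lborel (\<lambda>x. indicat_real K x *\<^sub>R f x)"
    using borel_integrable_compact continuous_on_subset[OF assms] by blast
  then show "integrable lebesgue (\<lambda>x. indicat_real K x *\<^sub>R f x)"
    using integrable_completion borel_measurable_integrable by blast
qed

lemma locally_integrable_diff: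
  assumes "locally_integrable_on f S" "locally_integrable_on g S"
  shows "locally_integrable_on (\<lambda>z. f z - g z) S"
  using assms unfolding locally_integrable_on_def by (auto intro!: set_integral_diff(1))

lemma integrable_test_function:
  fixes f :: "'a::euclidean_space \<Rightarrow> 'b::euclidean_space"
  assumes f: "locally_integrable_on f S" and \<phi>: "\<phi> \<in> test_functions S"
  shows "set_integrable lebesgue S (\<lambda>z. \<phi> z *\<^sub>R f z)"
proof -
  obtain K where K: "compact K" "K \<subseteq> S" "\<And>z. z \<notin> K \<Longrightarrow> \<phi> z = 0" and C: "C1_on UNIV \<phi>"
    using \<phi> unfolding test_functions_def by blast
  have cont: "continuous_on UNIV \<phi>" using C1_on_imp_continuous_on[OF C] .
  have "bounded (\<phi> ` K)"
    using K(1) cont by (meson compact_continuous_image compact_imp_bounded continuous_on_subset subset_UNIV)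
  then obtain B where B: "\<And>z. z \<in> K \<Longrightarrow> norm (\<phi> z) \<le> B" unfolding bounded_pos by auto
  have i: "integrable lebesgue (\<lambda>z. indicator K z *\<^sub>R f z)"
    using f K unfolding locally_integrable_on_def set_integrable_def by blast
  have "\<phi> \<in> borel_measurable lebesgue"
    using borel_measurable_continuous_onI[OF cont] by (simp add: measurable_completion)
  then have "integrable lebesgue (\<lambda>z. \<phi> z *\<^sub>R (indicator K z *\<^sub>R f z))"
    using i
  proof (intro Bochner_Integration.integrable_bound[OF integrable_norm[OF integrable_scaleR_right[OF i, of B]]])
    show "AE z in lebesgue. norm (\<phi> z *\<^sub>R (indicator K z *\<^sub>R f z)) \<le> norm (norm (B *\<^sub>R (indicator K z *\<^sub>R f z)))"
      using B by (intro always_eventually) (fastforce simp: indicator_def intro!: mult_right_mono)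
  qed (rule borel_measurable_scaleR, auto dest: borel_measurable_integrable)
  moreover have "\<phi> z *\<^sub>R (indicator K z *\<^sub>R f z) = indicator S z *\<^sub>R \<phi> z *\<^sub>R f z" for z
    using K by (auto simp: indicator_def)
  ultimately show ?thesis unfolding set_integrable_def by (simp only:)
qed

text \<open>The product \<open>\<phi> f\<close>, continued by zero, is C1 with compact support on
  the whole space, so its derivative integrates to zero; the product rule splits that
  integral.\<close>

lemma integration_by_parts:
  fixes f :: "'a::euclidean_space \<Rightarrow> 'b::euclidean_space"
  assumes S: "open S" and f: "C1_on S f" and \<phi>: "\<phi> \<in> test_functions S"
  shows "(LINT z:S|lebesgue. frechet_derivative \<phi> (at z) v *\<^sub>R f z) =
     - (LINT z:S|lebesgue. \<phi> z *\<^sub>R fd f z v)"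
proof -
  obtain K where K: "compact K" "K \<subseteq> S" "\<And>z. z \<notin> K \<Longrightarrow> \<phi> z = 0" and C: "C1_on UNIV \<phi>"
    using \<phi> unfolding test_functions_def by blast
  define \<psi> where "\<psi> = (\<lambda>z. \<phi> z *\<^sub>R f z)"
  \<comment> \<open>f is controlled on S only, so the product is glued from S and the complement of
    K, which together cover the space.\<close>
  have "C1_on UNIV \<psi>"
  proof (rule C1_on_local)
    fix z
    show "\<exists>U. open U \<and> z \<in> U \<and> C1_on U \<psi>"
    proof (cases "z \<in> S")
      case True
      then show ?thesis unfolding \<psi>_def using S f C by (intro exI[of _ S] conjI C1_on_scaleR C1_on_subset[OF C]) auto
    next
      case False
      then have "z \<in> - K" using K by auto
      moreover have "C1_on (- K) \<psi>"
        by (rule C1_on_cong[OF _ C1_on_const[of _ 0]]) (use K compact_imp_closed in \<open>auto simp: \<psi>_def\<close>)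
      ultimately show ?thesis using compact_imp_closed[OF K(1)] by (intro exI[of _ "- K"]) auto
    qed
  qed
  then have 0: "(LINT z|lebesgue. fd \<psi> z v) = 0"
    by (rule integral_fd_eq_0[OF _ K(1)]) (simp add: \<psi>_def K)
  have fdf: "blinfun_apply (fd \<phi> z) = frechet_derivative \<phi> (at z)" for z
    using C1_on_imp_has_derivative[OF C, of z] by (simp add: fd_apply differentiableI)
  have 1: "fd \<psi> z v = indicator S z *\<^sub>R (fd \<phi> z v *\<^sub>R f z) + indicator S z *\<^sub>R (\<phi> z *\<^sub>R fd f z v)" for z
  proof (cases "z \<in> S")
    case True
    have "(\<psi> has_derivative (\<lambda>h. \<phi> z *\<^sub>R fd f z h + fd \<phi> z h *\<^sub>R f z)) (at z)"
      unfolding \<psi>_def using C1_on_imp_has_derivative[OF C UNIV_I] C1_on_imp_has_derivative[OF f True]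
      by (rule has_derivative_scaleR)
    then have "fd \<psi> z = Blinfun (\<lambda>h. \<phi> z *\<^sub>R fd f z h + fd \<phi> z h *\<^sub>R f z)"
      by (intro fd_eqI) (simp add: bounded_linear_Blinfun_apply has_derivative_bounded_linear)
    then show ?thesis using True \<open>(\<psi> has_derivative _) _\<close>
      by (simp add: bounded_linear_Blinfun_apply has_derivative_bounded_linear)
  next
    case False
    then have "fd \<psi> z = 0" using zero_outside_fd[OF compact_imp_closed[OF K(1)], of \<psi> z] K by (auto simp: \<psi>_def)
    then show ?thesis using False by simp
  qed
  have i2: "integrable lebesgue (\<lambda>z. indicator S z *\<^sub>R (\<phi> z *\<^sub>R fd f z v))"
    unfolding set_integrable_def[symmetric]
    by (intro integrable_test_function[OF locally_integrable_continuous \<phi>] continuous_intros C1_on_imp_continuous_fd[OF f])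
  have "integrable lebesgue (\<lambda>z. indicator S z *\<^sub>R (fd \<phi> z v *\<^sub>R f z))"
  proof (rule integrable_compact_support(2)[OF K(1)])
    have "continuous_on K (\<lambda>z. fd \<phi> z v *\<^sub>R f z)"
      using C1_on_imp_continuous_fd[OF C] C1_on_imp_continuous_on[OF f] K(2)
      by (auto intro!: continuous_intros intro: continuous_on_subset)
    then show "continuous_on K (\<lambda>z. indicator S z *\<^sub>R (fd \<phi> z v *\<^sub>R f z))"
      using K(2) by (subst continuous_on_cong[OF refl, of _ _ "\<lambda>z. fd \<phi> z v *\<^sub>R f z"]) (auto simp: indicator_def)
    show "indicator S z *\<^sub>R (fd \<phi> z v *\<^sub>R f z) = 0" if "z \<notin> K" for z
      using zero_outside_fd[OF compact_imp_closed[OF K(1)] K(3) that] by simp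
  qed
  then have "(LINT z|lebesgue. fd \<psi> z v) = (LINT z|lebesgue. indicator S z *\<^sub>R (fd \<phi> z v *\<^sub>R f z)) +
      (LINT z|lebesgue. indicator S z *\<^sub>R (\<phi> z *\<^sub>R fd f z v))"
    unfolding 1 by (rule Bochner_Integration.integral_add[OF _ i2])
  with 0 show ?thesis unfolding set_lebesgue_integral_def fdf
    by (simp add: eq_neg_iff_add_eq_0)
qed

section \<open>Charts, differentials and weak derivatives\<close>

text \<open>Changes of charts and differentials are both instances of \<open>fd\<close>; the chain
  rule for \<open>fd\<close> therefore handles all passages between charts.\<close>

lemma tangent_change_eq_fd: "tangent_change c c' x = fd (snd c' \<circ> chart_inv c) (snd c x)"
  by (simp add: tangent_change_def fd_def)

lemma differential_eq_fd:
  "differential N f y = fd (f \<circ> chart_inv (chart_at N y)) (snd (chart_at N y) y)"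
  by (simp add: differential_def fd_def)

locale riemannian =
  fixes M :: "('p, 'm::finite) rmfd"
  assumes riemannian: "riemannian_manifold M"
begin

lemma is_chart: "c \<in> atlas M \<Longrightarrow> is_chart (carrier_top M) c"
  and chart_at: "x \<in> points M \<Longrightarrow> chart_at M x \<in> atlas M" "x \<in> points M \<Longrightarrow> x \<in> fst (chart_at M x)"
  and C2_transition: "c \<in> atlas M \<Longrightarrow> c' \<in> atlas M \<Longrightarrow>
      C2_on (snd c ` (fst c \<inter> fst c')) (snd c' \<circ> chart_inv c)"
  and bilinear_metric: "x \<in> points M \<Longrightarrow> bilinear (metric M x)"
  and metric_sym: "x \<in> points M \<Longrightarrow> metric M x v w = metric M x w v"
  and metric_pos: "x \<in> points M \<Longrightarrow> v \<noteq> 0 \<Longrightarrow> metric M x v v > 0"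
  and C1_metric_in: "c \<in> atlas M \<Longrightarrow> C1_on (chart_img c) (\<lambda>z. metric_in M c z v w)"
  using riemannian unfolding riemannian_manifold_def by blast+

lemma openin_chart_domain: "c \<in> atlas M \<Longrightarrow> openin (carrier_top M) (fst c)"
  and open_chart_img: "c \<in> atlas M \<Longrightarrow> open (chart_img c)"
  and homeomorphic_chart: "c \<in> atlas M \<Longrightarrow>
    homeomorphic_map (subtopology (carrier_top M) (fst c)) (top_of_set (chart_img c)) (snd c)"
  using is_chart unfolding is_chart_def by blast+

lemma chart_domain_subset: "c \<in> atlas M \<Longrightarrow> fst c \<subseteq> points M"
  using openin_chart_domain openin_subset by blast

lemma inj_on_chart: assumes "c \<in> atlas M" shows "inj_on (snd c) (fst c)"
proof -
  have "topspace (subtopology (carrier_top M) (fst c)) = fst c"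
    using chart_domain_subset[OF assms] by auto
  then show ?thesis using homeomorphic_imp_injective_map[OF homeomorphic_chart[OF assms]] by simp
qed

lemma chart_inv_chart: "c \<in> atlas M \<Longrightarrow> x \<in> fst c \<Longrightarrow> chart_inv c (snd c x) = x"
  unfolding chart_inv_def by (simp add: inj_on_chart)

lemma chart_chart_inv: "z \<in> chart_img c \<Longrightarrow> snd c (chart_inv c z) = z"
  and chart_inv_in: "z \<in> chart_img c \<Longrightarrow> chart_inv c z \<in> fst c"
  unfolding chart_inv_def chart_img_def by (auto simp: f_inv_into_f inv_into_into)

lemma chart_in_img: "x \<in> fst c \<Longrightarrow> snd c x \<in> chart_img c"
  by (simp add: chart_img_def)

lemma open_chart_image:
  assumes "c \<in> atlas M" "openin (carrier_top M) B"
  shows "open (snd c ` (B \<inter> fst c))"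
proof -
  have "openin (subtopology (carrier_top M) (fst c)) (B \<inter> fst c)"
    using assms(2) by (auto simp: openin_subtopology)
  then have "openin (top_of_set (chart_img c)) (snd c ` (B \<inter> fst c))"
    using homeomorphic_imp_open_map[OF homeomorphic_chart[OF assms(1)]] by (auto simp: open_map_def)
  then show ?thesis using open_chart_img[OF assms(1)] by (simp add: openin_open_eq)
qed

lemma openin_chart_preimage:
  assumes "c \<in> atlas M" "open V"
  shows "openin (carrier_top M) {x \<in> fst c. snd c x \<in> V}"
proof -
  have "openin (subtopology (carrier_top M) (fst c))
      {x \<in> topspace (subtopology (carrier_top M) (fst c)). snd c x \<in> V \<inter> chart_img c}"
    by (rule openin_continuous_map_preimage[OF homeomorphic_imp_continuous_map[OF homeomorphic_chart[OF assms(1)]]])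
      (use assms(2) in \<open>auto simp: openin_open\<close>)
  moreover have "{x \<in> topspace (subtopology (carrier_top M) (fst c)). snd c x \<in> V \<inter> chart_img c}
      = {x \<in> fst c. snd c x \<in> V}"
    using chart_domain_subset[OF assms(1)] by (auto simp: chart_img_def)
  ultimately show ?thesis
    using openin_trans_full openin_chart_domain[OF assms(1)] by metis
qed

lemma open_overlap: "c \<in> atlas M \<Longrightarrow> c' \<in> atlas M \<Longrightarrow> open (snd c ` (fst c \<inter> fst c'))"
  using open_chart_image[of c "fst c'"] openin_chart_domain by (simp add: Int_commute)

lemma C1_transition: "c \<in> atlas M \<Longrightarrow> c' \<in> atlas M \<Longrightarrow>
      C1_on (snd c ` (fst c \<inter> fst c')) (snd c' \<circ> chart_inv c)"
  using C2_transition C2_on_imp_C1_on by blast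

lemma has_derivative_transition:
  assumes "c \<in> atlas M" "c' \<in> atlas M" "x \<in> fst c" "x \<in> fst c'"
  shows "((snd c' \<circ> chart_inv c) has_derivative blinfun_apply (tangent_change c c' x)) (at (snd c x))"
  using C1_on_imp_has_derivative[OF C1_transition[OF assms(1,2)]] assms by (auto simp: tangent_change_eq_fd)

lemma tangent_change_compose:
  assumes "c \<in> atlas M" "c' \<in> atlas M" "c'' \<in> atlas M" "x \<in> fst c" "x \<in> fst c'" "x \<in> fst c''"
  shows "tangent_change c' c'' x o\<^sub>L tangent_change c c' x = tangent_change c c'' x"
proof -
  have "((snd c'' \<circ> chart_inv c') \<circ> (snd c' \<circ> chart_inv c) has_derivative
      blinfun_apply (tangent_change c' c'' x) \<circ> blinfun_apply (tangent_change c c' x)) (at (snd c x))"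
    by (rule diff_chain_at[OF has_derivative_transition])
      (use assms has_derivative_transition[of c' c'' x] in \<open>auto simp: chart_inv_chart\<close>)
  then have "((snd c'' \<circ> chart_inv c) has_derivative
      blinfun_apply (tangent_change c' c'' x) \<circ> blinfun_apply (tangent_change c c' x)) (at (snd c x))"
    by (rule has_derivative_transform_within_open[OF _ open_overlap[OF assms(1,2)]])
      (use assms in \<open>auto simp: chart_inv_chart\<close>)
  then have "((snd c'' \<circ> chart_inv c) has_derivative
      blinfun_apply (tangent_change c' c'' x o\<^sub>L tangent_change c c' x)) (at (snd c x))"
    by (simp add: blinfun_compose.rep_eq)
  from fd_eqI[OF this] show ?thesis by (simp add: tangent_change_eq_fd)
qed

lemma tangent_change_refl:
  assumes "c \<in> atlas M" "x \<in> fst c"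
  shows "tangent_change c c x = id_blinfun"
proof -
  have "((\<lambda>z. z) has_derivative blinfun_apply id_blinfun) (at (snd c x))" by (simp add: id_blinfun.rep_eq)
  then have "((snd c \<circ> chart_inv c) has_derivative blinfun_apply id_blinfun) (at (snd c x))"
    by (rule has_derivative_transform_within_open[OF _ open_chart_img[OF assms(1)]])
      (use assms in \<open>auto simp: chart_chart_inv chart_in_img\<close>)
  from fd_eqI[OF this] show ?thesis by (simp add: tangent_change_eq_fd)
qed

lemma tangent_change_inverse:
  assumes "c \<in> atlas M" "c' \<in> atlas M" "x \<in> fst c" "x \<in> fst c'"
  shows "tangent_change c' c x (tangent_change c c' x v) = v"
  using tangent_change_compose[of c c' c x] tangent_change_refl[of c x] assms
  by (metis blinfun_apply_blinfun_compose blinfun_apply_id_blinfun)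

text \<open>Chain rule through the distinguished chart. The right-hand side is exactly the
  expression that \<open>has_weak_derivative\<close> tests in the chart c, so for C1 maps the tested
  object is the classical derivative.\<close>

lemma fd_chart:
  assumes f: "C1_map M f" and c: "c \<in> atlas M" and x: "x \<in> fst c"
  shows "fd (f \<circ> chart_inv c) (snd c x) = differential M f x o\<^sub>L tangent_change c (chart_at M x) x"
proof -
  let ?c = "chart_at M x"
  have xp: "x \<in> points M" using x chart_domain_subset[OF c] by auto
  have c': "?c \<in> atlas M" "x \<in> fst ?c" using chart_at[OF xp] by auto
  have 1: "((f \<circ> chart_inv ?c) has_derivative blinfun_apply (differential M f x)) (at (snd ?c x))"
    using C1_on_imp_has_derivative f c' unfolding C1_map_def differential_eq_fd
    by (meson chart_in_img)
  have "((f \<circ> chart_inv ?c) \<circ> (snd ?c \<circ> chart_inv c) has_derivative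
      blinfun_apply (differential M f x) \<circ> blinfun_apply (tangent_change c ?c x)) (at (snd c x))"
    by (rule diff_chain_at[OF has_derivative_transition])
      (use c c' x 1 in \<open>auto simp: chart_inv_chart\<close>)
  then have "((f \<circ> chart_inv c) has_derivative
      blinfun_apply (differential M f x) \<circ> blinfun_apply (tangent_change c ?c x)) (at (snd c x))"
    by (rule has_derivative_transform_within_open[OF _ open_overlap[OF c c'(1)]])
      (use c c' x in \<open>auto simp: chart_inv_chart\<close>)
  then show ?thesis by (intro fd_eqI) (simp add: blinfun_compose.rep_eq)
qed

lemma differential_chart:
  assumes f: "C1_map M f" and c: "c \<in> atlas M" and x: "x \<in> fst c"
  shows "differential M f x = fd (f \<circ> chart_inv c) (snd c x) o\<^sub>L tangent_change (chart_at M x) c x"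
proof (rule blinfun_eqI)
  fix v
  have xp: "x \<in> points M" using x chart_domain_subset[OF c] by auto
  show "differential M f x v = (fd (f \<circ> chart_inv c) (snd c x) o\<^sub>L tangent_change (chart_at M x) c x) v"
    using fd_chart[OF f c x] tangent_change_inverse[OF chart_at(1)[OF xp] c chart_at(2)[OF xp] x]
    by simp
qed

section \<open>Weak derivatives: the classical case and uniqueness\<close>

lemma C1_map_has_weak_derivative:
  fixes f :: "'p \<Rightarrow> 'b::euclidean_space"
  assumes f: "C1_map M f"
  shows "has_weak_derivative M f (differential M f)"
proof -
  have "let f\<^sub>c = (\<lambda>z. f (chart_inv c z));
            F\<^sub>c = (\<lambda>z. let x = chart_inv c z in differential M f x o\<^sub>L tangent_change c (chart_at M x) x)
        in locally_integrable_on f\<^sub>c (chart_img c) \<and>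
           (\<forall>v. locally_integrable_on (\<lambda>z. blinfun_apply (F\<^sub>c z) v) (chart_img c)) \<and>
           (\<forall>\<phi>\<in>test_functions (chart_img c). \<forall>v.
              (LINT z:chart_img c|lebesgue. frechet_derivative \<phi> (at z) v *\<^sub>R f\<^sub>c z) =
              - (LINT z:chart_img c|lebesgue. \<phi> z *\<^sub>R blinfun_apply (F\<^sub>c z) v))" if c: "c \<in> atlas M" for c
  proof -
    define G where "G = (\<lambda>z. let x = chart_inv c z in differential M f x o\<^sub>L tangent_change c (chart_at M x) x)"
    define g where "g = f \<circ> chart_inv c"
    have g: "C1_on (chart_img c) g" using f c by (simp add: C1_map_def g_def)
    have G: "G z = fd g z" if "z \<in> chart_img c" for z
      using fd_chart[OF f c chart_inv_in[OF that]] that by (simp add: G_def Let_def g_def chart_chart_inv)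
    have "continuous_on (chart_img c) G"
      using C1_on_imp_continuous_fd[OF g] by (rule continuous_on_eq) (simp add: G)
    then have 1: "locally_integrable_on (\<lambda>z. blinfun_apply (G z) v) (chart_img c)" for v
      by (intro locally_integrable_continuous continuous_intros)
    have 2: "(LINT z:chart_img c|lebesgue. \<phi> z *\<^sub>R blinfun_apply (G z) v) =
       (LINT z:chart_img c|lebesgue. \<phi> z *\<^sub>R blinfun_apply (fd g z) v)" for \<phi> v
      unfolding set_lebesgue_integral_def by (intro Bochner_Integration.integral_cong) (auto simp: G indicator_def)
    have 3: "locally_integrable_on g (chart_img c)"
      by (rule locally_integrable_continuous[OF C1_on_imp_continuous_on[OF g]])
    have fg: "f (chart_inv c z) = g z" for z by (simp add: g_def)
    then show ?thesis
      unfolding G_def[symmetric] fg Let_def[of g] Let_def[of G]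
      using 1 3 integration_by_parts[OF open_chart_img[OF c] g] by (simp add: 2 fg)
  qed
  then show ?thesis unfolding has_weak_derivative_def by blast
qed

text \<open>For each direction v the difference of the two candidates is annihilated by all test
  functions. Finitely many basis directions determine a linear map, and the change to the
  distinguished chart is invertible. This is what gives control over the choice in
  \<open>weak_derivative\<close>.\<close>

lemma has_weak_derivative_unique:
  fixes f :: "'p \<Rightarrow> 'b::euclidean_space"
  assumes F: "has_weak_derivative M f F" and F': "has_weak_derivative M f F'" and c: "c \<in> atlas M"
  shows "negligible (snd c ` {x \<in> fst c. F x \<noteq> F' x})"
proof -
  define G where "G = (\<lambda>F :: 'p \<Rightarrow> (real ^ 'm) \<Rightarrow>\<^sub>L 'b. \<lambda>z. let x = chart_inv c z in F x o\<^sub>L tangent_change c (chart_at M x) x)"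
  have *: "\<And>v. locally_integrable_on (\<lambda>z. blinfun_apply (G F z) v) (chart_img c)"
    "\<And>\<phi> v. \<phi> \<in> test_functions (chart_img c) \<Longrightarrow>
              (LINT z:chart_img c|lebesgue. frechet_derivative \<phi> (at z) v *\<^sub>R f (chart_inv c z)) =
              - (LINT z:chart_img c|lebesgue. \<phi> z *\<^sub>R blinfun_apply (G F z) v)"
    if "has_weak_derivative M f F" for F
    using that c unfolding has_weak_derivative_def G_def by (simp_all add: Let_def)
  have neg: "negligible {z \<in> chart_img c. G F z v - G F' z v \<noteq> 0}" for v
  proof (rule fundamental_lemma[OF open_chart_img[OF c]])
    show "locally_integrable_on (\<lambda>z. blinfun_apply (G F z) v - blinfun_apply (G F' z) v) (chart_img c)"
      by (intro locally_integrable_diff *(1) F F')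
    fix \<phi> assume \<phi>: "\<phi> \<in> test_functions (chart_img c)"
    have "(LINT z:chart_img c|lebesgue. \<phi> z *\<^sub>R blinfun_apply (G F z) v) =
        (LINT z:chart_img c|lebesgue. \<phi> z *\<^sub>R blinfun_apply (G F' z) v)"
      using *(2)[OF F \<phi>, of v] *(2)[OF F' \<phi>, of v] by simp
    then show "(LINT z:chart_img c|lebesgue. \<phi> z *\<^sub>R (blinfun_apply (G F z) v - blinfun_apply (G F' z) v)) = 0"
      using integrable_test_function[OF *(1)[OF F] \<phi>] integrable_test_function[OF *(1)[OF F'] \<phi>]
      by (simp add: scaleR_diff_right set_integral_diff(2))
  qed
  have "snd c ` {x \<in> fst c. F x \<noteq> F' x} \<subseteq> (\<Union>v\<in>Basis. {z \<in> chart_img c. G F z v - G F' z v \<noteq> 0})"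
  proof clarify
    fix x assume x: "x \<in> fst c" and ne: "F x \<noteq> F' x"
    have xp: "x \<in> points M" using x chart_domain_subset[OF c] by auto
    show "snd c x \<in> (\<Union>v\<in>Basis. {z \<in> chart_img c. G F z v - G F' z v \<noteq> 0})"
    proof (rule ccontr)
      assume "\<not> ?thesis"
      then have "G F (snd c x) v = G F' (snd c x) v" if "v \<in> Basis" for v
        using that chart_in_img[OF x] by auto
      then have eq: "G F (snd c x) = G F' (snd c x)"
        by (rule blinfun_euclidean_eqI)
      have "F x w = F' x w" for w
      proof -
        define v where "v = tangent_change (chart_at M x) c x w"
        have "tangent_change c (chart_at M x) x v = w"
          unfolding v_def using tangent_change_inverse[OF chart_at(1)[OF xp] c chart_at(2)[OF xp] x] .
        then show ?thesis using eq chart_inv_chart[OF c x] unfolding G_def Let_def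
          by (metis blinfun_apply_blinfun_compose)
      qed
      then show False using ne blinfun_eqI by blast
    qed
  qed
  moreover have "negligible (\<Union>v\<in>(Basis :: (real ^ 'm) set). {z \<in> chart_img c. G F z v - G F' z v \<noteq> 0})"
    using neg by (intro negligible_Union) auto
  ultimately show ?thesis using negligible_subset by blast
qed

end

section \<open>The Riemannian measure\<close>

definition volume_density :: "('p, 'm::finite) rmfd \<Rightarrow> ('p, 'm) chart \<Rightarrow> (real ^ 'm) \<Rightarrow> real" where
  "volume_density M c z = sqrt (det (\<chi> i j. metric_in M c z (axis i 1) (axis j 1)))"

lemma suminf_swap_ennreal:
  fixes f :: "nat \<Rightarrow> nat \<Rightarrow> ennreal"
  shows "(\<Sum>i. \<Sum>j. f i j) = (\<Sum>j. \<Sum>i. f i j)"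
  using nn_integral_suminf[of f "count_space UNIV"] by (simp add: nn_integral_count_space_nat)

context riemannian
begin

lemma sigma_algebra_lebesgue_sets: "sigma_algebra (points M) (lebesgue_sets M)"
  unfolding sigma_algebra_iff2
proof (intro conjI ballI allI impI)
  show "lebesgue_sets M \<subseteq> Pow (points M)" by (auto simp: lebesgue_sets_def)
  show "{} \<in> lebesgue_sets M" by (simp add: lebesgue_sets_def)
  show "points M - B \<in> lebesgue_sets M" if B: "B \<in> lebesgue_sets M" for B
  proof -
    have "snd c ` ((points M - B) \<inter> fst c) \<in> sets lebesgue" if c: "c \<in> atlas M" for c
    proof -
      have "snd c ` ((points M - B) \<inter> fst c) = chart_img c - snd c ` (B \<inter> fst c)"
        using inj_on_chart[OF c] chart_domain_subset[OF c] by (auto simp: chart_img_def inj_on_def)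
      moreover have "chart_img c \<in> sets lebesgue" using open_chart_img[OF c] by simp
      ultimately show ?thesis using B c by (auto simp: lebesgue_sets_def)
    qed
    then show ?thesis by (simp add: lebesgue_sets_def)
  qed
  show "(\<Union>i. A i) \<in> lebesgue_sets M" if A: "range A \<subseteq> lebesgue_sets M" for A :: "nat \<Rightarrow> 'p set"
  proof -
    have "snd c ` ((\<Union>i. A i) \<inter> fst c) \<in> sets lebesgue" if c: "c \<in> atlas M" for c
    proof -
      have "snd c ` ((\<Union>i. A i) \<inter> fst c) = (\<Union>i. snd c ` (A i \<inter> fst c))" by auto
      then show ?thesis using A c by (auto simp: lebesgue_sets_def intro!: sets.countable_UN)
    qed
    moreover have "(\<Union>i. A i) \<subseteq> points M" using A by (auto simp: lebesgue_sets_def)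
    ultimately show ?thesis by (simp add: lebesgue_sets_def)
  qed
qed

lemma openin_lebesgue_sets: "openin (carrier_top M) B \<Longrightarrow> B \<in> lebesgue_sets M"
  by (auto simp: lebesgue_sets_def openin_subset dest: open_chart_image)

lemma bilinear_metric_in:
  assumes c: "c \<in> atlas M" and z: "z \<in> chart_img c"
  shows "bilinear (metric_in M c z)"
proof -
  have x: "chart_inv c z \<in> points M" using chart_inv_in[OF z] chart_domain_subset[OF c] by auto
  interpret b: bounded_bilinear "metric M (chart_inv c z)"
    using bilinear_metric[OF x] bilinear_conv_bounded_bilinear by blast
  show ?thesis
    unfolding bilinear_def metric_in_def Let_def
    by (auto intro!: linearI simp: blinfun.bilinear_simps b.add_left b.add_right b.scaleR_left b.scaleR_right)
qed

lemma metric_in_pos: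
  assumes c: "c \<in> atlas M" and z: "z \<in> chart_img c" and v: "v \<noteq> 0"
  shows "metric_in M c z v v > 0"
proof -
  have x: "chart_inv c z \<in> points M" using chart_inv_in[OF z] chart_domain_subset[OF c] by auto
  have "tangent_change c (chart_at M (chart_inv c z)) (chart_inv c z) v \<noteq> 0"
    using tangent_change_inverse[OF c chart_at(1)[OF x] chart_inv_in[OF z] chart_at(2)[OF x], of v] v
    by (metis blinfun.zero_right)
  then show ?thesis unfolding metric_in_def Let_def using metric_pos[OF x] by blast
qed

lemma metric_in_chart_at:
  assumes "x \<in> points M"
  shows "metric_in M (chart_at M x) (snd (chart_at M x) x) = metric M x"
  using chart_at[OF assms] by (intro ext) (simp add: metric_in_def Let_def chart_inv_chart tangent_change_refl)

lemma metric_in_tangent_change: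
  assumes c: "c \<in> atlas M" and x: "x \<in> fst c"
  shows "metric M x (tangent_change c (chart_at M x) x v) (tangent_change c (chart_at M x) x w)
    = metric_in M c (snd c x) v w"
  by (simp add: metric_in_def Let_def chart_inv_chart[OF c x])

end

lemma bilinear_basis_expansion:
  fixes g :: "real ^ 'm::finite \<Rightarrow> real ^ 'm \<Rightarrow> real"
  assumes "bilinear g"
  shows "g v w = (\<Sum>i\<in>UNIV. \<Sum>j\<in>UNIV. v $ i * w $ j * g (axis i 1) (axis j 1))"
proof -
  interpret b: bounded_bilinear g using assms bilinear_conv_bounded_bilinear by blast
  have "g v w = g (\<Sum>i\<in>UNIV. v $ i *\<^sub>R axis i 1) (\<Sum>j\<in>UNIV. w $ j *\<^sub>R axis j 1)"
    using basis_expansion[of v] basis_expansion[of w] by (simp add: scalar_mult_eq_scaleR)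
  also have "\<dots> = (\<Sum>i\<in>UNIV. \<Sum>j\<in>UNIV. v $ i * w $ j * g (axis i 1) (axis j 1))"
    by (subst sum.swap) (simp add: b.sum_left b.sum_right b.scaleR_left b.scaleR_right sum_distrib_left mult_ac)
  finally show ?thesis .
qed

text \<open>The determinant has no zero on the segment from the identity to the Gram matrix.\<close>

lemma det_gram_pos:
  fixes g :: "real ^ 'm::finite \<Rightarrow> real ^ 'm \<Rightarrow> real"
  assumes g: "bilinear g" and pos: "\<And>v. v \<noteq> 0 \<Longrightarrow> g v v > 0"
  shows "det (\<chi> i j. g (axis i 1) (axis j 1)) > 0"
proof (rule ccontr)
  assume np: "\<not> ?thesis"
  define G :: "real ^ 'm ^ 'm" where "G = (\<chi> i j. g (axis i 1) (axis j 1))"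
  define A where "A = (\<lambda>t. (1 - t) *\<^sub>R mat 1 + t *\<^sub>R G)"
  have "continuous_on {0..1} (\<lambda>t. det (A t))"
    unfolding det_def A_def by (auto intro!: continuous_intros)
  moreover have "det (A 0) = 1" "det (A 1) \<le> 0" using np by (simp_all add: A_def G_def)
  ultimately obtain t where t: "0 \<le> t" "t \<le> 1" "det (A t) = 0"
    using IVT2'[of "\<lambda>t. det (A t)" 1 0 0] by auto
  then obtain v where v: "v \<noteq> 0" "A t *v v = 0"
    using invertible_det_nz[of "A t"] matrix_left_invertible_ker[of "A t"] invertible_left_inverse by blast
  have "v \<bullet> (G *v v) = g v v"
    unfolding bilinear_basis_expansion[OF g, of v v] inner_vec_def matrix_vector_mult_def G_def
    by (simp add: sum_distrib_left mult_ac)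
  then have "v \<bullet> (A t *v v) = (1 - t) * (v \<bullet> v) + t * g v v"
    by (simp add: A_def matrix_vector_mult_add_rdistrib scaleR_matrix_vector_assoc[symmetric] inner_add_right)
  moreover have "(1 - t) * (v \<bullet> v) + t * g v v > 0"
    using t pos[OF v(1)] v(1)
    by (cases "t = 0") (auto intro!: add_nonneg_pos mult_nonneg_nonneg)
  ultimately show False using v(2) by simp
qed

context riemannian
begin

lemma volume_density_pos:
  "c \<in> atlas M \<Longrightarrow> z \<in> chart_img c \<Longrightarrow> volume_density M c z > 0"
  unfolding volume_density_def using det_gram_pos[OF bilinear_metric_in] metric_in_pos by simp

lemma continuous_on_volume_density:
  assumes "c \<in> atlas M"
  shows "continuous_on (chart_img c) (volume_density M c)"
  unfolding volume_density_def[abs_def] det_def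
  using C1_on_imp_continuous_on[OF C1_metric_in[OF assms]] by (auto intro!: continuous_intros)

text \<open>\<open>chart_volume\<close> as a genuine measure on coordinate space, with density zero
  off the chart, so that additivity, monotonicity and subadditivity come for free.\<close>

definition chart_measure :: "('p, 'm) chart \<Rightarrow> (real ^ 'm) measure" where
  "chart_measure c = density lebesgue (\<lambda>z. ennreal (indicator (chart_img c) z * volume_density M c z))"

lemma measurable_volume_density:
  assumes "c \<in> atlas M"
  shows "(\<lambda>z. ennreal (indicator (chart_img c) z * volume_density M c z)) \<in> borel_measurable lebesgue"
proof -
  have "(\<lambda>z. indicator (chart_img c) z *\<^sub>R volume_density M c z) \<in> borel_measurable borel"
    by (rule borel_measurable_continuous_on_indicator)
      (use open_chart_img[OF assms] continuous_on_volume_density[OF assms] in auto)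
  then have "(\<lambda>z. indicator (chart_img c) z *\<^sub>R volume_density M c z) \<in> borel_measurable lebesgue"
    by (simp add: measurable_completion)
  then show ?thesis by simp
qed

lemma sets_chart_measure [simp]: "sets (chart_measure c) = sets lebesgue"
  by (simp add: chart_measure_def)

lemma chart_volume_eq:
  assumes c: "c \<in> atlas M" and B: "B \<in> lebesgue_sets M" "B \<subseteq> fst c"
  shows "chart_volume M c B = emeasure (chart_measure c) (snd c ` B)"
proof -
  have s: "snd c ` B \<in> sets lebesgue"
    using B c by (auto simp: lebesgue_sets_def Int_absorb2)
  have sub: "snd c ` B \<subseteq> chart_img c" using B(2) by (auto simp: chart_img_def)
  show ?thesis
    unfolding chart_volume_def chart_measure_def emeasure_density[OF measurable_volume_density[OF c] s]
    by (intro nn_integral_cong) (use sub in \<open>auto simp: indicator_def volume_density_def\<close>)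
qed

text \<open>A second countable space is Lindelof, so the chart domains have a countable subcover. As
  M is nonempty, the subcover is nonempty and can be enumerated, which makes the choice in the
  definition meaningful.\<close>

lemma countable_atlas:
  assumes "points M \<noteq> {}"
  shows "range (countable_atlas M) \<subseteq> atlas M" "(\<Union>i. fst (countable_atlas M i)) = points M"
proof -
  have "Lindelof_space (carrier_top M)"
    using riemannian second_countable_imp_Lindelof_space unfolding riemannian_manifold_def by blast
  moreover have "\<Union>(fst ` atlas M) = points M"
  proof
    show "\<Union>(fst ` atlas M) \<subseteq> points M" using chart_domain_subset by auto
    show "points M \<subseteq> \<Union>(fst ` atlas M)" using chart_at by auto
  qed
  moreover have "\<forall>U \<in> fst ` atlas M. openin (carrier_top M) U" using openin_chart_domain by auto
  ultimately obtain V where V: "countable V" "V \<subseteq> fst ` atlas M" "\<Union>V = points M"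
    using Lindelof_spaceD[of "carrier_top M" "fst ` atlas M"] by meson
  then obtain A where A: "countable A" "A \<subseteq> atlas M" "V = fst ` A"
    using countable_subset_image[of V fst "atlas M"] by auto
  have "A \<noteq> {}" using assms V(3) A(3) by (metis Union_empty image_empty)
  then have "range (from_nat_into A) = A" using A(1) by (simp add: range_from_nat_into)
  moreover have "(\<Union>i. fst (from_nat_into A i)) = \<Union>(fst ` range (from_nat_into A))" by blast
  ultimately have "range (from_nat_into A) \<subseteq> atlas M \<and> (\<Union>i. fst (from_nat_into A i)) = points M"
    using A(2,3) V(3) by (simp only:)
  then have "\<exists>C :: nat \<Rightarrow> ('p, 'm) chart. range C \<subseteq> atlas M \<and> (\<Union>i. fst (C i)) = points M" by (rule exI[of _ "from_nat_into A"])
  from someI_ex[OF this]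
  show "range (countable_atlas M) \<subseteq> atlas M" "(\<Union>i. fst (countable_atlas M i)) = points M"
    unfolding countable_atlas_def by blast+
qed

definition piece :: "nat \<Rightarrow> 'p set" where
  "piece i = fst (countable_atlas M i) - (\<Union>j<i. fst (countable_atlas M j))"

lemma piece_lebesgue_sets:
  assumes "points M \<noteq> {}"
  shows "piece i \<in> lebesgue_sets M"
proof -
  interpret sigma_algebra "points M" "lebesgue_sets M" by (rule sigma_algebra_lebesgue_sets)
  have "fst (countable_atlas M i) \<in> lebesgue_sets M" for i
    using countable_atlas[OF assms] openin_chart_domain openin_lebesgue_sets by blast
  then show ?thesis unfolding piece_def by (intro Diff finite_UN) auto
qed

text \<open>\<open>measure_of\<close> yields the prescribed values only if they are countably
  additive. On a single piece this holds because the chart is injective and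
  \<open>chart_measure\<close> is a measure; the sums over pieces and over sets are then
  interchanged.\<close>

lemma emeasure_riemannian_measure:
  assumes ne: "points M \<noteq> {}"
  shows "space (riemannian_measure M) = points M" "sets (riemannian_measure M) = lebesgue_sets M"
    "B \<in> lebesgue_sets M \<Longrightarrow> emeasure (riemannian_measure M) B =
       (\<Sum>i. chart_volume M (countable_atlas M i) (B \<inter> piece i))"
proof -
  interpret sigma_algebra "points M" "lebesgue_sets M" by (rule sigma_algebra_lebesgue_sets)
  let ?C = "countable_atlas M"
  define \<mu> where "\<mu> = (\<lambda>B. \<Sum>i. chart_volume M (?C i) (B \<inter> piece i))"
  have R: "riemannian_measure M = measure_of (points M) (lebesgue_sets M) \<mu>"
    by (simp add: riemannian_measure_def Let_def \<mu>_def piece_def)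
  show sp: "space (riemannian_measure M) = points M" and "sets (riemannian_measure M) = lebesgue_sets M"
    unfolding R by (auto simp: space_closed sigma_sets_eq)
  have C: "?C i \<in> atlas M" for i using countable_atlas(1)[OF ne] by auto
  have v: "chart_volume M (?C i) (B \<inter> piece i) = emeasure (chart_measure (?C i)) (snd (?C i) ` (B \<inter> piece i))"
    if "B \<in> lebesgue_sets M" for B i
    using that piece_lebesgue_sets[OF ne] by (intro chart_volume_eq C) (auto simp: piece_def)
  have s: "snd (?C i) ` (B \<inter> piece i) \<in> sets (chart_measure (?C i))" if "B \<in> lebesgue_sets M" for B i
  proof -
    have "B \<inter> piece i \<in> lebesgue_sets M" using that piece_lebesgue_sets[OF ne] by auto
    moreover have "B \<inter> piece i \<inter> fst (?C i) = B \<inter> piece i" by (auto simp: piece_def)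
    ultimately show ?thesis using C[of i] unfolding lebesgue_sets_def by (auto dest: bspec)
  qed
  have "countably_additive (lebesgue_sets M) \<mu>"
  proof (rule countably_additiveI)
    fix A :: "nat \<Rightarrow> 'p set"
    assume A: "range A \<subseteq> lebesgue_sets M" "disjoint_family A" "(\<Union>i. A i) \<in> lebesgue_sets M"
    have "(\<Sum>n. \<mu> (A n)) = (\<Sum>i. \<Sum>n. emeasure (chart_measure (?C i)) (snd (?C i) ` (A n \<inter> piece i)))"
      unfolding \<mu>_def using A(1) by (subst suminf_swap_ennreal) (simp add: v image_subset_iff)
    also have "\<dots> = (\<Sum>i. emeasure (chart_measure (?C i)) (\<Union>n. snd (?C i) ` (A n \<inter> piece i)))"
    proof (intro suminf_cong suminf_emeasure)
      fix i
      show "range (\<lambda>n. snd (?C i) ` (A n \<inter> piece i)) \<subseteq> sets (chart_measure (?C i))"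
        using A(1) s by blast
      have "piece i \<subseteq> fst (?C i)" by (auto simp: piece_def)
      then show "disjoint_family (\<lambda>n. snd (?C i) ` (A n \<inter> piece i))"
        using A(2) inj_on_chart[OF C[of i]] unfolding disjoint_family_on_def inj_on_def by blast
    qed
    also have "\<dots> = \<mu> (\<Union>i. A i)"
      unfolding \<mu>_def using A(3) by (simp add: v image_UN[symmetric])
    finally show "(\<Sum>i. \<mu> (A i)) = \<mu> (\<Union>i. A i)" .
  qed
  moreover have "positive (lebesgue_sets M) \<mu>"
    by (simp add: positive_def \<mu>_def chart_volume_def)
  ultimately show "B \<in> lebesgue_sets M \<Longrightarrow> emeasure (riemannian_measure M) B =
       (\<Sum>i. chart_volume M (countable_atlas M i) (B \<inter> piece i))"
    unfolding R using emeasure_measure_of_sigma[OF sigma_algebra_axioms] by (simp add: \<mu>_def)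
qed

text \<open>Passes from uniqueness of weak derivatives, which is a statement in each chart, to the
  Riemannian measure: each of the countably many pieces contributes an integral over a negligible
  set.\<close>

lemma AE_riemannian_measure:
  assumes ne: "points M \<noteq> {}"
    and neg: "\<And>c. c \<in> atlas M \<Longrightarrow> negligible (snd c ` {x \<in> fst c. \<not> P x})"
  shows "AE x in riemannian_measure M. P x"
proof (rule AE_I)
  define N where "N = {x \<in> points M. \<not> P x}"
  show "{x \<in> space (riemannian_measure M). \<not> P x} \<subseteq> N"
    by (simp add: N_def emeasure_riemannian_measure[OF ne])
  have "N \<inter> fst c = {x \<in> fst c. \<not> P x}" if "c \<in> atlas M" for c
    using chart_domain_subset[OF that] by (auto simp: N_def)
  then have n: "negligible (snd c ` (N \<inter> fst c))" if "c \<in> atlas M" for c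
    using neg that by simp
  then have N: "N \<in> lebesgue_sets M"
    unfolding lebesgue_sets_def using negligible_iff_null_sets by (auto simp: N_def)
  then show "N \<in> sets (riemannian_measure M)" by (simp add: emeasure_riemannian_measure[OF ne])
  interpret sigma_algebra "points M" "lebesgue_sets M" by (rule sigma_algebra_lebesgue_sets)
  have "chart_volume M (countable_atlas M i) (N \<inter> piece i) = 0" for i
  proof -
    let ?c = "countable_atlas M i"
    have c: "?c \<in> atlas M" using countable_atlas(1)[OF ne] by auto
    have "snd ?c ` (N \<inter> piece i) \<subseteq> snd ?c ` (N \<inter> fst ?c)" by (auto simp: piece_def)
    then have "snd ?c ` (N \<inter> piece i) \<in> null_sets lebesgue"
      using n[OF c] negligible_iff_null_sets negligible_subset by blast
    then have "AE z in lebesgue. z \<notin> snd ?c ` (N \<inter> piece i)" by (rule AE_not_in)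
    then have "(\<integral>\<^sup>+ z \<in> snd ?c ` (N \<inter> piece i). ennreal (volume_density M ?c z) \<partial>lebesgue) =
        (\<integral>\<^sup>+ z. 0 \<partial>(lebesgue :: (real ^ 'm) measure))"
      by (intro nn_integral_cong_AE) (auto elim!: eventually_mono simp: indicator_def)
    then show ?thesis unfolding chart_volume_def volume_density_def by simp
  qed
  then show "emeasure (riemannian_measure M) N = 0"
    by (simp add: emeasure_riemannian_measure(3)[OF ne N])
qed

text \<open>On the first nonempty chart of the chosen countable atlas the measure is the chart volume itself,
  so the change of variables formula is never needed.\<close>

lemma first_chart:
  assumes ne: "points M \<noteq> {}"
  obtains c where "c \<in> atlas M" "fst c \<noteq> {}"
    "\<And>B. B \<in> lebesgue_sets M \<Longrightarrow> B \<subseteq> fst c \<Longrightarrow>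
       emeasure (riemannian_measure M) B = emeasure (chart_measure c) (snd c ` B)"
proof -
  let ?C = "countable_atlas M"
  have "\<exists>i. fst (?C i) \<noteq> {}" using countable_atlas(2)[OF ne] ne by (metis SUP_bot_conv(2) )
  define k where "k = (LEAST i. fst (?C i) \<noteq> {})"
  have k: "fst (?C k) \<noteq> {}" unfolding k_def by (rule LeastI_ex) fact
  have less: "fst (?C j) = {}" if "j < k" for j using not_less_Least that unfolding k_def by blast
  have C: "?C k \<in> atlas M" using countable_atlas(1)[OF ne] by auto
  show ?thesis
  proof (rule that[OF C k])
    fix B assume B: "B \<in> lebesgue_sets M" "B \<subseteq> fst (?C k)"
    \<comment> \<open>The domains before k are empty, so piece k is the whole domain of its chart,
      and every later piece avoids that domain.\<close>
    have "B \<inter> piece i = (if i = k then B else {})" for i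
      using B(2) less by (cases i k rule: linorder_cases) (auto simp: piece_def)
    then have "(\<Sum>i. chart_volume M (?C i) (B \<inter> piece i)) = (\<Sum>i. if i = k then chart_volume M (?C k) B else 0)"
      by (intro suminf_cong) (auto simp: chart_volume_def)
    also have "\<dots> = chart_volume M (?C k) B"
      using sums_single[of k "\<lambda>_. chart_volume M (?C k) B"] sums_unique by metis
    finally show "emeasure (riemannian_measure M) B = emeasure (chart_measure (?C k)) (snd (?C k) ` B)"
      using emeasure_riemannian_measure(3)[OF ne B(1)] chart_volume_eq[OF C B] by simp
  qed
qed

lemma emeasure_chart_measure_open:
  assumes c: "c \<in> atlas M" and V: "open V" "V \<noteq> {}" "V \<subseteq> chart_img c"
  shows "emeasure (chart_measure c) V > 0"
proof (rule ccontr)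
  assume "\<not> ?thesis"
  then have "(\<integral>\<^sup>+ z. ennreal (indicator (chart_img c) z * volume_density M c z) * indicator V z \<partial>lebesgue) = 0"
    unfolding chart_measure_def using V(1) by (subst emeasure_density[symmetric, OF measurable_volume_density[OF c]]) auto
  then have "AE z in lebesgue. ennreal (indicator (chart_img c) z * volume_density M c z) * indicator V z = 0"
    by (subst (asm) nn_integral_0_iff_AE)
      (use V(1) in \<open>auto intro!: borel_measurable_times_ennreal measurable_volume_density[OF c] borel_measurable_indicator\<close>)
  moreover have "ennreal (indicator (chart_img c) z * volume_density M c z) * indicator V z \<noteq> 0" if "z \<in> V" for z
    using volume_density_pos[OF c, of z] V(3) that by auto
  ultimately have "AE z in lebesgue. z \<notin> V" by (auto elim!: eventually_mono)
  then have "V \<in> null_sets lebesgue" using V(1) by (subst AE_iff_null_sets) auto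
  then show False using open_not_negligible[OF V(1,2)] negligible_iff_null_sets by blast
qed

lemma emeasure_chart_measure_compact:
  assumes c: "c \<in> atlas M" and K: "compact K" "K \<subseteq> chart_img c"
  shows "emeasure (chart_measure c) K < \<infinity>"
proof -
  have "integrable lborel (\<lambda>z. indicator K z *\<^sub>R volume_density M c z)"
    using K continuous_on_subset[OF continuous_on_volume_density[OF c]] by (intro borel_integrable_compact) auto
  then have "integrable lebesgue (\<lambda>z. indicator K z *\<^sub>R volume_density M c z)"
    using integrable_completion borel_measurable_integrable by blast
  then have "(\<integral>\<^sup>+ z. ennreal (norm (indicator K z *\<^sub>R volume_density M c z)) \<partial>lebesgue) < \<infinity>"
    by (simp add: integrable_iff_bounded)
  moreover have "emeasure (chart_measure c) K =
     (\<integral>\<^sup>+ z. ennreal (indicator (chart_img c) z * volume_density M c z) * indicator K z \<partial>lebesgue)"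
    unfolding chart_measure_def
    by (rule emeasure_density[OF measurable_volume_density[OF c]]) (use K in \<open>auto simp: compact_imp_closed\<close>)
  moreover have "\<dots> = (\<integral>\<^sup>+ z. ennreal (norm (indicator K z *\<^sub>R volume_density M c z)) \<partial>lebesgue)"
    by (intro nn_integral_cong) (use K(2) volume_density_pos[OF c] in \<open>auto simp: indicator_def less_imp_le\<close>)
  ultimately show ?thesis by simp
qed

end

section \<open>Hilbert--Schmidt norms of linear maps of rank one\<close>

definition inner_product :: "(real ^ 'm::finite \<Rightarrow> real ^ 'm \<Rightarrow> real) \<Rightarrow> bool" where
  "inner_product g \<longleftrightarrow> bilinear g \<and> (\<forall>v w. g v w = g w v) \<and> (\<forall>v. v \<noteq> 0 \<longrightarrow> g v v > 0)"

definition orthonormal_set :: "(real ^ 'm::finite \<Rightarrow> real ^ 'm \<Rightarrow> real) \<Rightarrow> (real ^ 'm) set \<Rightarrow> bool" where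
  "orthonormal_set g B \<longleftrightarrow> finite B \<and> (\<forall>e\<in>B. \<forall>e'\<in>B. g e e' = (if e = e' then 1 else 0))"

lemma orthonormal_basis_iff:
  "orthonormal_basis (g :: real ^ 'm::finite \<Rightarrow> real ^ 'm \<Rightarrow> real) B \<longleftrightarrow> orthonormal_set g B \<and> card B = CARD('m)"
  by (auto simp: orthonormal_basis_def orthonormal_set_def)

lemma orthonormal_set_coeff:
  assumes g: "inner_product g" and B: "orthonormal_set g B" and e: "e \<in> B"
  shows "g (\<Sum>e'\<in>B. u e' *\<^sub>R e') e = u e"
proof -
  interpret b: bounded_bilinear g
    using g bilinear_conv_bounded_bilinear unfolding inner_product_def by blast
  have "g (\<Sum>e'\<in>B. u e' *\<^sub>R e') e = (\<Sum>e'\<in>B. u e' * g e' e)"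
    by (simp add: b.sum_left b.scaleR_left)
  also have "\<dots> = (\<Sum>e'\<in>B. if e' = e then u e' else 0)"
    by (rule sum.cong) (use B e in \<open>auto simp: orthonormal_set_def\<close>)
  also have "\<dots> = u e" using B e by (simp add: orthonormal_set_def)
  finally show ?thesis .
qed

text \<open>Gram-Schmidt, one vector at a time: fewer than \<open>CARD('m)\<close> vectors do not
  span. Without existence the basis chosen in \<open>hs_norm\<close> would be arbitrary.\<close>

lemma orthonormal_set_exists:
  fixes g :: "real ^ 'm::finite \<Rightarrow> real ^ 'm \<Rightarrow> real"
  assumes g: "inner_product g" and "k \<le> CARD('m)"
  shows "\<exists>B. orthonormal_set g B \<and> card B = k"
  using assms(2)
proof (induction k)
  case 0
  show ?case by (rule exI[of _ "{}"]) (simp add: orthonormal_set_def)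
next
  case (Suc k)
  interpret b: bounded_bilinear g
    using g bilinear_conv_bounded_bilinear unfolding inner_product_def by blast
  obtain B where B: "orthonormal_set g B" "card B = k" using Suc by auto
  then have fin: "finite B" by (simp add: orthonormal_set_def)
  have "dim (span B) < DIM(real ^ 'm)"
    using dim_le_card'[OF fin] B(2) Suc.prems by simp
  then have "span B \<noteq> UNIV" using dim_UNIV by (metis less_irrefl)
  then obtain v where v: "v \<notin> span B" by blast
  define w where "w = v - (\<Sum>e\<in>B. g v e *\<^sub>R e)"
  have "(\<Sum>e\<in>B. g v e *\<^sub>R e) \<in> span B" by (intro span_sum span_scale span_base)
  then have "w \<noteq> 0" using v by (auto simp: w_def)
  then have pos: "g w w > 0" using g by (simp add: inner_product_def)
  have we: "g w e = 0" "g e w = 0" if "e \<in> B" for e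
  proof -
    show "g w e = 0"
      using orthonormal_set_coeff[OF g B(1) that, of "\<lambda>e. g v e"] by (simp add: w_def b.diff_left)
    then show "g e w = 0" using g by (metis inner_product_def)
  qed
  define n where "n = w /\<^sub>R sqrt (g w w)"
  have nn: "g n n = 1" using pos by (simp add: n_def b.scaleR_left b.scaleR_right field_simps)
  have ne: "g n e = 0" "g e n = 0" if "e \<in> B" for e
    using we[OF that] by (simp_all add: n_def b.scaleR_left b.scaleR_right)
  have "n \<notin> B" using nn ne by force
  moreover have "orthonormal_set g (insert n B)"
    using B(1) nn ne \<open>n \<notin> B\<close> unfolding orthonormal_set_def by auto
  ultimately show ?case using B(2) fin by (intro exI[of _ "insert n B"]) auto
qed

lemma orthonormal_basis_expansion:
  fixes g :: "real ^ 'm::finite \<Rightarrow> real ^ 'm \<Rightarrow> real"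
  assumes g: "inner_product g" and B: "orthonormal_basis g B"
  shows "v = (\<Sum>e\<in>B. g v e *\<^sub>R e)"
proof -
  have B': "orthonormal_set g B" "card B = CARD('m)" "finite B"
    using B by (auto simp: orthonormal_basis_iff orthonormal_set_def)
  interpret b: bounded_bilinear g
    using g bilinear_conv_bounded_bilinear unfolding inner_product_def by blast
  have "independent B"
  proof
    assume "dependent B"
    then obtain u where u: "\<exists>e\<in>B. u e \<noteq> 0" "(\<Sum>e\<in>B. u e *\<^sub>R e) = 0"
      using dependent_finite[OF B'(3)] by auto
    then have "u e = 0" if "e \<in> B" for e
      using orthonormal_set_coeff[OF g B'(1) that, of u] by (simp add: b.zero_left)
    then show False using u by blast
  qed
  then have "UNIV \<subseteq> span B"
    by (rule card_ge_dim_independent[OF subset_UNIV]) (simp add: dim_UNIV B'(2))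
  then have "v \<in> span B" by blast
  then obtain u where u: "v = (\<Sum>e\<in>B. u e *\<^sub>R e)" using span_finite[OF B'(3)] by auto
  then have "u e = g v e" if "e \<in> B" for e
    using orthonormal_set_coeff[OF g B'(1) that, of u] by simp
  with u show ?thesis by simp
qed

lemma some_orthonormal_basis:
  fixes g :: "real ^ 'm::finite \<Rightarrow> real ^ 'm \<Rightarrow> real"
  assumes "inner_product g"
  shows "orthonormal_basis g (SOME B. orthonormal_basis g B)"
  using someI_ex[of "orthonormal_basis g"] orthonormal_set_exists[OF assms, of "CARD('m)"]
  by (auto simp: orthonormal_basis_iff)

text \<open>The dual norm of a covector, computed with the very basis that \<open>hs_norm\<close>
  chooses. Norms of maps of rank one then factor without any appeal to independence of the
  basis.\<close>

definition conorm :: "(real ^ 'm::finite \<Rightarrow> real ^ 'm \<Rightarrow> real) \<Rightarrow> ((real ^ 'm) \<Rightarrow>\<^sub>L real) \<Rightarrow> real" where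
  "conorm g \<alpha> = sqrt (\<Sum>e\<in>(SOME B. orthonormal_basis g B). (\<alpha> e)\<^sup>2)"

lemma conorm_nonneg: "0 \<le> conorm g \<alpha>"
  by (simp add: conorm_def sum_nonneg)

lemma hs_norm_rank_one:
  fixes \<alpha> :: "(real ^ 'm::finite) \<Rightarrow>\<^sub>L real" and h :: "'b::euclidean_space \<Rightarrow> 'b \<Rightarrow> real"
  assumes h: "bilinear h" and L: "\<And>w. L w = \<alpha> w *\<^sub>R v"
  shows "hs_norm g h L = sqrt (h v v) * conorm g \<alpha>"
proof -
  interpret b: bounded_bilinear h
    using h bilinear_conv_bounded_bilinear by blast
  have "h (L e) (L e) = h v v * (\<alpha> e)\<^sup>2" for e
    by (simp add: L b.scaleR_left b.scaleR_right power2_eq_square)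
  then show ?thesis
    by (simp add: hs_norm_def conorm_def sum_distrib_left[symmetric] real_sqrt_mult)
qed

lemma conorm_scaleR: "conorm g (c *\<^sub>R \<alpha>) = \<bar>c\<bar> * conorm g \<alpha>"
  by (simp add: conorm_def blinfun.bilinear_simps power_mult_distrib sum_distrib_left[symmetric] real_sqrt_mult)

lemma conorm_zero [simp]: "conorm g 0 = 0"
  by (simp add: conorm_def)

text \<open>Cauchy-Schwarz for the coefficients in the chosen basis. It turns one large directional
  derivative into a lower bound for the covector norm.\<close>

lemma abs_le_conorm:
  fixes g :: "real ^ 'm::finite \<Rightarrow> real ^ 'm \<Rightarrow> real" and \<alpha> :: "(real ^ 'm) \<Rightarrow>\<^sub>L real"
  assumes g: "inner_product g"
  shows "\<bar>\<alpha> w\<bar> \<le> sqrt (g w w) * conorm g \<alpha>"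
proof -
  define B where "B = (SOME B. orthonormal_basis g B)"
  have B: "orthonormal_basis g B" unfolding B_def by (rule some_orthonormal_basis[OF g])
  interpret b: bounded_bilinear g
    using g bilinear_conv_bounded_bilinear unfolding inner_product_def by blast
  have w: "w = (\<Sum>e\<in>B. g w e *\<^sub>R e)" by (rule orthonormal_basis_expansion[OF g B])
  have "\<alpha> w = (\<Sum>e\<in>B. g w e * \<alpha> e)"
    by (subst w) (simp add: blinfun.sum_right blinfun.scaleR_right)
  moreover have "g w w = (\<Sum>e\<in>B. (g w e)\<^sup>2)"
    by (subst (2) w) (simp add: b.sum_right b.scaleR_right power2_eq_square)
  moreover have "\<bar>\<Sum>e\<in>B. g w e * \<alpha> e\<bar> \<le> (\<Sum>e\<in>B. \<bar>g w e\<bar> * \<bar>\<alpha> e\<bar>)"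
    by (rule order_trans[OF sum_abs]) (simp add: abs_mult)
  ultimately show ?thesis
    using L2_set_mult_ineq[of "\<lambda>e. g w e" "\<lambda>e. \<alpha> e" B] unfolding conorm_def B_def[symmetric] L2_set_def by simp
qed

lemma conorm_le:
  fixes g :: "real ^ 'm::finite \<Rightarrow> real ^ 'm \<Rightarrow> real" and \<alpha> :: "(real ^ 'm) \<Rightarrow>\<^sub>L real"
  assumes g: "inner_product g" and C: "\<And>e. g e e = 1 \<Longrightarrow> \<bar>\<alpha> e\<bar> \<le> C"
  shows "conorm g \<alpha> \<le> sqrt (real CARD('m)) * \<bar>C\<bar>"
proof -
  define B where "B = (SOME B. orthonormal_basis g B)"
  have B: "orthonormal_basis g B" unfolding B_def by (rule some_orthonormal_basis[OF g])
  have "(\<Sum>e\<in>B. (\<alpha> e)\<^sup>2) \<le> (\<Sum>e\<in>B. C\<^sup>2)"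
  proof (rule sum_mono)
    fix e assume "e \<in> B"
    then have "\<bar>\<alpha> e\<bar> \<le> C" using B C by (auto simp: orthonormal_basis_def)
    then show "(\<alpha> e)\<^sup>2 \<le> C\<^sup>2" using abs_le_square_iff by fastforce
  qed
  also have "\<dots> = real CARD('m) * C\<^sup>2" using B by (simp add: orthonormal_basis_def)
  finally have "sqrt (\<Sum>e\<in>B. (\<alpha> e)\<^sup>2) \<le> sqrt (real CARD('m) * C\<^sup>2)" by (rule real_sqrt_le_mono)
  then show ?thesis unfolding conorm_def B_def[symmetric] by (simp add: real_sqrt_mult)
qed

context riemannian
begin

lemma inner_product_metric: "x \<in> points M \<Longrightarrow> inner_product (metric M x)"
  unfolding inner_product_def using bilinear_metric metric_sym metric_pos by blast

end

section \<open>Stereographic coordinates on the round sphere\<close>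

abbreviation (input) sph :: "((real ^ 'n::finite) \<times> real, 'n) rmfd" where "sph \<equiv> round_sphere"

text \<open>Inverse stereographic projection from (0, s). It is written with t / (1 + t) at t =
  \<open>z \<bullet> z\<close>, so that its smoothness follows from \<open>C1_on_saturate\<close>;
  \<open>sinv_alt\<close> is the usual form.\<close>

definition sinv :: "real \<Rightarrow> real ^ 'n::finite \<Rightarrow> (real ^ 'n) \<times> real" where
  "sinv s z = ((2 - 2 * ((z \<bullet> z) / (1 + z \<bullet> z))) *\<^sub>R z, s * (2 * ((z \<bullet> z) / (1 + z \<bullet> z)) - 1))"

lemma sinv_alt: "sinv s z = ((2 / (1 + z \<bullet> z)) *\<^sub>R z, s * (z \<bullet> z - 1) / (1 + z \<bullet> z))"
proof -
  have "1 + z \<bullet> z > 0" by (simp add: add_pos_nonneg)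
  then show ?thesis by (simp add: sinv_def field_simps)
qed

lemma sphere_iff: "(w, h) \<in> sphere 0 1 \<longleftrightarrow> w \<bullet> w + h\<^sup>2 = 1"
  by (simp add: norm_prod_def power2_norm_eq_inner)

lemma stereo_sinv:
  assumes s: "s \<in> {1, -1}"
  shows "sinv s z \<in> fst (stereo s)" "snd (stereo s) (sinv s z) = z"
proof -
  have p: "1 + z \<bullet> z > 0" by (simp add: add_pos_nonneg)
  have ss: "s * s = 1" using s by auto
  have "(4 * (z \<bullet> z) + (z \<bullet> z - 1)\<^sup>2) = (1 + z \<bullet> z)\<^sup>2" by (simp add: power2_eq_square algebra_simps)
  then have "sinv s z \<in> sphere 0 1"
    using p ss unfolding sinv_alt sphere_iff
    by (simp add: power_divide power_mult_distrib power2_eq_square[of s] divide_simps) (simp add: power2_eq_square algebra_simps)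
  moreover have "sinv s z \<noteq> (0, s)"
  proof
    assume "sinv s z = (0, s)"
    then have "s * (z \<bullet> z - 1) / (1 + z \<bullet> z) = s" by (simp add: sinv_alt)
    then have "s * (z \<bullet> z - 1) = s * (1 + z \<bullet> z)" using p by (simp only: divide_eq_eq split: if_splits)
    then show False using s by auto
  qed
  ultimately show "sinv s z \<in> fst (stereo s)" by (simp add: stereo_def)
  have "1 - s * (s * (z \<bullet> z - 1) / (1 + z \<bullet> z)) = 2 / (1 + z \<bullet> z)"
    using p ss by (simp add: mult.assoc[symmetric] field_simps)
  then have "snd (stereo s) (sinv s z) = ((2 / (1 + z \<bullet> z)) *\<^sub>R z) /\<^sub>R (2 / (1 + z \<bullet> z))"
    by (simp only: stereo_def sinv_alt snd_conv prod.case times_divide_eq_right)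
  also have "\<dots> = z"
  proof -
    have "2 / (1 + z \<bullet> z) \<noteq> 0" using p by simp
    from left_inverse[OF this] show ?thesis by (simp only: scaleR_scaleR scaleR_one)
  qed
  finally show "snd (stereo s) (sinv s z) = z" .
qed

lemma sinv_stereo:
  assumes s: "s \<in> {1, -1}" and y: "y \<in> fst (stereo s)"
  shows "sinv s (snd (stereo s) y) = y"
proof (cases y)
  case (Pair w h)
  have ss: "s * s = 1" using s by auto
  have n: "w \<bullet> w + h\<^sup>2 = 1" using y Pair unfolding stereo_def fst_conv by (simp only: sphere_iff Diff_iff)
  have "s * h \<noteq> 1"
  proof
    assume "s * h = 1"
    then have "h = s" using s by auto
    then have "w \<bullet> w = 0" using n ss by (simp add: power2_eq_square)
    then show False using y Pair \<open>h = s\<close> by (simp add: stereo_def)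
  qed
  then have d: "1 - s * h \<noteq> 0" by simp
  define z where "z = w /\<^sub>R (1 - s * h)"
  have sh: "(s * h)\<^sup>2 = h\<^sup>2" using ss by (simp add: power_mult_distrib power2_eq_square[of s])
  have "w \<bullet> w = (1 - s * h) * (1 + s * h)" proof -
    have "w \<bullet> w = 1 - (s * h)\<^sup>2" using n sh by simp
    also have "\<dots> = (1 - s * h) * (1 + s * h)" by (simp add: power2_eq_square algebra_simps)
    finally show ?thesis .
  qed
  then have zz: "z \<bullet> z = (1 + s * h) / (1 - s * h)"
  proof -
    have "z \<bullet> z = (w \<bullet> w) * inverse (1 - s * h) * inverse (1 - s * h)" by (simp add: z_def)
    also have "\<dots> = (1 + s * h) / (1 - s * h)"
      using d by (simp add: \<open>w \<bullet> w = _\<close> divide_inverse)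
    finally show ?thesis .
  qed
  then have a: "1 + z \<bullet> z = 2 / (1 - s * h)" using d by (simp add: field_simps)
  have b: "z \<bullet> z - 1 = 2 * (s * h) / (1 - s * h)" using d zz by (simp add: field_simps)
  have "2 / (1 + z \<bullet> z) = 1 - s * h" unfolding a using d by simp
  moreover have "(1 - s * h) *\<^sub>R z = w" using d by (simp add: z_def)
  moreover have "s * (z \<bullet> z - 1) / (1 + z \<bullet> z) = h"
  proof -
    have "s * (z \<bullet> z - 1) / (1 + z \<bullet> z) = (s * s) * h" unfolding a b using d by (simp add: mult.assoc)
    then show ?thesis using ss by simp
  qed
  ultimately have "sinv s z = (w, h)"
    unfolding sinv_alt by simp
  then show ?thesis using Pair by (simp add: stereo_def z_def)
qed

lemma chart_img_stereo: "s \<in> {1, -1} \<Longrightarrow> chart_img (stereo s) = (UNIV :: (real ^ 'n::finite) set)"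
  unfolding chart_img_def using stereo_sinv by (metis UNIV_eq_I image_eqI)

lemma chart_inv_stereo: "s \<in> {1, -1} \<Longrightarrow> chart_inv (stereo s) = sinv s"
proof
  fix z :: "real ^ 'n"
  assume s: "s \<in> {1, -1}"
  have "inj_on (snd (stereo s)) (fst (stereo s) :: ((real ^ 'n) \<times> real) set)"
    using sinv_stereo[OF s] by (metis inj_onI)
  then show "chart_inv (stereo s) z = sinv s z"
    unfolding chart_inv_def using stereo_sinv[OF s, of z] by (metis inv_into_f_f)
qed

lemma C1_on_Pair:
  fixes f :: "'a::euclidean_space \<Rightarrow> 'b::euclidean_space" and g :: "'a \<Rightarrow> 'c::euclidean_space"
  assumes "C1_on S f" "C1_on S g"
  shows "C1_on S (\<lambda>z. (f z, g z))"
proof -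
  have "C1_on S (\<lambda>z. (f z, 0) + (0, g z))"
  proof (rule C1_on_add)
    show "C1_on S (\<lambda>z. (f z, 0))"
      using C1_on_compose[OF C1_on_bounded_linear[of "\<lambda>x. (x, 0)" UNIV] assms(1)]
      by (simp add: o_def bounded_linear_Pair bounded_linear_ident bounded_linear_zero)
    show "C1_on S (\<lambda>z. (0, g z))"
      using C1_on_compose[OF C1_on_bounded_linear[of "\<lambda>x. (0, x)" UNIV] assms(2)]
      by (simp add: o_def bounded_linear_Pair bounded_linear_ident bounded_linear_zero)
  qed
  then show ?thesis by simp
qed


lemma C1_on_sinv: "C1_on S (sinv s)"
  unfolding sinv_def[abs_def]
  by (intro C1_on_Pair C1_on_scaleR C1_on_mult C1_on_diff C1_on_const C1_on_saturate C1_on_inner C1_on_id) auto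

definition dsinv :: "real \<Rightarrow> real ^ 'n::finite \<Rightarrow> real ^ 'n \<Rightarrow> (real ^ 'n) \<times> real" where
  "dsinv s z v = ((2 / (1 + z \<bullet> z)) *\<^sub>R v - (4 * (z \<bullet> v) / (1 + z \<bullet> z)\<^sup>2) *\<^sub>R z,
     s * (4 * (z \<bullet> v) / (1 + z \<bullet> z)\<^sup>2))"

lemma has_derivative_sinv: "(sinv s has_derivative dsinv s z) (at z)"
proof -
  have p: "1 + z \<bullet> z \<noteq> 0" using inner_ge_zero[of z] by linarith
  have q: "((\<lambda>z. 2 / (1 + z \<bullet> z)) has_derivative (\<lambda>v. - (4 * (z \<bullet> v) / (1 + z \<bullet> z)\<^sup>2))) (at z)"
    using p by (auto intro!: derivative_eq_intros simp: inner_commute power2_eq_square field_simps)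
  have eq: "sinv s = (\<lambda>z. ((2 / (1 + z \<bullet> z)) *\<^sub>R z, s * (1 - 2 / (1 + z \<bullet> z))))"
  proof
    fix z :: "real ^ 'n"
    have "1 + z \<bullet> z \<noteq> 0" using inner_ge_zero[of z] by linarith
    then show "sinv s z = ((2 / (1 + z \<bullet> z)) *\<^sub>R z, s * (1 - 2 / (1 + z \<bullet> z)))"
      by (simp add: sinv_alt field_simps)
  qed
  show ?thesis unfolding eq dsinv_def[abs_def]
    by (rule has_derivative_eq_rhs[OF has_derivative_Pair[OF has_derivative_scaleR[OF q has_derivative_ident]
          has_derivative_mult_right[OF has_derivative_diff[OF has_derivative_const q]]]])
      (auto simp: fun_eq_iff)
qed

text \<open>Conformality of stereographic projection, with factor 2 / (1 + |z|^2). The pole enters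
  through s * s = 1 only, so both charts give the same metric formula.\<close>

lemma inner_dsinv:
  assumes "s * s = 1"
  shows "dsinv s z v \<bullet> dsinv s z w = 4 * (v \<bullet> w) / (1 + z \<bullet> z)\<^sup>2"
proof -
  have p: "1 + z \<bullet> z \<noteq> 0" using inner_ge_zero[of z] by linarith
  define a where "a = 1 + z \<bullet> z"
  have zz: "z \<bullet> z = a - 1" and a: "a \<noteq> 0" using p by (simp_all add: a_def)
  define P where "P = 4 * (z \<bullet> v) / a\<^sup>2"
  define Q where "Q = 4 * (z \<bullet> w) / a\<^sup>2"
  define A where "A = 2 / a"
  have "dsinv s z v \<bullet> dsinv s z w = (A *\<^sub>R v - P *\<^sub>R z) \<bullet> (A *\<^sub>R w - Q *\<^sub>R z) + (s * P) * (s * Q)"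
    by (simp add: dsinv_def a_def P_def Q_def A_def)
  also have "\<dots> = A\<^sup>2 * (v \<bullet> w) - A * Q * (z \<bullet> v) - A * P * (z \<bullet> w)
     + P * Q * (a - 1) + (s * s) * (P * Q)"
    by (simp add: inner_diff_left inner_diff_right zz inner_commute[of v z] power2_eq_square algebra_simps)
  also have "\<dots> = A\<^sup>2 * (v \<bullet> w) - A * Q * (z \<bullet> v) - A * P * (z \<bullet> w) + P * Q * a"
    using assms by (simp add: algebra_simps)
  also have "\<dots> = 4 * (v \<bullet> w) / a\<^sup>2"
    using a by (simp add: P_def Q_def A_def field_simps power2_eq_square)
  finally show ?thesis by (simp add: a_def)
qed

lemma linear_dsinv: "linear (dsinv s z)"
  using has_derivative_sinv has_derivative_linear by blast

text \<open>Injectivity, read off from conformality. It recovers tangent vectors of the sphere from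
  the ambient coordinates of their images.\<close>

lemma dsinv_eq_iff:
  assumes "s * s = 1"
  shows "dsinv s z v = dsinv s z w \<longleftrightarrow> v = w"
proof
  assume "dsinv s z v = dsinv s z w"
  then have "dsinv s z (v - w) = 0" by (simp add: linear_diff[OF linear_dsinv])
  then have "4 * ((v - w) \<bullet> (v - w)) / (1 + z \<bullet> z)\<^sup>2 = 0" using inner_dsinv[OF assms, of z "v - w" "v - w"] by simp
  moreover have "1 + z \<bullet> z \<noteq> 0" using inner_ge_zero[of z] by linarith
  ultimately show "v = w" by simp
qed simp

lemma sph_simps [simp]:
  "carrier_top sph = top_of_set (sphere 0 1)" "atlas sph = {stereo 1, stereo (-1)}"
  "chart_at sph = sphere_chart_at" "topspace (carrier_top sph) = sphere 0 1"
  by (simp_all add: round_sphere_def)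

lemma tangent_change_stereo_refl:
  fixes y :: "(real ^ 'n::finite) \<times> real"
  assumes s: "s \<in> {1, -1}"
  shows "tangent_change (stereo s) (stereo s) y = id_blinfun"
proof -
  have "snd (stereo s) \<circ> sinv s = (\<lambda>z :: real ^ 'n. z)" by (simp add: fun_eq_iff stereo_sinv(2)[OF s])
  then show ?thesis
    by (simp add: tangent_change_eq_fd chart_inv_stereo[OF s]) (rule fd_eqI, simp add: id_blinfun.rep_eq)
qed

text \<open>The transition between the two projections is inversion in the unit sphere; in
  particular it fixes the coordinates of the equator.\<close>

lemma stereo_neg_sinv:
  assumes "z \<noteq> 0"
  shows "snd (stereo (-1)) (sinv 1 z) = z /\<^sub>R (z \<bullet> z)" "sinv 1 z \<in> fst (stereo (-1))"
proof -
  have p: "1 + z \<bullet> z > 0" "z \<bullet> z > 0" using assms by (simp_all add: add_pos_nonneg)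
  have "1 + (z \<bullet> z - 1) / (1 + z \<bullet> z) = 2 * (z \<bullet> z) / (1 + z \<bullet> z)"
    using p(1) by (simp only: divide_simps) simp
  then have "snd (stereo (-1)) (sinv 1 z) = ((2 / (1 + z \<bullet> z)) *\<^sub>R z) /\<^sub>R (2 * (z \<bullet> z) / (1 + z \<bullet> z))"
    by (simp only: stereo_def sinv_alt snd_conv prod.case mult_1 minus_mult_left[symmetric] diff_minus_eq_add)
  also have "\<dots> = (inverse (2 * (z \<bullet> z) / (1 + z \<bullet> z)) * (2 / (1 + z \<bullet> z))) *\<^sub>R z"
    by (simp only: scaleR_scaleR)
  also have "inverse (2 * (z \<bullet> z) / (1 + z \<bullet> z)) * (2 / (1 + z \<bullet> z)) = inverse (z \<bullet> z)"
  proof -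
    have "inverse (2 * q / (1 + q)) * (2 / (1 + q)) = inverse q" if "q > 0" for q :: real
      using that by (simp add: divide_simps)
    then show ?thesis using p(2) by blast
  qed
  finally show "snd (stereo (-1)) (sinv 1 z) = z /\<^sub>R (z \<bullet> z)" .
  have "sinv 1 z \<in> sphere 0 1" using stereo_sinv(1)[of 1 z] by (simp add: stereo_def)
  moreover have "fst (sinv 1 z) \<noteq> 0"
  proof -
    have "2 / (1 + z \<bullet> z) \<noteq> 0" using p(1) by (metis divide_eq_0_iff less_irrefl zero_neq_numeral)
    then show ?thesis using assms unfolding sinv_alt fst_conv scaleR_eq_0_iff by blast
  qed
  ultimately show "sinv 1 z \<in> fst (stereo (-1))" by (auto simp: stereo_def)
qed

lemma has_derivative_stereo_transition:
  assumes "z \<noteq> 0"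
  shows "((snd (stereo (-1)) \<circ> sinv 1) has_derivative
     blinfun_apply (tangent_change (stereo 1) (stereo (-1)) (sinv 1 z))) (at z)"
proof -
  have "z \<bullet> z \<noteq> 0" using assms by simp
  from has_derivative_scaleR[OF Deriv.has_derivative_inverse[OF this has_derivative_inner[OF has_derivative_ident has_derivative_ident]]
        has_derivative_ident]
  obtain D where "((\<lambda>z. z /\<^sub>R (z \<bullet> z)) has_derivative D) (at z)" by blast
  then have D: "((snd (stereo (-1)) \<circ> sinv 1) has_derivative D) (at z)"
    by (rule has_derivative_transform_within_open[of _ _ _ _ "- {0}"]) (simp_all add: assms stereo_neg_sinv open_Compl)
  then have "(snd (stereo (-1)) \<circ> sinv 1) differentiable (at z)" by (rule differentiableI)
  moreover have "tangent_change (stereo 1) (stereo (-1)) (sinv 1 z) = fd (snd (stereo (-1)) \<circ> sinv 1) z"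
    using stereo_sinv(2)[of 1 z] by (simp add: tangent_change_eq_fd chart_inv_stereo)
  ultimately show ?thesis by (simp add: fd_apply frechet_derivative_works[symmetric])
qed

text \<open>Chain rule for \<open>sinv (-1)\<close> after the transition, which is
  \<open>sinv 1\<close> away from 0. Hence the induced metric may be computed in either
  chart.\<close>

lemma dsinv_transition:
  assumes "z \<noteq> 0"
  shows "dsinv (-1) (snd (stereo (-1)) (sinv 1 z)) (tangent_change (stereo 1) (stereo (-1)) (sinv 1 z) v) = dsinv 1 z v"
proof -
  have "(sinv (-1) \<circ> (snd (stereo (-1)) \<circ> sinv 1) has_derivative
     dsinv (-1) (snd (stereo (-1)) (sinv 1 z)) \<circ> blinfun_apply (tangent_change (stereo 1) (stereo (-1)) (sinv 1 z))) (at z)"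
    by (rule diff_chain_at[OF has_derivative_stereo_transition[OF assms]]) (simp add: has_derivative_sinv)
  then have "(sinv 1 has_derivative
     dsinv (-1) (snd (stereo (-1)) (sinv 1 z)) \<circ> blinfun_apply (tangent_change (stereo 1) (stereo (-1)) (sinv 1 z))) (at z)"
    by (rule has_derivative_transform_within_open[of _ _ _ _ "- {0}"])
      (simp_all add: assms stereo_neg_sinv(2) sinv_stereo open_Compl)
  from has_derivative_unique[OF this has_derivative_sinv] show ?thesis by (simp add: fun_eq_iff)
qed

lemma metric_sph:
  assumes "sphere_chart_at y = stereo s" "s \<in> {1, -1}"
  shows "metric sph y v w = dsinv s (snd (stereo s) y) v \<bullet> dsinv s (snd (stereo s) y) w"
  using assms by (simp add: round_sphere_def Let_def chart_inv_stereo frechet_derivative_at[OF has_derivative_sinv, symmetric])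

lemma metric_in_sph:
  "metric_in sph (stereo 1) z v w = 4 * (v \<bullet> w) / (1 + z \<bullet> z)\<^sup>2"
proof (cases "snd (sinv 1 z) \<le> 0")
  case True
  then have c: "sphere_chart_at (sinv 1 z) = stereo 1" by (simp add: sphere_chart_at_def)
  then show ?thesis
    by (simp add: metric_in_def Let_def chart_inv_stereo tangent_change_stereo_refl metric_sph[OF c]
       stereo_sinv(2) inner_dsinv)
next
  case False
  then have c: "sphere_chart_at (sinv 1 z) = stereo (-1)" by (simp add: sphere_chart_at_def)
  \<comment> \<open>The origin of the first chart is the south pole, whose height -1 would select
    the other distinguished chart.\<close>
  have "z \<noteq> 0" using False by (auto simp: sinv_alt)
  then show ?thesis
    by (simp add: metric_in_def Let_def chart_inv_stereo c metric_sph[OF c] dsinv_transition inner_dsinv)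
qed

text \<open>On the unit sphere of coordinate space the factor 4 / (1 + |z|^2)^2 equals 1 and has
  derivative \<open>- 2 * (b \<bullet> u)\<close> in direction u. The Koszul formula then becomes an
  equation between ordinary inner products.\<close>

lemma christoffel_sph:
  assumes b: "b \<bullet> b = 1"
  shows "christoffel sph (stereo 1) b v w = (v \<bullet> w) *\<^sub>R b - (b \<bullet> v) *\<^sub>R w - (b \<bullet> w) *\<^sub>R v"
proof -
  have d: "frechet_derivative (\<lambda>z. metric_in sph (stereo 1) z v w) (at b) u = - 2 * (b \<bullet> u) * (v \<bullet> w)" for u v w
  proof -
    have "((\<lambda>z. 4 * (v \<bullet> w) / (1 + z \<bullet> z)\<^sup>2) has_derivative (\<lambda>u. - 2 * (b \<bullet> u) * (v \<bullet> w))) (at b)"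
      using b by (auto intro!: derivative_eq_intros simp: inner_commute)
    from frechet_derivative_at[OF this] show ?thesis by (simp add: metric_in_sph fun_eq_iff)
  qed
  define r where "r = (v \<bullet> w) *\<^sub>R b - (b \<bullet> v) *\<^sub>R w - (b \<bullet> w) *\<^sub>R v"
  have m: "metric_in sph (stereo 1) b x q = x \<bullet> q" for x q by (simp add: metric_in_sph b)
  have rhs: "(- 2 * (b \<bullet> v) * (w \<bullet> q) + - 2 * (b \<bullet> w) * (v \<bullet> q) - - 2 * (b \<bullet> q) * (v \<bullet> w)) / 2 = r \<bullet> q" for q
    by (simp add: r_def inner_diff_left inner_add_left field_simps)
  show ?thesis
    unfolding christoffel_def d m rhs r_def[symmetric]
  proof (rule the_equality)
    show "r' = r" if "\<forall>q. r' \<bullet> q = r \<bullet> q" for r' using that by (simp add: vector_eq_rdot)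
  qed simp
qed

section \<open>Great circles and their horizontal lifts\<close>

definition rank_one :: "'b::real_normed_vector \<Rightarrow> ('a::real_normed_vector \<Rightarrow>\<^sub>L real) \<Rightarrow> 'a \<Rightarrow>\<^sub>L 'b" where
  "rank_one v \<alpha> = blinfun_scaleR_left v o\<^sub>L \<alpha>"

lemma rank_one_apply [simp]: "rank_one v \<alpha> w = \<alpha> w *\<^sub>R v"
  by (simp add: rank_one_def)

lemma bounded_bilinear_rank_one:
  "bounded_bilinear (rank_one :: 'b::real_normed_vector \<Rightarrow> ('a::real_normed_vector \<Rightarrow>\<^sub>L real) \<Rightarrow> 'a \<Rightarrow>\<^sub>L 'b)"
  unfolding rank_one_def[abs_def]
  by (rule bounded_bilinear.comp1[OF bounded_bilinear_blinfun_compose bounded_linear_blinfun_scaleR_left])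

locale great_circle =
  fixes e1 e2 :: "real ^ 'n::finite"
  assumes e: "e1 \<bullet> e1 = 1" "e2 \<bullet> e2 = 1" "e1 \<bullet> e2 = 0"
begin

definition gc :: "real \<Rightarrow> real ^ 'n" where "gc t = cos t *\<^sub>R e1 + sin t *\<^sub>R e2"

definition dgc :: "real \<Rightarrow> real ^ 'n" where "dgc t = cos t *\<^sub>R e2 - sin t *\<^sub>R e1"

text \<open>At height 0 both stereographic projections are (w, h) |-> w, so \<open>gc\<close> is the
  coordinate expression of this curve in either chart.\<close>

definition geo :: "real \<Rightarrow> (real ^ 'n) \<times> real" where "geo t = (gc t, 0)"

lemma gc_inner: "gc t \<bullet> gc t = 1" "dgc t \<bullet> dgc t = 1" "gc t \<bullet> dgc t = 0" "dgc t \<bullet> gc t = 0"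
proof -
  note [simp] = e inner_commute[of e2 e1] inner_add_left inner_add_right inner_diff_left inner_diff_right
  have *: "cos t * cos t + sin t * sin t = 1" using sin_cos_squared_add2[of t] by (simp add: power2_eq_square)
  then show "gc t \<bullet> gc t = 1" by (simp add: gc_def)
  show "dgc t \<bullet> dgc t = 1" using * by (simp add: dgc_def)
  show "gc t \<bullet> dgc t = 0" by (simp add: gc_def dgc_def mult.commute)
  then show "dgc t \<bullet> gc t = 0" by (metis inner_commute)
qed

lemma gc_derivative: "(gc has_vector_derivative dgc t) (at t)"
  and dgc_derivative: "(dgc has_vector_derivative - gc t) (at t)"
  unfolding gc_def[abs_def] dgc_def[abs_def]
  by (auto intro!: derivative_eq_intros simp: algebra_simps)

lemma continuous_on_gc [continuous_intros]: "continuous_on S gc" "continuous_on S dgc"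
  unfolding gc_def[abs_def] dgc_def[abs_def] by (auto intro!: continuous_intros)

lemma gc_nonzero: "gc t \<noteq> 0" using gc_inner(1)[of t] by auto

lemma sinv_gc: "sinv 1 (gc t) = geo t"
  by (simp add: sinv_alt geo_def gc_inner)

lemma geo_sphere: "geo t \<in> sphere 0 1"
  by (simp add: geo_def sphere_iff gc_inner del: mem_sphere_0 mem_sphere)

lemma geo_in_stereo: "s \<in> {1, -1} \<Longrightarrow> geo t \<in> fst (stereo s)"
  using geo_sphere[of t] gc_nonzero[of t] by (auto simp: stereo_def geo_def)

lemma stereo_geo: "snd (stereo s) (geo t) = gc t"
  by (simp add: stereo_def geo_def)

lemma sphere_chart_at_geo: "sphere_chart_at (geo t) = stereo 1"
  by (simp add: sphere_chart_at_def geo_def)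

text \<open>The transition map fixes every point of the coordinate curve \<open>gc\<close>, so its
  derivative fixes the velocity.\<close>

lemma tangent_change_dgc:
  assumes "s \<in> {1, -1}"
  shows "tangent_change (stereo 1) (stereo s) (geo t) (dgc t) = dgc t"
proof (cases "s = 1")
  case True
  then show ?thesis by (simp add: tangent_change_stereo_refl)
next
  case False
  then have s: "s = -1" using assms by auto
  have "((snd (stereo (-1)) \<circ> sinv 1) \<circ> gc has_derivative
     blinfun_apply (tangent_change (stereo 1) (stereo (-1)) (sinv 1 (gc t))) \<circ> (\<lambda>h. h *\<^sub>R dgc t)) (at t)"
    using gc_derivative[of t] unfolding has_vector_derivative_def
    by (rule diff_chain_at[of gc _ t, OF _ has_derivative_stereo_transition[OF gc_nonzero[of t]]])
  moreover have "(snd (stereo (-1)) \<circ> sinv 1) \<circ> gc = gc"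
    by (auto simp: sinv_gc stereo_geo)
  ultimately have "(gc has_vector_derivative tangent_change (stereo 1) (stereo s) (geo t) (dgc t)) (at t)"
    by (simp add: has_vector_derivative_def o_def blinfun.scaleR_right sinv_gc s)
  then show ?thesis using gc_derivative vector_derivative_unique_at by blast
qed

lemma metric_sph_geo: "metric sph (geo t) v w = v \<bullet> w"
  using metric_sph[OF sphere_chart_at_geo, of t v w] by (simp add: stereo_geo inner_dsinv gc_inner)

end

lemma bilinear_inner: "bilinear ((\<bullet>) :: 'a::euclidean_space \<Rightarrow> 'a \<Rightarrow> real)"
  using bilinear_conv_bounded_bilinear bounded_bilinear_inner by blast

context riemannian
begin

text \<open>The curves below do not move in M, so the connection of M enters only with direction 0.
  Each term of the Koszul formula then vanishes, and nondegeneracy of the metric gives the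
  result.\<close>

lemma christoffel_zero:
  assumes x: "x \<in> points M"
  shows "christoffel M (chart_at M x) (snd (chart_at M x) x) 0 w = 0"
proof -
  let ?c = "chart_at M x" and ?a = "snd (chart_at M x) x"
  have c: "?c \<in> atlas M" and xc: "x \<in> fst ?c" using chart_at[OF x] by auto
  have a: "?a \<in> chart_img ?c" using chart_in_img[OF xc] .
  have g: "inner_product (metric_in M ?c ?a)" using inner_product_metric[OF x] by (simp add: metric_in_chart_at[OF x])
  interpret b: bounded_bilinear "metric_in M ?c ?a"
    using g bilinear_conv_bounded_bilinear unfolding inner_product_def by blast
  have 1: "frechet_derivative (\<lambda>z. metric_in M ?c z w q) (at ?a) 0 = 0" for q
  proof -
    have "(\<lambda>z. metric_in M ?c z w q) differentiable (at ?a)"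
      using C1_on_imp_has_derivative[OF C1_metric_in[OF c] a] differentiableI by blast
    then show ?thesis by (simp add: linear_0 linear_frechet_derivative)
  qed
  have 2: "frechet_derivative (\<lambda>z. metric_in M ?c z 0 q) (at ?a) v = 0" for q v
  proof -
    have "((\<lambda>z. 0) has_derivative (\<lambda>_. 0)) (at ?a)" by simp
    then have "((\<lambda>z. metric_in M ?c z 0 q) has_derivative (\<lambda>_. 0)) (at ?a)"
    proof (rule has_derivative_transform_within_open[OF _ open_chart_img[OF c] a])
      fix z assume "z \<in> chart_img ?c"
      then show "0 = metric_in M ?c z 0 q"
        using bilinear_metric_in[OF c] bilinear_lzero by metis
    qed
    from frechet_derivative_at[OF this] show ?thesis by metis
  qed
  have "(\<forall>q. metric_in M ?c ?a r q = 0) \<longleftrightarrow> r = 0" for r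
    using g b.zero_left unfolding inner_product_def by (metis less_irrefl)
  then show ?thesis unfolding christoffel_def 1 2 by simp
qed

end

locale riemannian_circle = riemannian M + great_circle e1 e2
  for M :: "('p, 'm::finite) rmfd" and e1 e2 :: "real ^ 'n::finite"
begin

text \<open>With \<open>\<theta>\<close> and \<open>\<alpha>\<close> the value and the differential
  at x of a phase function, and a and \<open>\<beta>\<close> those of its increment, this joins the
  derivatives at x of the two maps obtained by composing \<open>geo\<close> with the phase before
  and after the increment.\<close>

definition lift_curve :: "'p \<Rightarrow> real \<Rightarrow> real \<Rightarrow> ((real ^ 'm) \<Rightarrow>\<^sub>L real) \<Rightarrow> ((real ^ 'm) \<Rightarrow>\<^sub>L real) \<Rightarrow> real \<Rightarrow>
    'p \<times> ((real ^ 'n) \<times> real) \<times> ((real ^ 'm) \<Rightarrow>\<^sub>L (real ^ 'n))" where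
  "lift_curve x \<theta> a \<alpha> \<beta> s = (x, geo (\<theta> + s * a), rank_one (dgc (\<theta> + s * a)) (\<alpha> + s *\<^sub>R \<beta>))"

lemma hom_in_geo:
  assumes x: "x \<in> points M"
  shows "hom_in M sph (chart_at M x) (stereo 1) x (geo t) L = L"
  unfolding hom_in_def sph_simps sphere_chart_at_geo
  using chart_at[OF x] by (intro blinfun_eqI) (simp add: tangent_change_stereo_refl tangent_change_refl)

lemma hom_coord_lift_curve:
  assumes x: "x \<in> points M"
  shows "hom_coord M sph (chart_at M x) (stereo 1) (lift_curve x \<theta> a \<alpha> \<beta> s) =
    (snd (chart_at M x) x, gc (\<theta> + s * a), rank_one (dgc (\<theta> + s * a)) (\<alpha> + s *\<^sub>R \<beta>))"
  by (simp add: hom_coord_def lift_curve_def hom_in_geo[OF x] stereo_geo)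

definition lift_velocity where
  "lift_velocity \<theta> a \<alpha> \<beta> s = (0 :: real ^ 'm, a *\<^sub>R dgc (\<theta> + s * a),
     rank_one (- a *\<^sub>R gc (\<theta> + s * a)) (\<alpha> + s *\<^sub>R \<beta>) + rank_one (dgc (\<theta> + s * a)) \<beta>)"

lemma lift_curve_derivative:
  assumes x: "x \<in> points M"
  shows "((\<lambda>s. hom_coord M sph (chart_at M x) (stereo 1) (lift_curve x \<theta> a \<alpha> \<beta> s))
     has_vector_derivative lift_velocity \<theta> a \<alpha> \<beta> s) (at s)"
proof -
  have 0: "((\<lambda>s. \<theta> + s * a) has_vector_derivative a) (at s)"
    by (auto intro!: derivative_eq_intros)
  have 1: "((\<lambda>s. gc (\<theta> + s * a)) has_vector_derivative a *\<^sub>R dgc (\<theta> + s * a)) (at s)"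
    using vector_diff_chain_at[OF 0 gc_derivative] by (simp add: o_def)
  have 2: "((\<lambda>s. dgc (\<theta> + s * a)) has_vector_derivative - a *\<^sub>R gc (\<theta> + s * a)) (at s)"
    using vector_diff_chain_at[OF 0 dgc_derivative] by (simp add: o_def)
  have 3: "((\<lambda>s. \<alpha> + s *\<^sub>R \<beta>) has_vector_derivative \<beta>) (at s)"
    by (auto intro!: derivative_eq_intros)
  have 4: "((\<lambda>s. rank_one (dgc (\<theta> + s * a)) (\<alpha> + s *\<^sub>R \<beta>)) has_vector_derivative
     rank_one (dgc (\<theta> + s * a)) \<beta> + rank_one (- a *\<^sub>R gc (\<theta> + s * a)) (\<alpha> + s *\<^sub>R \<beta>)) (at s)"
    by (rule bounded_bilinear.has_vector_derivative[OF bounded_bilinear_rank_one 2 3])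
  show ?thesis
    unfolding hom_coord_lift_curve[OF x] lift_velocity_def
    by (intro has_vector_derivative_Pair has_vector_derivative_const 1)
      (use 4 in \<open>simp add: add.commute\<close>)
qed

lemma continuous_on_lift_velocity: "continuous_on S (lift_velocity \<theta> a \<alpha> \<beta>)"
  unfolding lift_velocity_def[abs_def]
  by (intro continuous_intros bounded_bilinear.continuous_on[OF bounded_bilinear_rank_one]
      continuous_on_compose2[OF continuous_on_gc(1)[of UNIV]] continuous_on_compose2[OF continuous_on_gc(2)[of UNIV]]) auto

lemma piecewise_C1_lift_curve:
  assumes x: "x \<in> points M"
  shows "piecewise_C1_curve M sph (lift_curve x \<theta> a \<alpha> \<beta>)"
proof -
  let ?f = "\<lambda>s. hom_coord M sph (chart_at M x) (stereo 1) (lift_curve x \<theta> a \<alpha> \<beta> s)"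
  have "?f C1_differentiable_on S" for S
    unfolding C1_differentiable_on_def
    using lift_curve_derivative[OF x] continuous_on_lift_velocity by blast
  then have "?f piecewise_C1_differentiable_on S" for S
    by (rule C1_differentiable_imp_piecewise)
  then show ?thesis
    unfolding piecewise_C1_curve_def
    using x geo_sphere chart_at[OF x] geo_in_stereo[of 1]
    by (auto simp: lift_curve_def[of _ _ _ _ _ _] sphere_chart_at_geo Let_def intro!: exI[of _ 1])
qed

lemma sasaki_speed_lift_curve:
  assumes x: "x \<in> points M"
  shows "sasaki_speed M sph (lift_curve x \<theta> a \<alpha> \<beta>) s = sqrt (a\<^sup>2 + (conorm (metric M x) \<beta>)\<^sup>2)"
proof -
  let ?c = "chart_at M x" and ?t = "\<theta> + s * a"
  have m: "metric_in sph (stereo 1) (gc ?t) = (\<bullet>)"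
    by (intro ext) (simp add: metric_in_sph gc_inner)
  have g: "inner_product (metric_in M ?c (snd ?c x))" using inner_product_metric[OF x] by (simp add: metric_in_chart_at[OF x])
  have z: "metric_in M ?c (snd ?c x) 0 0 = 0"
    using g bilinear_lzero unfolding inner_product_def by blast
  \<comment> \<open>The derivative of \<open>dgc\<close> contributes a multiple of -
    \<open>gc\<close>, and the Christoffel term of two multiples of \<open>dgc\<close> contributes
    the opposite multiple: this is the geodesic equation. Only the change \<open>\<beta>\<close> of
    the covector survives, so \<open>\<alpha>\<close> drops out of the speed.\<close>
  have "connection_map M sph ?c (stereo 1) (snd ?c x, gc ?t, rank_one (dgc ?t) (\<alpha> + s *\<^sub>R \<beta>))
      (lift_velocity \<theta> a \<alpha> \<beta> s) w = \<beta> w *\<^sub>R dgc ?t" for w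
    by (simp add: connection_map_def lift_velocity_def christoffel_zero[OF x] christoffel_sph gc_inner
        blinfun.bilinear_simps algebra_simps)
  then have h: "hs_norm (metric_in M ?c (snd ?c x)) (\<bullet>)
      (connection_map M sph ?c (stereo 1) (snd ?c x, gc ?t, rank_one (dgc ?t) (\<alpha> + s *\<^sub>R \<beta>))
      (lift_velocity \<theta> a \<alpha> \<beta> s)) = conorm (metric M x) \<beta>"
    using hs_norm_rank_one[OF bilinear_inner, of _ \<beta> "dgc ?t"] by (simp add: gc_inner metric_in_chart_at[OF x])
  have f: "fst (lift_curve x \<theta> a \<alpha> \<beta> s) = x" "fst (snd (lift_curve x \<theta> a \<alpha> \<beta> s)) = geo ?t"
    by (simp_all add: lift_curve_def)
  have "sasaki_form M sph ?c (stereo 1) (hom_coord M sph ?c (stereo 1) (lift_curve x \<theta> a \<alpha> \<beta> s))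
      (lift_velocity \<theta> a \<alpha> \<beta> s) = a\<^sup>2 + (conorm (metric M x) \<beta>)\<^sup>2"
    using h unfolding sasaki_form_def hom_coord_lift_curve[OF x] lift_velocity_def
    by (simp add: m z gc_inner power2_eq_square)
  then show ?thesis
    unfolding sasaki_speed_def f sph_simps sphere_chart_at_geo Let_def
      vector_derivative_at[OF lift_curve_derivative[OF x]] by simp
qed

lemma sasaki_dist_le:
  assumes x: "x \<in> points M"
  shows "sasaki_dist M sph (x, geo \<theta>, rank_one (dgc \<theta>) \<alpha>) (x, geo (\<theta> + a), rank_one (dgc (\<theta> + a)) (\<alpha> + \<beta>))
    \<le> ennreal (sqrt (a\<^sup>2 + (conorm (metric M x) \<beta>)\<^sup>2))"
proof -
  have "sasaki_length M sph (lift_curve x \<theta> a \<alpha> \<beta>) = ennreal (sqrt (a\<^sup>2 + (conorm (metric M x) \<beta>)\<^sup>2))"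
    unfolding sasaki_length_def sasaki_speed_lift_curve[OF x] by (simp add: nn_integral_cmult)
  moreover have "lift_curve x \<theta> a \<alpha> \<beta> 0 = (x, geo \<theta>, rank_one (dgc \<theta>) \<alpha>)"
    "lift_curve x \<theta> a \<alpha> \<beta> 1 = (x, geo (\<theta> + a), rank_one (dgc (\<theta> + a)) (\<alpha> + \<beta>))"
    by (simp_all add: lift_curve_def)
  ultimately show ?thesis unfolding sasaki_dist_def
    using piecewise_C1_lift_curve[OF x, of \<theta> a \<alpha> \<beta>]
    by (intro INF_lower2[of "lift_curve x \<theta> a \<alpha> \<beta>"]) auto
qed

end

section \<open>Maps into a great circle\<close>

context riemannian
begin

lemma has_weak_derivative_cong:
  fixes f :: "'p \<Rightarrow> 'b::euclidean_space"
  assumes F: "has_weak_derivative M f F" and eq: "\<And>x. x \<in> points M \<Longrightarrow> F x = F' x"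
  shows "has_weak_derivative M f F'"
proof -
  define G where "G = (\<lambda>F :: 'p \<Rightarrow> (real ^ 'm) \<Rightarrow>\<^sub>L 'b. \<lambda>c z. let x = chart_inv c z in F x o\<^sub>L tangent_change c (chart_at M x) x)"
  have eqG: "G F c z = G F' c z" if "c \<in> atlas M" "z \<in> chart_img c" for c z
    using eq[of "chart_inv c z"] chart_inv_in[OF that(2)] chart_domain_subset[OF that(1)]
    by (auto simp: G_def Let_def)
  have 1: "locally_integrable_on (\<lambda>z. blinfun_apply (G F' c z) v) (chart_img c)"
    if "c \<in> atlas M" "locally_integrable_on (\<lambda>z. blinfun_apply (G F c z) v) (chart_img c)" for c v
    using that(2) unfolding locally_integrable_on_def
  proof (intro allI impI)
    fix K assume *: "\<forall>K. compact K \<and> K \<subseteq> chart_img c \<longrightarrow> (\<lambda>z. blinfun_apply (G F c z) v) absolutely_integrable_on K"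
      and K: "compact K \<and> K \<subseteq> chart_img c"
    then have "(\<lambda>z. blinfun_apply (G F c z) v) absolutely_integrable_on K" by blast
    moreover have "G F' c z = G F c z" if "z \<in> K" for z
      using K eqG[OF \<open>c \<in> atlas M\<close>, of z] that by auto
    ultimately show "(\<lambda>z. blinfun_apply (G F' c z) v) absolutely_integrable_on K"
      by (subst set_integrable_cong[OF refl refl, of _ "\<lambda>z. blinfun_apply (G F' c z) v" "\<lambda>z. blinfun_apply (G F c z) v"]) simp_all
  qed
  have 2: "(LINT z:chart_img c|lebesgue. \<phi> z *\<^sub>R blinfun_apply (G F c z) v) =
     (LINT z:chart_img c|lebesgue. \<phi> z *\<^sub>R blinfun_apply (G F' c z) v)" if "c \<in> atlas M" for c v \<phi>
    unfolding set_lebesgue_integral_def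
    by (intro Bochner_Integration.integral_cong) (auto simp: eqG[OF that] indicator_def)
  have Gx: "\<And>F c. (\<lambda>z. let x = chart_inv c z in F x o\<^sub>L tangent_change c (chart_at M x) x) = G F c"
    by (simp add: G_def)
  show ?thesis
    using F 1 unfolding has_weak_derivative_def Gx Let_def[of "\<lambda>z. f (chart_inv _ z)"] Let_def[of "G _ _"]
    by (metis (no_types, lifting) 2)
qed

lemma differential_compose:
  fixes F :: "real \<Rightarrow> 'b::euclidean_space"
  assumes \<phi>: "C1_map M \<phi>" and F: "\<And>t. (F has_vector_derivative F' t) (at t)" "continuous_on UNIV F'"
  shows "C1_map M (F \<circ> \<phi>)"
    and "x \<in> points M \<Longrightarrow> differential M (F \<circ> \<phi>) x = rank_one (F' (\<phi> x)) (differential M \<phi> x)"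
proof -
  have C: "C1_on UNIV F" using F by (rule C1_on_real)
  show "C1_map M (F \<circ> \<phi>)"
    using \<phi> C1_on_compose[OF C] unfolding C1_map_def o_assoc[symmetric] by blast
  assume x: "x \<in> points M"
  let ?c = "chart_at M x"
  have c: "?c \<in> atlas M" "x \<in> fst ?c" using chart_at[OF x] by auto
  have p: "((\<phi> \<circ> chart_inv ?c) has_derivative blinfun_apply (differential M \<phi> x)) (at (snd ?c x))"
    unfolding differential_eq_fd
    by (rule C1_on_imp_has_derivative[OF _ chart_in_img[OF c(2)]]) (use \<phi> c(1) in \<open>simp add: C1_map_def\<close>)
  have "(F \<circ> (\<phi> \<circ> chart_inv ?c) has_derivative (\<lambda>h. h *\<^sub>R F' (\<phi> x)) \<circ> blinfun_apply (differential M \<phi> x)) (at (snd ?c x))"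
    by (rule diff_chain_at[OF p]) (use F(1)[of "\<phi> x"] in \<open>simp add: has_vector_derivative_def chart_inv_chart c\<close>)
  then have "((F \<circ> \<phi>) \<circ> chart_inv ?c has_derivative blinfun_apply (rank_one (F' (\<phi> x)) (differential M \<phi> x))) (at (snd ?c x))"
    by (rule has_derivative_eq_rhs[OF back_subst[of "\<lambda>g. (g has_derivative _) _", OF _ o_assoc]]) (simp add: fun_eq_iff)
  from fd_eqI[OF this] show "differential M (F \<circ> \<phi>) x = rank_one (F' (\<phi> x)) (differential M \<phi> x)"
    by (simp add: differential_eq_fd)
qed

lemma openin_C1_map_preimage:
  assumes f: "C1_map M f" and V: "open V"
  shows "openin (carrier_top M) {x \<in> points M. f x \<in> V}"
proof -
  have "openin (carrier_top M) {x \<in> fst c. f x \<in> V}" if c: "c \<in> atlas M" for c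
  proof -
    have "continuous_on (chart_img c) (f \<circ> chart_inv c)"
      using f c C1_on_imp_continuous_on unfolding C1_map_def by blast
    then have "open ((f \<circ> chart_inv c) -` V \<inter> chart_img c)"
      using V unfolding continuous_on_open_vimage[OF open_chart_img[OF c]] by blast
    from openin_chart_preimage[OF c this]
    show ?thesis by (rule back_subst[of "openin (carrier_top M)"]) (auto simp: chart_inv_chart[OF c] chart_in_img)
  qed
  then have "openin (carrier_top M) (\<Union>c\<in>atlas M. {x \<in> fst c. f x \<in> V})" by blast
  moreover have "(\<Union>c\<in>atlas M. {x \<in> fst c. f x \<in> V}) = {x \<in> points M. f x \<in> V}"
    using chart_at chart_domain_subset by blast
  ultimately show ?thesis by simp
qed

end

context great_circle
begin

lemma compose_geo_derivative:
  fixes f :: "(real ^ 'n) \<times> real \<Rightarrow> 'b::real_normed_vector"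
  assumes "C1_map sph f"
  shows "((f \<circ> geo) has_vector_derivative differential sph f (geo t) (dgc t)) (at t)"
    and "continuous_on UNIV (\<lambda>t. differential sph f (geo t) (dgc t))"
proof -
  have C: "C1_on UNIV (f \<circ> sinv 1)"
    using assms by (simp add: C1_map_def chart_img_stereo chart_inv_stereo)
  have d: "differential sph f (geo t) = fd (f \<circ> sinv 1) (gc t)" for t
    by (simp add: differential_eq_fd sphere_chart_at_geo chart_inv_stereo stereo_geo)
  have "(f \<circ> sinv 1) \<circ> gc = f \<circ> geo" by (auto simp: sinv_gc)
  moreover have "((f \<circ> sinv 1) \<circ> gc has_derivative blinfun_apply (fd (f \<circ> sinv 1) (gc t)) \<circ> (\<lambda>h. h *\<^sub>R dgc t)) (at t)"
    using gc_derivative[of t] unfolding has_vector_derivative_def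
    by (rule diff_chain_at[of gc _ t, OF _ C1_on_imp_has_derivative[OF C UNIV_I]])
  ultimately show "((f \<circ> geo) has_vector_derivative differential sph f (geo t) (dgc t)) (at t)"
    by (simp add: d has_vector_derivative_def o_def blinfun.scaleR_right)
  show "continuous_on UNIV (\<lambda>t. differential sph f (geo t) (dgc t))"
    unfolding d by (intro continuous_intros continuous_on_compose2[OF C1_on_imp_continuous_fd[OF C]]) auto
qed

text \<open>As the sphere is compact, ambient coordinates are admissible test functions. Their
  differentials together separate tangent vectors, which identifies colocal weak
  derivatives.\<close>

lemma coordinate_function:
  fixes b :: "(real ^ 'n) \<times> real"
  shows "(\<lambda>y. y \<bullet> b) \<in> C1_compact_support sph"
    and "differential sph (\<lambda>y. y \<bullet> b) (geo t) v = dsinv 1 (gc t) v \<bullet> b"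
proof -
  have C: "C1_on S ((\<lambda>y. y \<bullet> b) \<circ> sinv s)" for s S
    using C1_on_compose[OF C1_on_inner_left(1)[of UNIV b] C1_on_sinv] by simp
  have "compactin (top_of_set (sphere 0 1)) (sphere (0 :: (real ^ 'n) \<times> real) 1)"
    by (simp add: compactin_subtopology)
  then show "(\<lambda>y. y \<bullet> b) \<in> C1_compact_support sph"
    unfolding C1_compact_support_def C1_map_def using C
    by (auto simp: chart_inv_stereo intro!: exI[of _ "sphere 0 1"])
  have "((\<lambda>y. y \<bullet> b) \<circ> sinv 1 has_derivative (\<lambda>y. y \<bullet> b) \<circ> dsinv 1 (gc t)) (at (gc t))"
    by (rule diff_chain_at[OF has_derivative_sinv]) (auto intro!: derivative_eq_intros)
  moreover have "((\<lambda>y. y \<bullet> b) \<circ> sinv 1 has_derivative blinfun_apply (fd ((\<lambda>y. y \<bullet> b) \<circ> sinv 1) (gc t))) (at (gc t))"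
    by (rule C1_on_imp_has_derivative[OF C[of UNIV] UNIV_I])
  ultimately have "blinfun_apply (fd ((\<lambda>y. y \<bullet> b) \<circ> sinv 1) (gc t)) = (\<lambda>y. y \<bullet> b) \<circ> dsinv 1 (gc t)"
    using has_derivative_unique by blast
  then show "differential sph (\<lambda>y. y \<bullet> b) (geo t) v = dsinv 1 (gc t) v \<bullet> b"
    by (simp add: differential_eq_fd sphere_chart_at_geo chart_inv_stereo stereo_geo)
qed

end

context riemannian_circle
begin

section \<open>Colocal weak derivatives and Sobolev membership of maps into the circle\<close>

definition geo_derivative :: "('p \<Rightarrow> real) \<Rightarrow> 'p \<Rightarrow> (real ^ 'm) \<Rightarrow>\<^sub>L (real ^ 'n)" where
  "geo_derivative \<phi> x = rank_one (dgc (\<phi> x)) (differential M \<phi> x)"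

context
  fixes \<phi> :: "'p \<Rightarrow> real"
  assumes \<phi>: "C1_map M \<phi>"
begin

lemma weak_derivative_compose_geo:
  fixes f :: "(real ^ 'n) \<times> real \<Rightarrow> 'b::euclidean_space"
  assumes f: "C1_map sph f"
  shows "has_weak_derivative M (f \<circ> (geo \<circ> \<phi>))
     (\<lambda>x. rank_one (differential sph f (geo (\<phi> x)) (dgc (\<phi> x))) (differential M \<phi> x))"
  unfolding o_assoc
  by (rule has_weak_derivative_cong[OF C1_map_has_weak_derivative])
    (simp_all only: differential_compose[OF \<phi> compose_geo_derivative[OF f]])

lemma measurable_geo: "measurable_map M sph (geo \<circ> \<phi>)"
proof -
  have "C1_map M (geo \<circ> \<phi>)"
  proof (rule differential_compose(1)[OF \<phi>])
    show "(geo has_vector_derivative (dgc t, 0)) (at t)" for t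
      unfolding geo_def[abs_def] by (intro has_vector_derivative_Pair gc_derivative has_vector_derivative_const)
    show "continuous_on UNIV (\<lambda>t. (dgc t, 0 :: real))" by (intro continuous_intros)
  qed
  then have "{x \<in> points M. (geo \<circ> \<phi>) x \<in> V} \<in> lebesgue_sets M" if V: "openin (top_of_set (sphere 0 1)) V" for V
  proof -
    obtain T where T: "open T" "V = sphere 0 1 \<inter> T" using V by (auto simp: openin_open)
    have "{x \<in> points M. (geo \<circ> \<phi>) x \<in> V} = {x \<in> points M. (geo \<circ> \<phi>) x \<in> T}"
      using geo_sphere T(2) by auto
    then show ?thesis using openin_lebesgue_sets[OF openin_C1_map_preimage[OF \<open>C1_map M (geo \<circ> \<phi>)\<close> T(1)]] by simp
  qed
  moreover have "geo \<circ> \<phi> \<in> points M \<rightarrow> sphere 0 1" using geo_sphere by auto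
  ultimately show ?thesis unfolding measurable_map_def by simp
qed

text \<open>By \<open>tangent_change_dgc\<close> the velocity has the same components in both charts
  of the sphere. In every pair of charts the morphism is therefore a continuous expression, and the
  sets in question are even open.\<close>

lemma measurable_geo_derivative: "measurable_morphism M sph (geo \<circ> \<phi>) (geo_derivative \<phi>)"
proof -
  have "{x \<in> fst c. (geo \<circ> \<phi>) x \<in> fst (stereo s) \<and> hom_in M sph c (stereo s) x ((geo \<circ> \<phi>) x) (geo_derivative \<phi> x) \<in> V} \<in> lebesgue_sets M"
    if c: "c \<in> atlas M" and s: "s \<in> {1, -1}" and V: "open V" for c s V
  proof -
    have C: "C1_on (chart_img c) (\<phi> \<circ> chart_inv c)" using \<phi> c by (simp add: C1_map_def)
    define H where "H = (\<lambda>z. rank_one (dgc ((\<phi> \<circ> chart_inv c) z)) (fd (\<phi> \<circ> chart_inv c) z))"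
    have H: "hom_in M sph c (stereo s) x (geo (\<phi> x)) (geo_derivative \<phi> x) = H (snd c x)" if x: "x \<in> fst c" for x
      unfolding hom_in_def H_def geo_derivative_def fd_chart[OF \<phi> c x] sph_simps sphere_chart_at_geo
      by (intro blinfun_eqI) (simp add: blinfun.scaleR_right tangent_change_dgc[OF s] chart_inv_chart[OF c x])
    have "continuous_on (chart_img c) H"
      unfolding H_def
      by (intro bounded_bilinear.continuous_on[OF bounded_bilinear_rank_one] C1_on_imp_continuous_fd[OF C]
         continuous_on_compose2[OF continuous_on_gc(2)[of UNIV] C1_on_imp_continuous_on[OF C]]) auto
    then have "open (H -` V \<inter> chart_img c)"
      using open_chart_img[OF c] V by (simp add: continuous_on_open_vimage)
    from openin_lebesgue_sets[OF openin_chart_preimage[OF c this]]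
    show ?thesis by (rule back_subst[of "\<lambda>S. S \<in> lebesgue_sets M"]) (auto simp: H chart_in_img geo_in_stereo[OF s])
  qed
  then show ?thesis unfolding measurable_morphism_def using measurable_geo by auto
qed

lemma has_colocal_weak_derivative_geo:
  "has_colocal_weak_derivative M sph (geo \<circ> \<phi>) (geo_derivative \<phi>)"
  unfolding has_colocal_weak_derivative_def
proof (intro conjI ballI measurable_geo_derivative)
  fix f :: "(real ^ 'n) \<times> real \<Rightarrow> real" assume "f \<in> C1_compact_support sph"
  then have "C1_map sph f" by (simp add: C1_compact_support_def)
  from weak_derivative_compose_geo[OF this]
  show "has_weak_derivative M (f \<circ> (geo \<circ> \<phi>)) (\<lambda>x. differential sph f ((geo \<circ> \<phi>) x) o\<^sub>L geo_derivative \<phi> x)"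
  proof (rule has_weak_derivative_cong)
    fix x
    show "rank_one (differential sph f (geo (\<phi> x)) (dgc (\<phi> x))) (differential M \<phi> x) =
         differential sph f ((geo \<circ> \<phi>) x) o\<^sub>L geo_derivative \<phi> x"
      by (rule blinfun_eqI) (simp add: geo_derivative_def blinfun.scaleR_right)
  qed
qed

text \<open>The chosen colocal derivative is accessible only through scalar compositions. Finitely
  many ambient coordinates, uniqueness of their weak derivatives and injectivity of
  \<open>dsinv\<close> determine it almost everywhere.\<close>

lemma AE_colocal_weak_derivative:
  assumes ne: "points M \<noteq> {}"
  shows "AE x in riemannian_measure M. colocal_weak_derivative M sph (geo \<circ> \<phi>) x = geo_derivative \<phi> x"
proof -
  define U where "U = colocal_weak_derivative M sph (geo \<circ> \<phi>)"
  have U: "has_colocal_weak_derivative M sph (geo \<circ> \<phi>) U"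
    unfolding U_def colocal_weak_derivative_def using has_colocal_weak_derivative_geo
    by (rule someI[where P="has_colocal_weak_derivative M sph (geo \<circ> \<phi>)"])
  show ?thesis unfolding U_def[symmetric]
  proof (rule AE_riemannian_measure[OF ne])
    fix c assume c: "c \<in> atlas M"
    let ?f = "\<lambda>b y. y \<bullet> (b :: (real ^ 'n) \<times> real)"
    let ?N = "\<lambda>b. snd c ` {x \<in> fst c. differential sph (?f b) (geo (\<phi> x)) o\<^sub>L U x \<noteq>
         differential sph (?f b) (geo (\<phi> x)) o\<^sub>L geo_derivative \<phi> x}"
    have neg: "negligible (?N b)" for b
    proof (rule has_weak_derivative_unique[OF _ _ c])
      show "has_weak_derivative M (?f b \<circ> (geo \<circ> \<phi>)) (\<lambda>x. differential sph (?f b) (geo (\<phi> x)) o\<^sub>L U x)"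
        using U coordinate_function(1)[of b] unfolding has_colocal_weak_derivative_def by auto
      show "has_weak_derivative M (?f b \<circ> (geo \<circ> \<phi>)) (\<lambda>x. differential sph (?f b) (geo (\<phi> x)) o\<^sub>L geo_derivative \<phi> x)"
        using has_colocal_weak_derivative_geo coordinate_function(1)[of b] unfolding has_colocal_weak_derivative_def by auto
    qed
    have "snd c ` {x \<in> fst c. U x \<noteq> geo_derivative \<phi> x} \<subseteq> (\<Union>b\<in>Basis. ?N b)"
    proof clarify
      fix x assume x: "x \<in> fst c" and neq: "U x \<noteq> geo_derivative \<phi> x"
      show "snd c x \<in> (\<Union>b\<in>Basis. ?N b)"
      proof (rule ccontr)
        assume n: "\<not> ?thesis"
        have "dsinv 1 (gc (\<phi> x)) (U x v) = dsinv 1 (gc (\<phi> x)) (geo_derivative \<phi> x v)" for v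
        proof (rule euclidean_eqI)
          fix b :: "(real ^ 'n) \<times> real" assume "b \<in> Basis"
          then have "differential sph (?f b) (geo (\<phi> x)) o\<^sub>L U x = differential sph (?f b) (geo (\<phi> x)) o\<^sub>L geo_derivative \<phi> x"
            using n x by blast
          then have "differential sph (?f b) (geo (\<phi> x)) (U x v) = differential sph (?f b) (geo (\<phi> x)) (geo_derivative \<phi> x v)"
            by (metis blinfun_apply_blinfun_compose)
          then show "dsinv 1 (gc (\<phi> x)) (U x v) \<bullet> b = dsinv 1 (gc (\<phi> x)) (geo_derivative \<phi> x v) \<bullet> b"
            by (simp add: coordinate_function(2))
        qed
        then have "U x v = geo_derivative \<phi> x v" for v by (simp add: dsinv_eq_iff)
        then show False using neq blinfun_eqI by blast
      qed
    qed
    moreover have "negligible (\<Union>b\<in>Basis. ?N b)" using neg by (intro negligible_Union) auto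
    ultimately show "negligible (snd c ` {x \<in> fst c. U x \<noteq> geo_derivative \<phi> x})"
      using negligible_subset by blast
  qed
qed

lemma AE_weak_derivative_compose_geo:
  fixes f :: "(real ^ 'n) \<times> real \<Rightarrow> 'b::euclidean_space"
  assumes ne: "points M \<noteq> {}" and f: "C1_map sph f"
  shows "AE x in riemannian_measure M. weak_derivative M (f \<circ> (geo \<circ> \<phi>)) x =
     rank_one (differential sph f (geo (\<phi> x)) (dgc (\<phi> x))) (differential M \<phi> x)"
proof (rule AE_riemannian_measure[OF ne])
  fix c assume c: "c \<in> atlas M"
  have "has_weak_derivative M (f \<circ> (geo \<circ> \<phi>)) (weak_derivative M (f \<circ> (geo \<circ> \<phi>)))"
    unfolding weak_derivative_def using weak_derivative_compose_geo[OF f]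
    by (rule someI[where P="has_weak_derivative M (f \<circ> (geo \<circ> \<phi>))"])
  from has_weak_derivative_unique[OF this weak_derivative_compose_geo[OF f] c]
  show "negligible (snd c ` {x \<in> fst c. weak_derivative M (f \<circ> (geo \<circ> \<phi>)) x \<noteq>
     rank_one (differential sph f (geo (\<phi> x)) (dgc (\<phi> x))) (differential M \<phi> x)})" .
qed

lemma hs_norm_geo_derivative:
  "hs_norm (metric M x) (metric sph (geo (\<phi> x))) (blinfun_apply (geo_derivative \<phi> x)) = conorm (metric M x) (differential M \<phi> x)"
proof -
  have m: "metric sph (geo (\<phi> x)) = (\<bullet>)" by (intro ext) (simp add: metric_sph_geo)
  show ?thesis
    unfolding m using hs_norm_rank_one[OF bilinear_inner, of "blinfun_apply (geo_derivative \<phi> x)" "differential M \<phi> x" "dgc (\<phi> x)"]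
    by (simp add: geo_derivative_def gc_inner)
qed

text \<open>\<open>geo\<close> has unit speed, so the energy density of the composed map is the
  covector norm of the differential of the phase.\<close>

lemma geo_in_homogeneous_sobolev:
  assumes ne: "points M \<noteq> {}"
    and fin: "(\<integral>\<^sup>+ x. ennreal (conorm (metric M x) (differential M \<phi> x) powr p) \<partial>riemannian_measure M) < \<infinity>"
  shows "geo \<circ> \<phi> \<in> homogeneous_sobolev M sph p"
proof -
  have "colocally_weakly_differentiable M sph (geo \<circ> \<phi>)"
    unfolding colocally_weakly_differentiable_def weakly_differentiable_def
    using measurable_geo has_colocal_weak_derivative_geo unfolding has_colocal_weak_derivative_def by blast
  moreover have "(\<integral>\<^sup>+ x. ennreal (hs_norm (metric M x) (metric sph ((geo \<circ> \<phi>) x))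
              (blinfun_apply (colocal_weak_derivative M sph (geo \<circ> \<phi>) x)) powr p) \<partial>riemannian_measure M) =
      (\<integral>\<^sup>+ x. ennreal (conorm (metric M x) (differential M \<phi> x) powr p) \<partial>riemannian_measure M)"
    by (intro nn_integral_cong_AE eventually_mono[OF AE_colocal_weak_derivative[OF ne]])
      (simp add: hs_norm_geo_derivative)
  ultimately show ?thesis using fin unfolding homogeneous_sobolev_def by simp
qed

end

end

section \<open>Extending functions from a chart\<close>

text \<open>The offset d is the phase around which the maps will oscillate. If G is supported in a
  compact part of the chart, the function is the constant d beyond it.\<close>

definition chart_extension :: "('p, 'm) chart \<Rightarrow> real \<Rightarrow> ((real ^ 'm) \<Rightarrow> real) \<Rightarrow> 'p \<Rightarrow> real" where
  "chart_extension c d G x = d + (if x \<in> fst c then G (snd c x) else 0)"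

context riemannian
begin

context
  fixes c :: "('p, 'm) chart" and K :: "(real ^ 'm) set"
  assumes c: "c \<in> atlas M" and K: "compact K" "K \<subseteq> chart_img c"
begin

definition chart_compact :: "'p set" where
  "chart_compact = {x \<in> fst c. snd c x \<in> K}"

text \<open>Here the Hausdorff property enters: the compact support in the chart is closed in M, so
  the constant continuation of a function from the chart is C1 also at the edge of the chart
  domain.\<close>

lemma openin_compl_chart_compact: "openin (carrier_top M) (points M - chart_compact)"
proof -
  have "snd c ` chart_compact = K"
    using K(2) by (auto simp: chart_compact_def chart_img_def)
  moreover have "chart_compact \<subseteq> topspace (subtopology (carrier_top M) (fst c))"
    using chart_domain_subset[OF c] by (auto simp: chart_compact_def)
  moreover have "compactin (top_of_set (chart_img c)) K"
    using K by (simp add: compactin_subtopology)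
  ultimately have "compactin (subtopology (carrier_top M) (fst c)) chart_compact"
    using homeomorphic_map_compactness_eq[OF homeomorphic_chart[OF c]] by metis
  then have "compactin (carrier_top M) chart_compact" by (simp add: compactin_subtopology)
  then have "closedin (carrier_top M) chart_compact"
    using riemannian compactin_imp_closedin unfolding riemannian_manifold_def by blast
  then show ?thesis by blast
qed

lemma chart_compact_lebesgue_sets: "chart_compact \<in> lebesgue_sets M"
proof -
  interpret sigma_algebra "points M" "lebesgue_sets M" by (rule sigma_algebra_lebesgue_sets)
  have "points M - (points M - chart_compact) \<in> lebesgue_sets M"
    using openin_lebesgue_sets[OF openin_compl_chart_compact] by blast
  moreover have "points M - (points M - chart_compact) = chart_compact"
    using chart_domain_subset[OF c] by (auto simp: chart_compact_def)
  ultimately show ?thesis by simp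
qed

context
  fixes G :: "real ^ 'm \<Rightarrow> real" and d :: real
  assumes G: "C1_on UNIV G" "\<forall>z. z \<notin> K \<longrightarrow> G z = 0"
begin

lemma chart_extension_eq: "x \<in> points M - chart_compact \<Longrightarrow> chart_extension c d G x = d"
  using G(2) by (auto simp: chart_extension_def chart_compact_def)

lemma C1_map_chart_extension: "C1_map M (chart_extension c d G)"
  unfolding C1_map_def
proof (intro ballI C1_on_local)
  fix c' z assume c': "c' \<in> atlas M" and z: "z \<in> chart_img c'"
  show "\<exists>U. open U \<and> z \<in> U \<and> C1_on U (chart_extension c d G \<circ> chart_inv c')"
  proof (cases "chart_inv c' z \<in> fst c")
    case True
    let ?U = "snd c' ` (fst c' \<inter> fst c)"
    have zU: "z \<in> ?U" using True chart_inv_in[OF z] chart_chart_inv[OF z] by (metis IntI image_eqI)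
    have "C1_on ?U (\<lambda>z. d + (G \<circ> (snd c \<circ> chart_inv c')) z)"
      by (intro C1_on_add C1_on_const C1_on_compose[OF G(1) C1_transition[OF c' c]]) simp
    then have "C1_on ?U (chart_extension c d G \<circ> chart_inv c')"
      by (rule C1_on_cong[OF open_overlap[OF c' c]]) (auto simp: chart_extension_def chart_inv_chart[OF c'])
    then show ?thesis using zU open_overlap[OF c' c] by blast
  next
    case False
    let ?U = "snd c' ` ((points M - chart_compact) \<inter> fst c')"
    have o: "open ?U" by (rule open_chart_image[OF c' openin_compl_chart_compact])
    have "chart_inv c' z \<in> (points M - chart_compact) \<inter> fst c'"
      using False chart_inv_in[OF z] chart_domain_subset[OF c'] by (auto simp: chart_compact_def)
    then have zU: "z \<in> ?U" using chart_chart_inv[OF z] by (metis image_eqI)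
    have "C1_on ?U (chart_extension c d G \<circ> chart_inv c')"
      by (rule C1_on_cong[OF o C1_on_const[of _ d]]) (auto simp: chart_extension_eq chart_inv_chart[OF c'])
    then show ?thesis using zU o by blast
  qed
qed

lemma differential_chart_extension:
  assumes x: "x \<in> fst c"
  shows "differential M (chart_extension c d G) x = fd G (snd c x) o\<^sub>L tangent_change (chart_at M x) c x"
proof -
  have "((\<lambda>z. d + G z) has_derivative blinfun_apply (fd G (snd c x))) (at (snd c x))"
    using has_derivative_add[OF has_derivative_const C1_on_imp_has_derivative[OF G(1) UNIV_I]] by simp
  then have "(chart_extension c d G \<circ> chart_inv c has_derivative blinfun_apply (fd G (snd c x))) (at (snd c x))"
    by (rule has_derivative_transform_within_open[OF _ open_chart_img[OF c] chart_in_img[OF x]])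
      (simp add: chart_extension_def chart_inv_in chart_chart_inv)
  from fd_eqI[OF this] show ?thesis using differential_chart[OF C1_map_chart_extension c x] by simp
qed

lemma differential_chart_extension_outside:
  assumes x: "x \<in> points M - chart_compact"
  shows "differential M (chart_extension c d G) x = 0"
proof -
  let ?c = "chart_at M x"
  have c': "?c \<in> atlas M" "x \<in> fst ?c" using chart_at x by auto
  have "((\<lambda>z. d) has_derivative blinfun_apply 0) (at (snd ?c x))" by (simp add: zero_blinfun.rep_eq)
  then have "(chart_extension c d G \<circ> chart_inv ?c has_derivative blinfun_apply 0) (at (snd ?c x))"
    by (rule has_derivative_transform_within_open[OF _ open_chart_image[OF c'(1) openin_compl_chart_compact]])
      (use x c' in \<open>auto simp: chart_extension_eq chart_inv_chart\<close>)
  then show ?thesis unfolding differential_eq_fd by (rule fd_eqI)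
qed

end

text \<open>Minimum of the quadratic form over K times the unit sphere, extended to all vectors by
  homogeneity. It yields upper bounds for covector norms.\<close>

lemma metric_in_lower_bound: "\<exists>\<kappa>>0. \<forall>z\<in>K. \<forall>w. \<kappa> * (w \<bullet> w) \<le> metric_in M c z w w"
proof (cases "K = {}")
  case True
  then show ?thesis by (auto intro: exI[of _ 1])
next
  case False
  let ?S = "K \<times> sphere (0 :: real ^ 'm) 1"
  have cont: "continuous_on ?S (\<lambda>(z, w). metric_in M c z w w)"
  proof -
    \<comment> \<open>Continuity of the metric in the base point is known for fixed vectors only;
      expanding in matrix entries makes it joint in both arguments.\<close>
    have "continuous_on ?S (\<lambda>q. \<Sum>i\<in>UNIV. \<Sum>j\<in>UNIV. snd q $ i * snd q $ j * metric_in M c (fst q) (axis i 1) (axis j 1))"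
      using K(2) by (intro continuous_intros continuous_on_compose2[OF C1_on_imp_continuous_on[OF C1_metric_in[OF c]]]) auto
    then show ?thesis
    proof (rule continuous_on_eq)
      fix q assume "q \<in> ?S"
      then have "fst q \<in> chart_img c" using K(2) by auto
      from bilinear_basis_expansion[OF bilinear_metric_in[OF c this], of "snd q" "snd q"]
      show "(\<Sum>i\<in>UNIV. \<Sum>j\<in>UNIV. snd q $ i * snd q $ j * metric_in M c (fst q) (axis i 1) (axis j 1)) =
          (case q of (z, w) \<Rightarrow> metric_in M c z w w)" by (simp only: case_prod_beta)
    qed
  qed
  have "axis undefined 1 \<in> sphere (0 :: real ^ 'm) 1" by simp
  then have "?S \<noteq> {}" using False by blast
  then obtain q where q: "q \<in> ?S" "\<And>y. y \<in> ?S \<Longrightarrow> (case q of (z, w) \<Rightarrow> metric_in M c z w w) \<le> (case y of (z, w) \<Rightarrow> metric_in M c z w w)"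
    using continuous_attains_inf[OF compact_Times[OF K(1) compact_sphere] _ cont] by blast
  define \<kappa> where "\<kappa> = metric_in M c (fst q) (snd q) (snd q)"
  have "fst q \<in> K" "norm (snd q) = 1" using q(1) by auto
  then have "fst q \<in> chart_img c" "snd q \<noteq> 0" using K(2) by auto
  then have "\<kappa> > 0" unfolding \<kappa>_def by (rule metric_in_pos[OF c])
  moreover have "\<kappa> * (w \<bullet> w) \<le> metric_in M c z w w" if z: "z \<in> K" for z w
  proof (cases "w = 0")
    case True
    then show ?thesis using bilinear_lzero[OF bilinear_metric_in[OF c]] z K(2) by auto
  next
    case False
    interpret b: bounded_bilinear "metric_in M c z"
      using bilinear_metric_in[OF c] z K(2) bilinear_conv_bounded_bilinear by blast
    have "(z, w /\<^sub>R norm w) \<in> ?S" using z False by simp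
    from q(2)[OF this] have "\<kappa> \<le> metric_in M c z (w /\<^sub>R norm w) (w /\<^sub>R norm w)"
      by (simp add: \<kappa>_def case_prod_beta)
    also have "\<dots> = metric_in M c z w w / (w \<bullet> w)"
      by (simp add: b.scaleR_left b.scaleR_right dot_square_norm power2_eq_square divide_inverse)
    finally show ?thesis using False by (simp add: pos_le_divide_eq)
  qed
  ultimately show ?thesis by blast
qed

text \<open>A vector of unit length in the metric has coordinates of Euclidean length at most
  \<open>sqrt (1 / \<kappa>)\<close>, and \<open>fd G\<close> is bounded on K. The dimensional
  factor is harmless, as only finiteness counts.\<close>

lemma conorm_bound:
  assumes G: "C1_on UNIV G"
  shows "\<exists>C\<ge>0. \<forall>x\<in>chart_compact.
     conorm (metric M x) (fd (G :: real ^ 'm \<Rightarrow> real) (snd c x) o\<^sub>L tangent_change (chart_at M x) c x) \<le> C"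
proof -
  obtain \<kappa> where \<kappa>: "\<kappa> > 0" "\<And>z w. z \<in> K \<Longrightarrow> \<kappa> * (w \<bullet> w) \<le> metric_in M c z w w"
    using metric_in_lower_bound by blast
  have "bounded (fd G ` K)"
    using K(1) C1_on_imp_continuous_fd[OF G] by (meson compact_continuous_image compact_imp_bounded continuous_on_subset subset_UNIV)
  then obtain B where B: "B > 0" "\<And>z. z \<in> K \<Longrightarrow> norm (fd G z) \<le> B" unfolding bounded_pos by auto
  have "conorm (metric M x) (fd G (snd c x) o\<^sub>L tangent_change (chart_at M x) c x) \<le> sqrt (real CARD('m)) * \<bar>B * sqrt (1 / \<kappa>)\<bar>"
    if x: "x \<in> chart_compact" for x
  proof (rule conorm_le)
    have xc: "x \<in> fst c" and zK: "snd c x \<in> K" using x by (auto simp: chart_compact_def)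
    have xp: "x \<in> points M" using xc chart_domain_subset[OF c] by auto
    show "inner_product (metric M x)" by (rule inner_product_metric[OF xp])
    fix e assume e: "metric M x e e = 1"
    define w where "w = tangent_change (chart_at M x) c x e"
    have "tangent_change c (chart_at M x) x w = e"
      unfolding w_def by (rule tangent_change_inverse[OF chart_at(1)[OF xp] c chart_at(2)[OF xp] xc])
    then have "metric_in M c (snd c x) w w = 1"
      using metric_in_tangent_change[OF c xc, of w w] e by simp
    then have "w \<bullet> w \<le> 1 / \<kappa>" using \<kappa>(2)[OF zK, of w] \<kappa>(1) by (simp add: field_simps)
    then have nw: "norm w \<le> sqrt (1 / \<kappa>)" unfolding norm_eq_sqrt_inner by (rule real_sqrt_le_mono)
    have "\<bar>fd G (snd c x) w\<bar> \<le> norm (fd G (snd c x)) * norm w"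
      using norm_blinfun[of "fd G (snd c x)" w] by simp
    also have "\<dots> \<le> B * sqrt (1 / \<kappa>)" using B(2)[OF zK] B(1) nw by (intro mult_mono) auto
    finally show "\<bar>(fd G (snd c x) o\<^sub>L tangent_change (chart_at M x) c x) e\<bar> \<le> B * sqrt (1 / \<kappa>)"
      by (simp add: w_def)
  qed
  then show ?thesis by (intro exI[of _ "sqrt (real CARD('m)) * \<bar>B * sqrt (1 / \<kappa>)\<bar>"]) auto
qed

text \<open>Stated for one fixed vector, since the lower estimate of the covector norm tests only
  the direction of oscillation.\<close>

lemma metric_in_upper_bound: "\<exists>B>0. \<forall>z\<in>K. metric_in M c z w w \<le> B\<^sup>2"
proof -
  have "continuous_on K (\<lambda>z. metric_in M c z w w)"
    using C1_on_imp_continuous_on[OF C1_metric_in[OF c]] K(2) continuous_on_subset by blast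
  then have "bounded ((\<lambda>z. metric_in M c z w w) ` K)"
    using K(1) compact_continuous_image compact_imp_bounded by blast
  then obtain B where B: "B > 0" "\<And>z. z \<in> K \<Longrightarrow> \<bar>metric_in M c z w w\<bar> \<le> B" unfolding bounded_pos by auto
  then have "\<forall>z\<in>K. metric_in M c z w w \<le> (sqrt B)\<^sup>2" by (simp add: abs_le_iff)
  then show ?thesis using B(1) by (intro exI[of _ "sqrt B"]) auto
qed

lemma nn_integral_conorm_finite:
  assumes ne: "points M \<noteq> {}" and fin: "emeasure (riemannian_measure M) chart_compact < \<infinity>"
    and G: "C1_on UNIV G" "\<forall>z. z \<notin> K \<longrightarrow> G z = 0" and p: "0 \<le> p"
  shows "(\<integral>\<^sup>+ x. ennreal (conorm (metric M x) (differential M (chart_extension c d G) x) powr p) \<partial>riemannian_measure M) < \<infinity>"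
proof -
  obtain C where C: "C \<ge> 0" "\<And>x. x \<in> chart_compact \<Longrightarrow>
     conorm (metric M x) (fd G (snd c x) o\<^sub>L tangent_change (chart_at M x) c x) \<le> C"
    using conorm_bound[OF G(1)] by blast
  have "(\<integral>\<^sup>+ x. ennreal (conorm (metric M x) (differential M (chart_extension c d G) x) powr p) \<partial>riemannian_measure M)
     \<le> (\<integral>\<^sup>+ x. ennreal (C powr p) * indicator chart_compact x \<partial>riemannian_measure M)"
  proof (rule nn_integral_mono)
    fix x assume "x \<in> space (riemannian_measure M)"
    then have x: "x \<in> points M" by (simp add: emeasure_riemannian_measure[OF ne])
    show "ennreal (conorm (metric M x) (differential M (chart_extension c d G) x) powr p) \<le> ennreal (C powr p) * indicator chart_compact x"
    proof (cases "x \<in> chart_compact")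
      case True
      then have "x \<in> fst c" by (simp add: chart_compact_def)
      then show ?thesis using True C(2)[OF True] p
        by (simp add: differential_chart_extension[OF G] powr_mono2 conorm_nonneg ennreal_leI)
    next
      case False
      then show ?thesis using x differential_chart_extension_outside[OF G] by simp
    qed
  qed
  also have "\<dots> = ennreal (C powr p) * emeasure (riemannian_measure M) chart_compact"
    by (rule nn_integral_cmult_indicator) (simp add: emeasure_riemannian_measure[OF ne] chart_compact_lebesgue_sets)
  also have "\<dots> < \<infinity>" using fin by (simp add: ennreal_mult_less_top)
  finally show ?thesis .
qed

end

end

section \<open>Powers of extended reals, bounded curves and the sine\<close>

lemma ennreal_powr_mono: "a \<le> b \<Longrightarrow> 0 \<le> r \<Longrightarrow> ennreal_powr a r \<le> ennreal_powr b r"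
  unfolding ennreal_powr_def
  by (auto simp: top_unique less_top intro!: ennreal_leI powr_mono2 enn2real_mono)

lemma ennreal_powr_ennreal: "0 \<le> a \<Longrightarrow> ennreal_powr (ennreal a) r = ennreal (a powr r)"
  by (simp add: ennreal_powr_def)

text \<open>If the derivative had period h, the increment of c over a step h would be a constant a,
  nonzero by the last hypothesis, and c would drift by n a after n steps, against
  boundedness.\<close>

lemma derivative_not_periodic:
  fixes c :: "real \<Rightarrow> 'b::real_normed_vector"
  assumes d: "\<And>t. (c has_vector_derivative c' t) (at t)" and b: "bounded (range c)" and h: "c h \<noteq> c 0"
  shows "\<exists>s. c' (s + h) \<noteq> c' s"
proof (rule ccontr)
  assume "\<not> ?thesis"
  then have eq: "c' (s + h) = c' s" for s by blast
  have "((\<lambda>s. c (s + h) - c s) has_vector_derivative 0) (at s within UNIV)" for s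
  proof -
    have "((\<lambda>s. s + h) has_vector_derivative 1) (at s)" by (auto intro!: derivative_eq_intros)
    from vector_diff_chain_at[OF this d] have "((\<lambda>s. c (s + h)) has_vector_derivative c' (s + h)) (at s)"
      by (simp add: o_def)
    from has_vector_derivative_diff[OF this d[of s]] show ?thesis by (simp add: eq)
  qed
  then obtain a where a: "\<And>s. c (s + h) - c s = a"
    using has_vector_derivative_zero_constant[of UNIV "\<lambda>s. c (s + h) - c s"] by auto
  have n: "c (real n * h) = c 0 + real n *\<^sub>R a" for n
  proof (induction n)
    case (Suc n)
    have "c (real n * h + h) = c (real n * h) + a" using a[of "real n * h"] by (simp add: algebra_simps)
    then show ?case using Suc by (simp add: algebra_simps)
  qed simp
  obtain B where B: "\<And>t. norm (c t) \<le> B" using b unfolding bounded_iff by auto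
  have "a \<noteq> 0" using a[of 0] h by auto
  then obtain n where "real n * norm a > 2 * B" using reals_Archimedean3[of "norm a", THEN spec, of "2 * B"] by auto
  moreover have "real n * norm a \<le> norm (c (real n * h)) + norm (c 0)"
    using norm_triangle_ineq4[of "c (real n * h)" "c 0"] n[of n] by simp
  ultimately show False using B[of "real n * h"] B[of 0] by linarith
qed

lemma C1_on_sin: "C1_on UNIV f \<Longrightarrow> C1_on UNIV (\<lambda>z. sin (f z :: real))"
proof -
  have "C1_on UNIV (sin :: real \<Rightarrow> real)"
    by (rule C1_on_real[where f'=cos])
      (auto simp: has_real_derivative_iff_has_vector_derivative[symmetric] intro!: derivative_eq_intros continuous_intros)
  then show "C1_on UNIV f \<Longrightarrow> C1_on UNIV (\<lambda>z. sin (f z :: real))"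
    using C1_on_compose[of UNIV sin UNIV f] by (simp add: o_def)
qed

context great_circle
begin

lemma geo_neq: "0 < h \<Longrightarrow> h \<le> 1 \<Longrightarrow> geo h \<noteq> geo 0"
proof
  assume h: "0 < h" "h \<le> 1" and "geo h = geo 0"
  then have "gc h \<bullet> e2 = gc 0 \<bullet> e2" by (simp add: geo_def)
  then have "sin h = 0" by (simp add: gc_def inner_add_left e)
  moreover have "sin h > 0" using h pi_gt3 by (intro sin_gt_zero) auto
  ultimately show False by simp
qed

end

section \<open>The two distances along a great circle\<close>

lemma fd_add_scaled:
  fixes G \<zeta> :: "'a::euclidean_space \<Rightarrow> real"
  assumes "C1_on UNIV G" "C1_on UNIV \<zeta>"
  shows "fd (\<lambda>z. G z + h * \<zeta> z) z = fd G z + h *\<^sub>R fd \<zeta> z"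
proof (rule fd_eqI)
  show "((\<lambda>z. G z + h * \<zeta> z) has_derivative blinfun_apply (fd G z + h *\<^sub>R fd \<zeta> z)) (at z)"
    using has_derivative_add[OF C1_on_imp_has_derivative[OF assms(1) UNIV_I]
        has_derivative_mult_right[OF C1_on_imp_has_derivative[OF assms(2) UNIV_I]]]
    by (simp add: plus_blinfun.rep_eq scaleR_blinfun.rep_eq)
qed

context riemannian_circle
begin

text \<open>The order of the quantifiers is the point: D depends on \<open>\<zeta>\<close> and K but
  not on h, d or G, so h can be fixed before the oscillation of G is chosen.\<close>

lemma delta_S_geo_le:
  assumes c: "c \<in> atlas M" and K: "compact K" "K \<subseteq> chart_img c"
    and ne: "points M \<noteq> {}" and fin: "emeasure (riemannian_measure M) (chart_compact c K) < \<infinity>"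
    and \<zeta>: "C1_on UNIV \<zeta>" "\<forall>z. z \<notin> K \<longrightarrow> \<zeta> z = 0" and p: "0 < p"
  shows "\<exists>D\<ge>0. \<forall>h\<ge>0. \<forall>d G. C1_on UNIV G \<longrightarrow> (\<forall>z. z \<notin> K \<longrightarrow> G z = 0) \<longrightarrow>
     delta_S M sph p (geo \<circ> chart_extension c d G) (geo \<circ> chart_extension c d (\<lambda>z. G z + h * \<zeta> z))
       \<le> ennreal (((h * D) powr p * measure (riemannian_measure M) (chart_compact c K)) powr (1 / p))"
proof -
  let ?\<mu> = "riemannian_measure M" and ?K = "chart_compact c K"
  define \<psi> where "\<psi> = chart_extension c 0 \<zeta>"
  obtain C where C: "C \<ge> 0" "\<And>x. x \<in> ?K \<Longrightarrow>
     conorm (metric M x) (fd \<zeta> (snd c x) o\<^sub>L tangent_change (chart_at M x) c x) \<le> C"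
    using conorm_bound[OF c K \<zeta>(1)] by blast
  have "bounded (\<zeta> ` K)"
    using K(1) C1_on_imp_continuous_on[OF \<zeta>(1)] by (meson compact_continuous_image compact_imp_bounded continuous_on_subset subset_UNIV)
  then obtain B where B: "B > 0" "\<And>z. z \<in> K \<Longrightarrow> \<bar>\<zeta> z\<bar> \<le> B" unfolding bounded_pos by auto
  \<comment> \<open>B bounds \<open>\<zeta>\<close> and C bounds the norm of its differential on the
    compact set, so D bounds the Sasaki speed per unit of h there. Elsewhere the speed is zero,
    whence the indicator in the next estimate.\<close>
  define D where "D = sqrt (B\<^sup>2 + C\<^sup>2)"
  have speed: "sqrt ((h * \<psi> x)\<^sup>2 + (conorm (metric M x) (h *\<^sub>R differential M \<psi> x))\<^sup>2) \<le> h * D * indicator ?K x"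
    if h: "h \<ge> 0" and x: "x \<in> points M" for h x
  proof (cases "x \<in> ?K")
    case True
    then have xc: "x \<in> fst c" "snd c x \<in> K" by (auto simp: chart_compact_def[OF c K])
    have "\<bar>\<psi> x\<bar> \<le> B" using B(2)[OF xc(2)] xc(1) by (simp add: \<psi>_def chart_extension_def)
    then have "(\<psi> x)\<^sup>2 \<le> B\<^sup>2" using abs_le_square_iff[of "\<psi> x" B] B(1) by simp
    moreover have "conorm (metric M x) (differential M \<psi> x) \<le> C"
      using C(2)[OF True] by (simp add: \<psi>_def differential_chart_extension[OF c K \<zeta> xc(1)])
    then have "(conorm (metric M x) (differential M \<psi> x))\<^sup>2 \<le> C\<^sup>2"
      using conorm_nonneg by (intro power_mono)
    ultimately have "sqrt ((\<psi> x)\<^sup>2 + (conorm (metric M x) (differential M \<psi> x))\<^sup>2) \<le> D"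
      unfolding D_def by (intro real_sqrt_le_mono add_mono)
    moreover have "sqrt ((h * \<psi> x)\<^sup>2 + (conorm (metric M x) (h *\<^sub>R differential M \<psi> x))\<^sup>2) =
        h * sqrt ((\<psi> x)\<^sup>2 + (conorm (metric M x) (differential M \<psi> x))\<^sup>2)"
      using h by (simp add: conorm_scaleR power_mult_distrib distrib_left[symmetric] real_sqrt_mult)
    ultimately show ?thesis using True h by (simp add: mult_left_mono)
  next
    case False
    then show ?thesis using x
      by (simp add: \<psi>_def chart_extension_eq[OF c K \<zeta>] differential_chart_extension_outside[OF c K \<zeta>])
  qed
  have sets: "?K \<in> sets ?\<mu>" by (simp add: emeasure_riemannian_measure[OF ne] chart_compact_lebesgue_sets[OF c K])
  have bound: "delta_S M sph p (geo \<circ> chart_extension c d G) (geo \<circ> chart_extension c d (\<lambda>z. G z + h * \<zeta> z))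
       \<le> ennreal (((h * D) powr p * measure ?\<mu> ?K) powr (1 / p))"
    if h: "h \<ge> 0" and G: "C1_on UNIV G" "\<forall>z. z \<notin> K \<longrightarrow> G z = 0" for h d G
  proof -
    define u where "u = chart_extension c d G"
    define v where "v = chart_extension c d (\<lambda>z. G z + h * \<zeta> z)"
    have H: "C1_on UNIV (\<lambda>z. G z + h * \<zeta> z)" "\<forall>z. z \<notin> K \<longrightarrow> G z + h * \<zeta> z = 0"
      using G \<zeta> by (auto intro!: C1_on_add C1_on_mult)
    have u: "C1_map M u" unfolding u_def by (rule C1_map_chart_extension[OF c K G])
    have v: "C1_map M v" unfolding v_def by (rule C1_map_chart_extension[OF c K H])
    have vx: "v x = u x + h * \<psi> x" for x by (simp add: u_def v_def \<psi>_def chart_extension_def)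
    have dv: "differential M v x = differential M u x + h *\<^sub>R differential M \<psi> x" if x: "x \<in> points M" for x
    proof (cases "x \<in> fst c")
      case True
      show ?thesis
        unfolding u_def v_def \<psi>_def differential_chart_extension[OF c K G True] differential_chart_extension[OF c K H True]
          differential_chart_extension[OF c K \<zeta> True] fd_add_scaled[OF G(1) \<zeta>(1)]
        by (rule blinfun_eqI) (simp add: blinfun.bilinear_simps)
    next
      case False
      then have "x \<in> points M - ?K" using x by (simp add: chart_compact_def[OF c K])
      then show ?thesis unfolding u_def v_def \<psi>_def
        by (simp add: differential_chart_extension_outside[OF c K G] differential_chart_extension_outside[OF c K H] differential_chart_extension_outside[OF c K \<zeta>])
    qed
    let ?d = "\<lambda>x. sasaki_dist M sph (x, (geo \<circ> u) x, colocal_weak_derivative M sph (geo \<circ> u) x)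
                            (x, (geo \<circ> v) x, colocal_weak_derivative M sph (geo \<circ> v) x)"
    have "AE x in ?\<mu>. ennreal_powr (?d x) p \<le> ennreal ((h * D) powr p) * indicator ?K x"
      using AE_colocal_weak_derivative[OF u ne] AE_colocal_weak_derivative[OF v ne] AE_space
    proof eventually_elim
      case (elim x)
      have x: "x \<in> points M" using elim(3) by (simp add: emeasure_riemannian_measure[OF ne])
      have "?d x = sasaki_dist M sph (x, geo (u x), rank_one (dgc (u x)) (differential M u x))
          (x, geo (u x + h * \<psi> x), rank_one (dgc (u x + h * \<psi> x)) (differential M u x + h *\<^sub>R differential M \<psi> x))"
        using elim(1,2) by (simp add: geo_derivative_def vx dv[OF x])
      also have "\<dots> \<le> ennreal (sqrt ((h * \<psi> x)\<^sup>2 + (conorm (metric M x) (h *\<^sub>R differential M \<psi> x))\<^sup>2))"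
        by (rule sasaki_dist_le[OF x])
      also have "\<dots> \<le> ennreal (h * D * indicator ?K x)" by (rule ennreal_leI[OF speed[OF h x]])
      finally have "ennreal_powr (?d x) p \<le> ennreal_powr (ennreal (h * D * indicator ?K x)) p"
        using p by (intro ennreal_powr_mono) auto
      also have "\<dots> = ennreal ((h * D * indicator ?K x) powr p)"
        using h by (intro ennreal_powr_ennreal) (simp add: D_def)
      also have "\<dots> = ennreal ((h * D) powr p) * indicator ?K x"
        using p by (simp add: indicator_def)
      finally show ?case .
    qed
    then have "(\<integral>\<^sup>+ x. ennreal_powr (?d x) p \<partial>?\<mu>) \<le> (\<integral>\<^sup>+ x. ennreal ((h * D) powr p) * indicator ?K x \<partial>?\<mu>)"
      by (rule nn_integral_mono_AE)
    also have "\<dots> = ennreal ((h * D) powr p) * emeasure ?\<mu> ?K"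
      by (rule nn_integral_cmult_indicator[OF sets])
    also have "\<dots> = ennreal ((h * D) powr p * measure ?\<mu> ?K)"
      using fin by (simp add: emeasure_eq_ennreal_measure ennreal_mult)
    finally have "delta_S M sph p (geo \<circ> u) (geo \<circ> v) \<le> ennreal_powr (ennreal ((h * D) powr p * measure ?\<mu> ?K)) (1 / p)"
      unfolding delta_S_def using p by (intro ennreal_powr_mono) auto
    then show ?thesis by (simp add: ennreal_powr_ennreal u_def v_def)
  qed
  show ?thesis by (rule exI[of _ D]) (use bound in \<open>auto simp: D_def\<close>)
qed

text \<open>Only the derivative term on S is kept. As u and v have the same differential there, the
  difference of the two derivatives again has rank one, so its norm is the product in the
  hypothesis; integrating the constant Y^p over S finishes.\<close>

lemma delta_iota_geo_ge:
  fixes \<iota> :: "(real ^ 'n) \<times> real \<Rightarrow> real ^ 'k::finite"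
  assumes ne: "points M \<noteq> {}" and p: "0 < p" and \<iota>: "C1_map sph \<iota>"
    and u: "C1_map M u" and v: "C1_map M v" and S: "S \<in> lebesgue_sets M" and Y: "0 \<le> Y"
    and eq: "\<And>x. x \<in> S \<Longrightarrow> differential M v x = differential M u x"
    and ge: "\<And>x. x \<in> S \<Longrightarrow> Y \<le> norm (differential sph \<iota> (geo (u x)) (dgc (u x)) - differential sph \<iota> (geo (v x)) (dgc (v x)))
        * conorm (metric M x) (differential M u x)"
    and one: "1 \<le> ennreal (Y powr p) * emeasure (riemannian_measure M) S"
  shows "1 \<le> delta_iota M \<iota> p (geo \<circ> u) (geo \<circ> v)"
proof -
  let ?\<mu> = "riemannian_measure M"
  let ?c = "\<lambda>t. differential sph \<iota> (geo t) (dgc t)"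
  let ?w = "\<lambda>u x. weak_derivative M (\<iota> \<circ> (geo \<circ> u)) x"
  let ?f = "\<lambda>x. ((norm (\<iota> ((geo \<circ> u) x) - \<iota> ((geo \<circ> v) x)))\<^sup>2 +
       (hs_norm (metric M x) (\<bullet>) (blinfun_apply (?w u x - ?w v x)))\<^sup>2) powr (p / 2)"
  have "AE x in ?\<mu>. ennreal (Y powr p) * indicator S x \<le> ennreal (?f x)"
    using AE_weak_derivative_compose_geo[OF u ne \<iota>] AE_weak_derivative_compose_geo[OF v ne \<iota>]
  proof eventually_elim
    case (elim x)
    show ?case
    proof (cases "x \<in> S")
      case True
      have "blinfun_apply (?w u x - ?w v x) w = differential M u x w *\<^sub>R (?c (u x) - ?c (v x))" for w
        using elim by (simp add: eq[OF True] blinfun.bilinear_simps scaleR_diff_right)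
      from hs_norm_rank_one[OF bilinear_inner this, of "metric M x"]
      have "Y \<le> hs_norm (metric M x) (\<bullet>) (blinfun_apply (?w u x - ?w v x))"
        using ge[OF True] by (simp add: norm_eq_sqrt_inner)
      then have "Y\<^sup>2 \<le> (norm (\<iota> ((geo \<circ> u) x) - \<iota> ((geo \<circ> v) x)))\<^sup>2 +
       (hs_norm (metric M x) (\<bullet>) (blinfun_apply (?w u x - ?w v x)))\<^sup>2"
        using Y by (intro add_increasing power_mono) auto
      then have "(Y\<^sup>2) powr (p / 2) \<le> ?f x" using p by (intro powr_mono2) auto
      moreover have "(Y\<^sup>2) powr (p / 2) = Y powr p"
        using Y by (cases "Y = 0") (auto simp: powr_powr powr_numeral[symmetric] simp del: powr_numeral)
      ultimately show ?thesis using True by (simp add: ennreal_leI)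
    qed simp
  qed
  then have "(\<integral>\<^sup>+ x. ennreal (Y powr p) * indicator S x \<partial>?\<mu>) \<le> (\<integral>\<^sup>+ x. ennreal (?f x) \<partial>?\<mu>)"
    by (rule nn_integral_mono_AE)
  moreover have "(\<integral>\<^sup>+ x. ennreal (Y powr p) * indicator S x \<partial>?\<mu>) = ennreal (Y powr p) * emeasure ?\<mu> S"
    by (rule nn_integral_cmult_indicator) (simp add: emeasure_riemannian_measure[OF ne] S)
  ultimately have "ennreal 1 \<le> (\<integral>\<^sup>+ x. ennreal (?f x) \<partial>?\<mu>)" using one by simp
  then have "ennreal_powr (ennreal 1) (1 / p) \<le> delta_iota M \<iota> p (geo \<circ> u) (geo \<circ> v)"
    unfolding delta_iota_def o_assoc[symmetric] using p by (intro ennreal_powr_mono) auto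
  then show ?thesis using ennreal_powr_ennreal[of 1 "1 / p"] by simp
qed

section \<open>The oscillating maps and the choice of their constants\<close>

lemma not_uniformly_continuous_delta_iota:
  fixes \<iota> :: "(real ^ 'n) \<times> real \<Rightarrow> real ^ 'k::finite"
  assumes ne: "points M \<noteq> {}" and p: "1 \<le> p" and \<iota>: "C1_map sph \<iota>" "embedding_map (carrier_top sph) euclidean \<iota>"
  shows "\<not> uniformly_continuous_edist (homogeneous_sobolev M sph p) (delta_S M sph p) (delta_iota M \<iota> p) (\<lambda>u. u)"
proof
  assume uc: "uniformly_continuous_edist (homogeneous_sobolev M sph p) (delta_S M sph p) (delta_iota M \<iota> p) (\<lambda>u. u)"
  then obtain \<delta> :: real where \<delta>: "\<delta> > 0" "\<And>u v. u \<in> homogeneous_sobolev M sph p \<Longrightarrow> v \<in> homogeneous_sobolev M sph p \<Longrightarrow>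
      delta_S M sph p u v < ennreal \<delta> \<Longrightarrow> delta_iota M \<iota> p u v < ennreal 1"
    unfolding uniformly_continuous_edist_def using zero_less_one by metis
  let ?\<mu> = "riemannian_measure M"
  \<comment> \<open>In this chart the glued measure can be computed; the whole construction takes
    place in a closed ball of its image.\<close>
  obtain c where c: "c \<in> atlas M" "fst c \<noteq> {}"
    and \<mu>: "\<And>B. B \<in> lebesgue_sets M \<Longrightarrow> B \<subseteq> fst c \<Longrightarrow> emeasure ?\<mu> B = emeasure (chart_measure c) (snd c ` B)"
    using first_chart[OF ne] by blast
  obtain z0 where "z0 \<in> chart_img c" using c(2) by (auto simp: chart_img_def)
  then obtain r where r: "r > 0" "cball z0 r \<subseteq> chart_img c"
    using open_chart_img[OF c(1)] open_contains_cball by blast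
  let ?Kz = "cball z0 r"
  have Kz: "compact ?Kz" by simp
  note cK = c(1) Kz r(2)
  let ?K = "chart_compact c ?Kz"
  have img: "snd c ` {x \<in> fst c. snd c x \<in> V} = V" if "V \<subseteq> chart_img c" for V
    using that by (auto simp: chart_img_def)
  have fin: "emeasure ?\<mu> ?K < \<infinity>"
    using \<mu>[OF chart_compact_lebesgue_sets[OF cK]] emeasure_chart_measure_compact[OF cK] img[OF r(2)]
    by (simp add: chart_compact_def[OF cK] subset_eq)
  \<comment> \<open>The argument of \<open>bump\<close> is at most 0 from distance r on, and at
    least 1 as long as |z - z0|^2 is at most r^2 / 2, which includes the ball of radius r /
    2.\<close>
  define \<zeta> where "\<zeta> = (\<lambda>z. bump (2 - (2 / r\<^sup>2) * ((z - z0) \<bullet> (z - z0))))"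
  have "C1_on UNIV (\<lambda>z. 2 - (2 / r\<^sup>2) * ((z - z0) \<bullet> (z - z0)))"
    by (intro C1_on_diff C1_on_mult C1_on_inner C1_on_const C1_on_id)
  from C1_on_compose[OF C1_on_bump this] have \<zeta>1: "C1_on UNIV \<zeta>"
    unfolding \<zeta>_def o_def by blast
  have \<zeta>0: "\<forall>z. z \<notin> ?Kz \<longrightarrow> \<zeta> z = 0"
  proof (intro allI impI)
    fix z assume that: "z \<notin> ?Kz"
    have "r\<^sup>2 \<le> (z - z0) \<bullet> (z - z0)"
      using that r(1) by (simp add: dot_square_norm dist_norm norm_minus_commute power_mono)
    then show "\<zeta> z = 0" unfolding \<zeta>_def using r(1) by (intro bump_0) (simp add: field_simps)
  qed
  let ?R = "ball z0 (r / 2)"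
  have RK: "?R \<subseteq> ?Kz" using r(1) by auto
  have \<zeta>R: "\<zeta> z = 1" if "z \<in> ?R" for z
  proof -
    have "(z - z0) \<bullet> (z - z0) \<le> (r / 2)\<^sup>2"
      using that by (simp add: dot_square_norm dist_norm norm_minus_commute power_mono)
    moreover have "(r / 2)\<^sup>2 = r\<^sup>2 / 4" by (simp add: power_divide)
    ultimately have "2 * ((z - z0) \<bullet> (z - z0)) \<le> r\<^sup>2" using inner_ge_zero[of "z - z0"] by linarith
    then show ?thesis unfolding \<zeta>_def using r(1) by (intro bump_1) (simp add: field_simps)
  qed
  \<comment> \<open>The direction of oscillation is any coordinate axis; \<open>undefined\<close>
    just names some index.\<close>
  define e :: "real ^ 'm" where "e = axis undefined 1"
  have ee: "e \<bullet> e = 1" by (simp add: e_def inner_axis_axis)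
  obtain B where B: "B > 0" "\<And>z. z \<in> ?Kz \<Longrightarrow> metric_in M c z e e \<le> B\<^sup>2"
    using metric_in_upper_bound[OF cK] by blast

  obtain D where D: "D \<ge> 0" "\<And>h d G. h \<ge> 0 \<Longrightarrow> C1_on UNIV G \<Longrightarrow> \<forall>z. z \<notin> ?Kz \<longrightarrow> G z = 0 \<Longrightarrow>
     delta_S M sph p (geo \<circ> chart_extension c d G) (geo \<circ> chart_extension c d (\<lambda>z. G z + h * \<zeta> z))
       \<le> ennreal (((h * D) powr p * measure ?\<mu> ?K) powr (1 / p))"
    using delta_S_geo_le[OF cK ne fin \<zeta>1 \<zeta>0, of p] p by auto
  define X where "X = D powr p * measure ?\<mu> ?K"
  have X: "X \<ge> 0" by (simp add: X_def)
  \<comment> \<open>Since h is at most 1 and p at least 1, h^p X is at most h X, which is less than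
    \<open>\<delta>\<close>^p. The summand in X + 1 covers X = 0. The bound by 1 also keeps h below
    pi, so that \<open>geo h\<close> and \<open>geo 0\<close> differ.\<close>
  define h where "h = min 1 (\<delta> powr p / (2 * (X + 1)))"
  have h: "0 < h" "h \<le> 1" using \<delta>(1) X by (auto simp: h_def)
  have "((h * D) powr p * measure ?\<mu> ?K) powr (1 / p) < \<delta>"
  proof -
    have "(h * D) powr p * measure ?\<mu> ?K = h powr p * X"
      using h D(1) by (simp add: X_def powr_mult)
    also have "\<dots> \<le> h powr 1 * X"
      using h p X by (intro mult_right_mono powr_mono') auto
    also have "\<dots> \<le> \<delta> powr p / (2 * (X + 1)) * X"
      using h X by (intro mult_right_mono) (auto simp: h_def)
    also have "\<dots> < \<delta> powr p"
      using X \<delta>(1) by (simp add: divide_less_eq)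
    finally have "((h * D) powr p * measure ?\<mu> ?K) powr (1 / p) < (\<delta> powr p) powr (1 / p)"
      using p by (intro powr_less_mono2) auto
    also have "\<dots> = \<delta>" using p \<delta>(1) by (simp add: powr_powr)
    finally show ?thesis .
  qed
  then have small: "delta_S M sph p (geo \<circ> chart_extension c d G) (geo \<circ> chart_extension c d (\<lambda>z. G z + h * \<zeta> z)) < ennreal \<delta>"
    if "C1_on UNIV G" "\<forall>z. z \<notin> ?Kz \<longrightarrow> G z = 0" for d G
    using D(2)[of h G d] that h(1) by (auto intro!: ennreal_lessI \<delta>(1) elim!: le_less_trans)

  let ?c' = "\<lambda>t. differential sph \<iota> (geo t) (dgc t)"
  have cont: "continuous_on (sphere 0 1) \<iota>"
    using \<iota>(2) by (simp add: embedding_map_def homeomorphic_eq_everything_map continuous_map_in_subtopology)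
  have inj: "inj_on \<iota> (sphere 0 1)"
    using \<iota>(2) by (simp add: embedding_map_def homeomorphic_eq_everything_map)
  have "bounded (range (\<iota> \<circ> geo))"
  proof (rule bounded_subset)
    show "bounded (\<iota> ` sphere 0 1)"
      by (intro compact_imp_bounded compact_continuous_image cont compact_sphere)
    show "range (\<iota> \<circ> geo) \<subseteq> \<iota> ` sphere 0 1" using geo_sphere by auto
  qed
  moreover have "(\<iota> \<circ> geo) h \<noteq> (\<iota> \<circ> geo) 0"
    using inj_onD[OF inj _ geo_sphere geo_sphere] geo_neq[OF h] by (metis comp_apply)
  ultimately obtain s0 where s0: "?c' (s0 + h) \<noteq> ?c' s0"
    using derivative_not_periodic[OF compose_geo_derivative(1)[OF \<iota>(1)]] by blast
  \<comment> \<open>Half of the gap at \<open>s0\<close>, so that by continuity the gap still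
    exceeds \<open>\<eta>\<close> on a whole interval; its radius A becomes the amplitude.\<close>
  define \<eta> where "\<eta> = norm (?c' s0 - ?c' (s0 + h)) / 2"
  have \<eta>: "\<eta> > 0" using s0 by (simp add: \<eta>_def)
  have "continuous_on UNIV (\<lambda>t. norm (?c' t - ?c' (t + h)))"
    by (intro continuous_intros compose_geo_derivative(2)[OF \<iota>(1)]
        continuous_on_compose2[OF compose_geo_derivative(2)[OF \<iota>(1)]]) auto
  then have "open ((\<lambda>t. norm (?c' t - ?c' (t + h))) -` {\<eta><..})" by (intro open_vimage) auto
  moreover have "s0 \<in> (\<lambda>t. norm (?c' t - ?c' (t + h))) -` {\<eta><..}" using \<eta> by (simp add: \<eta>_def)
  ultimately obtain A where A: "A > 0" "cball s0 A \<subseteq> (\<lambda>t. norm (?c' t - ?c' (t + h))) -` {\<eta><..}"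
    using open_contains_cball by blast

  define mR where "mR = emeasure (chart_measure c) ?R"
  have Rc: "?R \<subseteq> chart_img c" using RK r(2) by blast
  have "mR > 0" unfolding mR_def
    using r(1) by (intro emeasure_chart_measure_open[OF c(1)] Rc) auto
  moreover have "mR \<le> emeasure (chart_measure c) ?Kz"
    unfolding mR_def using RK by (intro emeasure_mono) auto
  then have "mR < \<infinity>" using emeasure_chart_measure_compact[OF cK] by (simp add: le_less_trans)
  ultimately obtain m where m: "mR = ennreal m" "m > 0"
    by (cases mR) auto
  \<comment> \<open>The target for the derivative difference on a set of measure at least m / 2: Y
    at least 1 gives Y^p at least Y, and Y at least 2 / m then gives Y^p m / 2 at least 1.\<close>
  define Y where "Y = max 1 (2 / m)"
  have Y: "Y \<ge> 1" "Y \<ge> 2 / m" by (auto simp: Y_def)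
  \<comment> \<open>The solution of \<open>\<eta>\<close> A freq / (2 B) = Y. Here A freq / 2 bounds
    the slope from below where the cosine exceeds 1/2 in absolute value, and B bounds the length of
    the coordinate vector.\<close>
  define freq where "freq = 2 * B * Y / (\<eta> * A)"
  have freq: "freq > 0" using B(1) Y(1) \<eta> A(1) by (simp add: freq_def)

  \<comment> \<open>The part of the inner ball where the slope is not small. Cosine and sine cannot
    both be at most 1/2 in absolute value, so the phases 0 and pi / 2 together cover the ball, and
    one of them catches at least half of its measure.\<close>
  define T where "T = (\<lambda>\<beta>. ?R \<inter> {z. 1 / 2 < \<bar>cos (freq * (z \<bullet> e) + \<beta>)\<bar>})"
  have T_open: "open (T \<beta>)" for \<beta>
    unfolding T_def by (intro open_Int open_ball open_Collect_less continuous_intros)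
  have Tc: "T \<beta> \<subseteq> chart_img c" for \<beta> using Rc by (auto simp: T_def)
  have "?R \<subseteq> T 0 \<union> T (pi / 2)"
  proof
    fix z assume z: "z \<in> ?R"
    let ?t = "freq * (z \<bullet> e)"
    have "1 / 2 < \<bar>cos ?t\<bar> \<or> 1 / 2 < \<bar>sin ?t\<bar>"
    proof (rule ccontr)
      assume "\<not> ?thesis"
      then have "\<bar>cos ?t\<bar> \<le> 1 / 2" "\<bar>sin ?t\<bar> \<le> 1 / 2" by simp_all
      from power_mono[OF this(1) abs_ge_zero, of 2] power_mono[OF this(2) abs_ge_zero, of 2]
      have "(cos ?t)\<^sup>2 \<le> 1 / 4" "(sin ?t)\<^sup>2 \<le> 1 / 4" by (simp_all add: power_divide)
      then show False using sin_cos_squared_add[of ?t] by linarith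
    qed
    moreover have "cos (?t + pi / 2) = - sin ?t" by (simp add: cos_add)
    ultimately show "z \<in> T 0 \<union> T (pi / 2)" using z by (auto simp: T_def)
  qed
  then have "mR \<le> emeasure (chart_measure c) (T 0 \<union> T (pi / 2))"
    unfolding mR_def using T_open by (intro emeasure_mono) auto
  also have "\<dots> \<le> emeasure (chart_measure c) (T 0) + emeasure (chart_measure c) (T (pi / 2))"
    using T_open by (intro emeasure_subadditive) auto
  finally have sum: "ennreal m \<le> emeasure (chart_measure c) (T 0) + emeasure (chart_measure c) (T (pi / 2))"
    by (simp add: m)
  have "\<exists>\<beta>. ennreal (m / 2) \<le> emeasure (chart_measure c) (T \<beta>)"
  proof (rule ccontr)
    assume "\<not> ?thesis"
    then have lt: "emeasure (chart_measure c) (T \<beta>) < ennreal (m / 2)" for \<beta> by (simp add: not_le)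
    have "\<exists>a. emeasure (chart_measure c) (T \<beta>) = ennreal a \<and> 0 \<le> a \<and> a < m / 2" for \<beta>
      using lt[of \<beta>] m(2) by (cases "emeasure (chart_measure c) (T \<beta>)") (auto simp: ennreal_less_iff)
    then obtain a where a: "\<And>\<beta>. emeasure (chart_measure c) (T \<beta>) = ennreal (a \<beta>)" "\<And>\<beta>. 0 \<le> a \<beta>" "\<And>\<beta>. a \<beta> < m / 2"
      by metis
    have "ennreal m \<le> ennreal (a 0 + a (pi / 2))" using sum a by (simp add: ennreal_plus)
    then have "m \<le> a 0 + a (pi / 2)" using a(2)[of 0] a(2)[of "pi / 2"] by (subst (asm) ennreal_le_iff) auto
    then show False using a(3)[of 0] a(3)[of "pi / 2"] by linarith
  qed
  then obtain \<beta> where \<beta>: "ennreal (m / 2) \<le> emeasure (chart_measure c) (T \<beta>)" by blast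

  \<comment> \<open>On the inner ball this is a pure sine of amplitude A, so the phase there stays
    within A of \<open>s0\<close> whatever the frequency.\<close>
  define G where "G = (\<lambda>z. \<zeta> z * (A * sin (freq * (z \<bullet> e) + \<beta>)))"
  have G1: "C1_on UNIV G"
    unfolding G_def by (intro C1_on_mult \<zeta>1 C1_on_const C1_on_sin C1_on_add C1_on_inner_left)
  have G0: "\<forall>z. z \<notin> ?Kz \<longrightarrow> G z = 0" using \<zeta>0 by (simp add: G_def)
  have H1: "C1_on UNIV (\<lambda>z. G z + h * \<zeta> z)" by (intro C1_on_add C1_on_mult G1 \<zeta>1 C1_on_const)
  have H0: "\<forall>z. z \<notin> ?Kz \<longrightarrow> G z + h * \<zeta> z = 0" using G0 \<zeta>0 by simp
  define u where "u = chart_extension c s0 G"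
  define v where "v = chart_extension c s0 (\<lambda>z. G z + h * \<zeta> z)"
  have u: "C1_map M u" unfolding u_def by (rule C1_map_chart_extension[OF cK G1 G0])
  have v: "C1_map M v" unfolding v_def by (rule C1_map_chart_extension[OF cK H1 H0])
  \<comment> \<open>On the inner ball the cutoff is identically 1: there u and v differ by exactly h
    and have equal differentials.\<close>
  have fd\<zeta>: "fd \<zeta> z = 0" if "z \<in> ?R" for z
  proof (rule fd_eqI)
    have "((\<lambda>z. 1) has_derivative blinfun_apply 0) (at z)" by (simp add: zero_blinfun.rep_eq)
    then show "(\<zeta> has_derivative blinfun_apply 0) (at z)"
      by (rule has_derivative_transform_within_open[OF _ open_ball that]) (simp add: \<zeta>R)
  qed
  have fdG: "fd G z e = A * freq * cos (freq * (z \<bullet> e) + \<beta>)" if "z \<in> ?R" for z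
  proof -
    have "((\<lambda>z. A * sin (freq * (z \<bullet> e) + \<beta>)) has_derivative (\<lambda>w. A * (cos (freq * (z \<bullet> e) + \<beta>) * (freq * (w \<bullet> e))))) (at z)"
      by (auto intro!: derivative_eq_intros)
    then have "(G has_derivative (\<lambda>w. A * (cos (freq * (z \<bullet> e) + \<beta>) * (freq * (w \<bullet> e))))) (at z)"
      by (rule has_derivative_transform_within_open[OF _ open_ball that]) (simp add: G_def \<zeta>R)
    from has_derivative_unique[OF C1_on_imp_has_derivative[OF G1 UNIV_I] this]
    show ?thesis by (simp add: ee)
  qed
  define S where "S = {x \<in> fst c. snd c x \<in> T \<beta>}"
  have S: "S \<in> lebesgue_sets M"
    unfolding S_def by (rule openin_lebesgue_sets[OF openin_chart_preimage[OF c(1) T_open]])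
  have "1 \<le> delta_iota M \<iota> p (geo \<circ> u) (geo \<circ> v)"
  proof (rule delta_iota_geo_ge[OF ne _ \<iota>(1) u v S])
    show "0 < p" "0 \<le> Y" using p Y by auto
    fix x assume x: "x \<in> S"
    then have xc: "x \<in> fst c" and zT: "snd c x \<in> T \<beta>" by (auto simp: S_def)
    have xp: "x \<in> points M" using xc chart_domain_subset[OF c(1)] by auto
    let ?z = "snd c x"
    have zR: "?z \<in> ?R" and cos: "1 / 2 < \<bar>cos (freq * (?z \<bullet> e) + \<beta>)\<bar>" using zT by (auto simp: T_def)
    show "differential M v x = differential M u x"
      unfolding u_def v_def differential_chart_extension[OF cK G1 G0 xc] differential_chart_extension[OF cK H1 H0 xc]
        fd_add_scaled[OF G1 \<zeta>1] fd\<zeta>[OF zR] by simp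
    have ux: "u x = s0 + A * sin (freq * (?z \<bullet> e) + \<beta>)"
      using xc by (simp add: u_def chart_extension_def G_def \<zeta>R[OF zR])
    have vx: "v x = u x + h"
      using xc by (simp add: u_def v_def chart_extension_def \<zeta>R[OF zR])
    have "u x \<in> cball s0 A"
      using A(1) by (simp add: ux dist_real_def abs_mult mult_left_le)
    then have 1: "\<eta> \<le> norm (?c' (u x) - ?c' (v x))" using A(2) vx by force
    \<comment> \<open>The tangent vector at x with components e in the chart c. Testing the
      differential on it isolates the fast direction.\<close>
    define w where "w = tangent_change c (chart_at M x) x e"
    have "tangent_change (chart_at M x) c x w = e"
      unfolding w_def by (rule tangent_change_inverse[OF c(1) chart_at(1)[OF xp] xc chart_at(2)[OF xp]])
    then have "differential M u x w = A * freq * cos (freq * (?z \<bullet> e) + \<beta>)"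
      unfolding u_def differential_chart_extension[OF cK G1 G0 xc] by (simp add: fdG[OF zR])
    then have "A * freq * (1 / 2) \<le> \<bar>differential M u x w\<bar>"
      using cos A(1) freq by (simp add: abs_mult)
    also have "\<dots> \<le> sqrt (metric M x w w) * conorm (metric M x) (differential M u x)"
      by (rule abs_le_conorm[OF inner_product_metric[OF xp]])
    also have "\<dots> \<le> B * conorm (metric M x) (differential M u x)"
    proof (rule mult_right_mono[OF _ conorm_nonneg])
      have "metric M x w w \<le> B\<^sup>2"
        unfolding w_def metric_in_tangent_change[OF c(1) xc] using B(2) zR RK by blast
      then have "sqrt (metric M x w w) \<le> sqrt (B\<^sup>2)" by (rule real_sqrt_le_mono)
      then show "sqrt (metric M x w w) \<le> B" using B(1) by simp
    qed
    finally have 2: "A * freq / (2 * B) \<le> conorm (metric M x) (differential M u x)"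
      using B(1) by (simp add: field_simps)
    have "Y = \<eta> * (A * freq / (2 * B))" using \<eta> A(1) B(1) by (simp add: freq_def)
    also have "\<dots> \<le> norm (?c' (u x) - ?c' (v x)) * conorm (metric M x) (differential M u x)"
      using 1 2 \<eta> A(1) B(1) freq by (intro mult_mono) auto
    finally show "Y \<le> norm (?c' (u x) - ?c' (v x)) * conorm (metric M x) (differential M u x)" .
  next
    have "emeasure ?\<mu> S = emeasure (chart_measure c) (T \<beta>)"
      using \<mu>[OF S] img[OF Tc] by (simp add: S_def subset_eq)
    then have "ennreal (Y powr p) * ennreal (m / 2) \<le> ennreal (Y powr p) * emeasure ?\<mu> S"
      using \<beta> by (simp add: mult_left_mono)
    moreover have "1 \<le> Y powr p * (m / 2)"
    proof -
      have "1 = 2 / m * (m / 2)" using m(2) by simp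
      also have "\<dots> \<le> Y powr 1 * (m / 2)" using Y m(2) by (intro mult_right_mono) auto
      also have "\<dots> \<le> Y powr p * (m / 2)" using Y m(2) p by (intro mult_right_mono powr_mono) auto
      finally show ?thesis .
    qed
    then have "ennreal 1 \<le> ennreal (Y powr p * (m / 2))" by (rule ennreal_leI)
    moreover have "ennreal (Y powr p * (m / 2)) = ennreal (Y powr p) * ennreal (m / 2)"
      using m(2) by (intro ennreal_mult) auto
    ultimately show "1 \<le> ennreal (Y powr p) * emeasure ?\<mu> S"
      unfolding ennreal_1[symmetric] by (metis order_trans)
  qed
  moreover have "geo \<circ> u \<in> homogeneous_sobolev M sph p" "geo \<circ> v \<in> homogeneous_sobolev M sph p"
    using p nn_integral_conorm_finite[OF cK ne fin G1 G0, of p s0] nn_integral_conorm_finite[OF cK ne fin H1 H0, of p s0]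
    by (auto intro!: geo_in_homogeneous_sobolev u v ne simp: u_def[symmetric] v_def[symmetric])
  moreover have "delta_S M sph p (geo \<circ> u) (geo \<circ> v) < ennreal \<delta>"
    unfolding u_def v_def by (rule small[OF G1 G0])
  ultimately show False using \<delta>(2)[of "geo \<circ> u" "geo \<circ> v"] by (simp add: not_less[symmetric])
qed

end

theorem proposition4p23:
  fixes M :: "('p, 'm::finite) rmfd"
    and p :: real
    and \<iota> :: "(real ^ 'n::finite) \<times> real \<Rightarrow> (real ^ 'k::finite)"
  assumes "riemannian_manifold M" and "points M \<noteq> {}"
    and "1 \<le> p"
    and "CARD('n) \<ge> 2"
    and "isometric_embedding (round_sphere :: ((real ^ 'n) \<times> real, 'n) rmfd) \<iota>"
    and "closed (\<iota> ` points (round_sphere :: ((real ^ 'n) \<times> real, 'n) rmfd))"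
  shows "\<not> uniformly_continuous_edist
           (homogeneous_sobolev M (round_sphere :: ((real ^ 'n) \<times> real, 'n) rmfd) p)
           (delta_S M round_sphere p)
           (delta_iota M \<iota> p)
           (\<lambda>u. u)"
proof -
  \<comment> \<open>Two distinct coordinate axes supply the orthonormal pair that spans the plane of
    the great circle.\<close>
  obtain i j :: 'n where "i \<noteq> j"
    using assms(4) card_le_Suc0_iff_eq[of "UNIV :: 'n set"] by (auto simp: not_less_eq_eq[symmetric])
  then interpret riemannian_circle M "axis i 1" "axis j 1"
    using assms(1) by unfold_locales (auto simp: inner_axis_axis)
  show ?thesis
    using assms(5) by (intro not_uniformly_continuous_delta_iota assms(2,3)) (simp_all add: isometric_embedding_def)
qed

end
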